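(* Assume Condition D and that $(H_1,H_2)$ is $U$-controllable. Then: 1) there are constants $c>0$, $0<q<1$ such that $|P_n(A)-\pi(A)|\le cq^n$ for all Borel $A\subset U(N)$ and all $n\ge1$; 2) for every bounded measurable $f$ on $U(N)$, almost surely $\frac1T\int_0^Tf(X(t))\,dt\to\int_{U(N)}f\,d\pi$ as $T\to\infty$.
   Context: $\mathcal H=\mathbb C^N$, $N>1$; $H_1,H_2$ Hermitian, $U_k^t=e^{-itH_k}$. For $s_1,\dots,s_n\ge0$, $J_n(s_1,\dots,s_n)=U_{k_n}^{s_n}\cdots U_{k_2}^{s_2}U_1^{s_1}$ with $k_j=1$ for odd $j$, $k_j=2$ for even $j$; $\mathcal J_n(H_1,H_2)=\{J_n(s):s_j\ge0\}$; $(H_1,H_2)$ is $U$-controllable if $\mathcal J_n(H_1,H_2)=U(N)$ for some $n$. Condition D: $\tau_1,\tau_2,\dots$ are i.i.d. positive random variables with $\mathbb E\tau_1<\infty$ and a density positive on $[0,\infty)$; $t_0=0$, $t_n=\tau_1+\dots+\tau_n$. Define $X(0)=E$ and $X(t)=J_n(\tau_1,\dots,\tau_{n-1},t-t_{n-1})$ for $t_{n-1}\le t<t_n$; $X_n=J_n(\tau_1,\dots,\tau_n)$, and $P_n$ is the distribution of $X_n$ on $U(N)$. $\pi$ is the normalized Haar measure on $U(N)$. *)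

theory Defs
  imports "HOL-Probability.Probability"
begin

type_synonym 'n cmat = "complex ^'n ^'n"

definition ctrans :: "'n::finite cmat \<Rightarrow> 'n cmat" where
  "ctrans A = (\<chi> i j. cnj (A $ j $ i))"

definition hermitian :: "'n::finite cmat \<Rightarrow> bool" where
  "hermitian H \<longleftrightarrow> ctrans H = H"

definition unitary_group :: "'n::finite cmat set" where
  "unitary_group = {A. ctrans A ** A = mat 1}"

definition cscale :: "complex \<Rightarrow> 'n::finite cmat \<Rightarrow> 'n cmat" where
  "cscale c A = (\<chi> i j. c * A $ i $ j)"

fun mpow :: "'n::finite cmat \<Rightarrow> nat \<Rightarrow> 'n cmat" where
  "mpow A 0 = mat 1"
| "mpow A (Suc k) = A ** mpow A k"

definition mexp :: "'n::finite cmat \<Rightarrow> 'n cmat" where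
  "mexp A = (\<Sum>k. (1 / fact k) *\<^sub>R mpow A k)"

definition evol :: "'n::finite cmat \<Rightarrow> real \<Rightarrow> 'n cmat" where
  "evol H t = mexp (cscale (- \<i> * complex_of_real t) H)"

text \<open>J_n(s_1,...,s_n) = U_{k_n}^{s_n} ... U_1^{s_1}, k_j = 1 for odd j, 2 for even j.
  The argument s is indexed from 1 (s 0 is irrelevant).\<close>
fun Jn :: "'n::finite cmat \<Rightarrow> 'n cmat \<Rightarrow> (nat \<Rightarrow> real) \<Rightarrow> nat \<Rightarrow> 'n cmat" where
  "Jn H1 H2 s 0 = mat 1"
| "Jn H1 H2 s (Suc j) = evol (if odd (Suc j) then H1 else H2) (s (Suc j)) ** Jn H1 H2 s j"

definition U_controllable :: "'n::finite cmat \<Rightarrow> 'n cmat \<Rightarrow> bool" where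
  "U_controllable H1 H2 \<longleftrightarrow>
     (\<exists>n. {Jn H1 H2 s n | s. \<forall>j. s j \<ge> 0} = unitary_group)"

definition U_borel :: "'n::finite cmat measure" where
  "U_borel = restrict_space borel unitary_group"

definition is_haar :: "'n::finite cmat measure \<Rightarrow> bool" where
  "is_haar \<pi> \<longleftrightarrow> prob_space \<pi> \<and> sets \<pi> = sets U_borel \<and> space \<pi> = unitary_group \<and>
     (\<forall>g\<in>unitary_group. distr \<pi> U_borel (\<lambda>x. g ** x) = \<pi>)"

definition jump_time :: "(nat \<Rightarrow> 'w \<Rightarrow> real) \<Rightarrow> 'w \<Rightarrow> nat \<Rightarrow> real" where
  "jump_time \<tau> \<omega> n = (\<Sum>i\<in>{1..n}. \<tau> i \<omega>)"

definition Xn :: "'n::finite cmat \<Rightarrow> 'n cmat \<Rightarrow> (nat \<Rightarrow> 'w \<Rightarrow> real) \<Rightarrow> nat \<Rightarrow> 'w \<Rightarrow> 'n cmat" where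
  "Xn H1 H2 \<tau> n \<omega> = Jn H1 H2 (\<lambda>i. \<tau> i \<omega>) n"

text \<open>X(t) = J_n(tau_1,...,tau_{n-1}, t - t_{n-1}) for t_{n-1} \<le> t < t_n (t \<ge> 0);
  n is the least index with t < t_n.\<close>
definition Xt :: "'n::finite cmat \<Rightarrow> 'n cmat \<Rightarrow> (nat \<Rightarrow> 'w \<Rightarrow> real) \<Rightarrow> real \<Rightarrow> 'w \<Rightarrow> 'n cmat" where
  "Xt H1 H2 \<tau> t \<omega> =
    (let n = (LEAST n. t < jump_time \<tau> \<omega> n)
     in Jn H1 H2 (\<lambda>i. if i < n then \<tau> i \<omega> else t - jump_time \<tau> \<omega> (n - 1)) n)"

end

theory Submission
  imports Defs
begin

text \<open>
  Up to a shift of parity, \<open>X\<^sub>n\<close> is a random walk on the compact group, and its transition operators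
  contract the oscillation of every bounded function (Doeblin--Dobrushin). The key is a point at
  which the control map has full rank. Its differential is spanned by conjugates of the two
  generators, and controllability makes these span all skew-Hermitian matrices: a skew-Hermitian
  matrix orthogonal to both orbits commutes with the whole group, hence is scalar, the generators
  are traceless, and only determinant one could be reached. Near a full-rank point Brouwer's
  theorem shows that the images of a fixed ball, started from any two points near the identity,
  cover a common ball in a linear chart of the group, while Lipschitz maps do not enlarge Lebesgue
  measure by more than a constant; so the two laws overlap. Left invariance of \<open>\<pi>\<close> alone turns the
  contraction into the exponential bound.

  For the time averages, the integrals over successive cycles have exponentially decaying
  covariances after truncation, so Etemadi's proof of the strong law applies with only a first
  moment; a renewal argument passes from cycles to continuous time.
\<close>

text \<open>Two obstacles shape the proof. The steps alternate between two generators, so pieces of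
  trajectory are joined at even indices only, where the alternation restarts; hence the even block
  lengths. And little regularity is at hand: \<open>p\<close> is positive on nonnegative times but
  has no positive lower bound there, and the control map is handled as a Lipschitz map with a known
  derivative at one point. Overlap is therefore tested set by set: for every Borel \<open>Q\<close>,
  the probability of \<open>Q\<close> from one start plus that of its complement from the other is
  at least a constant. An endpoint common to both starts lies in \<open>Q\<close> or outside and so
  feeds one of the two terms; densities on the group are never compared. A test function with values
  in [0,1] is reduced to its level set at 1/2. Functions are Borel on the whole matrix space and
  compared on the group alone. In the law of large numbers the truncated cycle integrals are bounded
  only by a multiple of the index; uniform covariance bounds come from their conditional means given
  the starting point, which stay below \<open>C * m1\<close>.\<close>

lemma ctrans_nth [simp]: "ctrans A $ i $ j = cnj (A $ j $ i)"
  by (simp add: ctrans_def)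

lemma ctrans_ctrans [simp]: "ctrans (ctrans A) = A"
  by (simp add: vec_eq_iff)

lemma ctrans_mult: "ctrans (A ** B) = ctrans B ** ctrans A"
  by (simp add: vec_eq_iff matrix_matrix_mult_def mult.commute)

lemma ctrans_add: "ctrans (A + B) = ctrans A + ctrans B"
  and ctrans_diff: "ctrans (A - B) = ctrans A - ctrans B"
  and ctrans_scaleR: "ctrans (c *\<^sub>R A) = c *\<^sub>R ctrans A"
  and ctrans_mat_1 [simp]: "ctrans (mat 1) = mat 1"
  by (auto simp: vec_eq_iff mat_def)

lemma linear_ctrans: "linear ctrans"
  by (intro linearI ctrans_add ctrans_scaleR)

lemma bounded_linear_ctrans: "bounded_linear ctrans"
  using linear_ctrans linear_conv_bounded_linear by blast

text \<open>The Euclidean inner product of the matrix type is the real part of the trace of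
  \<open>A ** ctrans B\<close>. Hence multiplication by a matrix has multiplication by its conjugate
  transpose as adjoint, and unitary factors drop out of all norms.\<close>

lemma inner_cmat: "inner A B = (\<Sum>i\<in>UNIV. \<Sum>j\<in>UNIV. Re (A $ i $ j * cnj (B $ i $ j)))"
  for A B :: "'n::finite cmat"
  by (simp add: inner_vec_def inner_complex_def)

lemma inner_mult_left: "inner (A ** X) Y = inner X (ctrans A ** Y)"
  for A X Y :: "'n::finite cmat"
proof -
  have "inner (A ** X) Y = (\<Sum>i\<in>UNIV. \<Sum>j\<in>UNIV. \<Sum>k\<in>UNIV. Re (A $ i $ k * X $ k $ j * cnj (Y $ i $ j)))"
    by (simp add: inner_cmat matrix_matrix_mult_def sum_distrib_right)
  also have "\<dots> = (\<Sum>j\<in>UNIV. \<Sum>i\<in>UNIV. \<Sum>k\<in>UNIV. Re (A $ i $ k * X $ k $ j * cnj (Y $ i $ j)))"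
    by (rule sum.swap)
  also have "\<dots> = (\<Sum>j\<in>UNIV. \<Sum>k\<in>UNIV. \<Sum>i\<in>UNIV. Re (A $ i $ k * X $ k $ j * cnj (Y $ i $ j)))"
    by (intro sum.cong refl sum.swap)
  also have "\<dots> = (\<Sum>k\<in>UNIV. \<Sum>j\<in>UNIV. \<Sum>i\<in>UNIV. Re (A $ i $ k * X $ k $ j * cnj (Y $ i $ j)))"
    by (rule sum.swap)
  also have "\<dots> = inner X (ctrans A ** Y)"
    by (simp add: inner_cmat matrix_matrix_mult_def sum_distrib_left algebra_simps)
  finally show ?thesis .
qed

lemma inner_ctrans: "inner (ctrans X) (ctrans Y) = inner X Y"
  for X Y :: "'n::finite cmat"
  unfolding inner_cmat by (subst sum.swap) (simp add: algebra_simps)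

lemma inner_mult_right: "inner (X ** A) Y = inner X (Y ** ctrans A)"
  for A X Y :: "'n::finite cmat"
  using inner_mult_left[of "ctrans A" "ctrans X" "ctrans Y"]
  by (metis ctrans_ctrans ctrans_mult inner_ctrans)

lemma norm_ctrans [simp]: "norm (ctrans X) = norm X"
  by (simp add: norm_eq_sqrt_inner inner_ctrans)

lemma matrix_add_rdistrib': "(A + B) ** C = A ** C + B ** C" for A B C :: "'n::finite cmat"
  by (simp add: vec_eq_iff matrix_matrix_mult_def distrib_right sum.distrib)

lemma matrix_scaleR_left: "(c *\<^sub>R A) ** B = c *\<^sub>R (A ** B)" for A B :: "'n::finite cmat"
  by (simp add: vec_eq_iff matrix_matrix_mult_def scaleR_sum_right)

lemma matrix_scaleR_right: "A ** (c *\<^sub>R B) = c *\<^sub>R (A ** B)" for A B :: "'n::finite cmat"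
  by (simp add: vec_eq_iff matrix_matrix_mult_def scaleR_sum_right)

lemma bounded_bilinear_cmat_mult: "bounded_bilinear ((**) :: 'n::finite cmat \<Rightarrow> _ \<Rightarrow> 'n cmat)"
  unfolding bilinear_conv_bounded_bilinear[symmetric]
  by (auto simp: bilinear_def intro!: linearI simp: matrix_add_ldistrib matrix_add_rdistrib'
      matrix_scaleR_left matrix_scaleR_right)

interpretation cm: bounded_bilinear "(**) :: 'n::finite cmat \<Rightarrow> _ \<Rightarrow> 'n cmat"
  by (rule bounded_bilinear_cmat_mult)

lemma unitary_left: "u \<in> unitary_group \<Longrightarrow> ctrans u ** u = mat 1"
  by (simp add: unitary_group_def)

lemma unitary_right: "u \<in> unitary_group \<Longrightarrow> u ** ctrans u = mat 1"
  using matrix_left_right_inverse unitary_left by blast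

lemma unitary_one [simp]: "mat 1 \<in> unitary_group"
  by (simp add: unitary_group_def)

lemma unitary_mult: "u \<in> unitary_group \<Longrightarrow> v \<in> unitary_group \<Longrightarrow> u ** v \<in> unitary_group"
  by (simp add: unitary_group_def ctrans_mult)
    (metis matrix_mul_assoc matrix_mul_lid)

lemma unitary_ctrans: "u \<in> unitary_group \<Longrightarrow> ctrans u \<in> unitary_group"
  using unitary_right by (auto simp: unitary_group_def)

lemma unitary_cancel_left: "u \<in> unitary_group \<Longrightarrow> ctrans u ** (u ** X) = X" for u X :: "'n::finite cmat"
  by (simp add: matrix_mul_assoc unitary_left)

lemma norm_unitary_left: "u \<in> unitary_group \<Longrightarrow> norm (u ** X) = norm X" for u X :: "'n::finite cmat"
  by (simp add: norm_eq_sqrt_inner inner_mult_left unitary_cancel_left)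

lemma norm_unitary_right: "u \<in> unitary_group \<Longrightarrow> norm (X ** u) = norm X" for u X :: "'n::finite cmat"
  using norm_ctrans[of "X ** u"] norm_unitary_left[OF unitary_ctrans, of u "ctrans X"]
  by (simp add: ctrans_mult)

lemma closed_unitary_group: "closed (unitary_group :: 'n::finite cmat set)"
proof -
  have "continuous_on UNIV (\<lambda>A :: 'n cmat. ctrans A ** A)"
    by (intro cm.continuous_on bounded_linear.continuous_on[OF bounded_linear_ctrans] continuous_intros)
  moreover have "unitary_group = (\<lambda>A :: 'n cmat. ctrans A ** A) -` {mat 1}"
    by (auto simp: unitary_group_def)
  ultimately show ?thesis
    using closed_vimage[OF closed_singleton, of "\<lambda>A :: 'n cmat. ctrans A ** A" "mat 1"] by simp
qed

lemma compact_unitary_group: "compact (unitary_group :: 'n::finite cmat set)"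
proof -
  have "unitary_group \<subseteq> cball (0 :: 'n cmat) (norm (mat 1 :: 'n cmat))"
  proof
    fix u :: "'n cmat" assume "u \<in> unitary_group"
    from norm_unitary_left[OF this, of "mat 1"] show "u \<in> cball 0 (norm (mat 1 :: 'n cmat))"
      by simp
  qed
  then show ?thesis
    using closed_unitary_group bounded_cball bounded_subset compact_eq_bounded_closed by blast
qed

lemma unitary_group_borel [measurable]: "(unitary_group :: 'n::finite cmat set) \<in> sets borel"
  by (intro borel_closed closed_unitary_group)

section \<open>The matrix exponential\<close>

lemma mpow_scaleR: "mpow (t *\<^sub>R B) k = t ^ k *\<^sub>R mpow B k"
  by (induction k) (simp_all add: matrix_scaleR_left matrix_scaleR_right)

lemma mpow_commute: "X ** B = B ** X \<Longrightarrow> X ** mpow B k = mpow B k ** X"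
  by (induction k) (simp, metis matrix_mul_assoc mpow.simps(2))

text \<open>The norm is the Frobenius norm, used as submultiplicative up to the constant
  \<open>K\<close> of bounded bilinearity. \<open>C\<close> absorbs \<open>K\<close> and, for
  \<open>k = 0\<close>, the norm of the identity.\<close>

lemma mpow_bound: "\<exists>C>0. \<forall>k. norm (mpow B k) \<le> C * C ^ k" for B :: "'n::finite cmat"
proof -
  have "\<exists>K>0. \<forall>(A :: 'n cmat) (B :: 'n cmat). norm (A ** B) \<le> norm A * norm B * K"
    by (rule cm.pos_bounded)
  then obtain K where K: "K > 0" "\<forall>(A :: 'n cmat) (B :: 'n cmat). norm (A ** B) \<le> norm A * norm B * K"
    by (elim exE conjE)
  define C where "C = norm B * K + norm (mat 1 :: 'n cmat) + 1"
  have C: "C \<ge> norm B * K" "C \<ge> norm (mat 1 :: 'n cmat)" "C > 0"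
    using K by (auto simp: C_def intro: add_nonneg_pos)
  have "norm (mpow B k) \<le> C * C ^ k" for k
  proof (induction k)
    case (Suc k)
    have "norm (mpow B (Suc k)) \<le> (norm B * K) * norm (mpow B k)"
      using K(2)[rule_format, of B "mpow B k"] by (simp add: mult_ac)
    also have "\<dots> \<le> C * (C * C ^ k)"
      using C Suc by (intro mult_mono) auto
    finally show ?case by simp
  qed (use C in auto)
  then show ?thesis using C by blast
qed

text \<open>Entrywise, \<open>mexp (t *\<^sub>R B)\<close> is a complex power series in
  \<open>t\<close> that converges everywhere, which makes termwise differentiation of scalar series
  available.\<close>

lemma
  fixes B :: "'n::finite cmat"
  shows summable_mexp: "summable (\<lambda>k. (1 / fact k) *\<^sub>R mpow B k)"
    and summable_mexp_entry: "summable (\<lambda>k. mpow B k $ i $ j / fact k * z ^ k)"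
    and mexp_nth: "mexp (t *\<^sub>R B) $ i $ j = (\<Sum>k. mpow B k $ i $ j / fact k * of_real t ^ k)"
proof -
  have S: "summable (\<lambda>k. (1 / fact k) *\<^sub>R mpow B k)" for B :: "'n cmat"
  proof -
    obtain C where C: "C > 0" "\<And>k. norm (mpow B k) \<le> C * C ^ k"
      using mpow_bound by blast
    have "summable (\<lambda>k. C * (inverse (fact k) * C ^ k))"
      using summable_exp[of C] by (intro summable_mult) auto
    then show ?thesis
    proof (rule summable_comparison_test'[where N=0])
      fix k
      have "norm ((1 / fact k) *\<^sub>R mpow B k) = norm (mpow B k) * inverse (fact k)"
        by (simp add: divide_inverse mult.commute)
      also have "\<dots> \<le> C * C ^ k * inverse (fact k)"
        using C by (intro mult_right_mono) auto
      finally show "norm ((1 / fact k) *\<^sub>R mpow B k) \<le> C * (inverse (fact k) * C ^ k)"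
        by (simp add: mult_ac)
    qed
  qed
  then show "summable (\<lambda>k. (1 / fact k) *\<^sub>R mpow B k)" .
  obtain C where C: "C > 0" "\<And>k. norm (mpow B k) \<le> C * C ^ k"
    using mpow_bound by blast
  have "norm (mpow B k $ i $ j / fact k * z ^ k) \<le> C * (inverse (fact k) * (C * norm z) ^ k)" for k
  proof -
    have "norm (mpow B k $ i $ j) \<le> C * C ^ k"
      using C(2)[of k] by (meson Finite_Cartesian_Product.norm_nth_le order_trans)
    then have "norm (mpow B k $ i $ j) * (inverse (fact k) * norm z ^ k) \<le> C * C ^ k * (inverse (fact k) * norm z ^ k)"
      by (intro mult_right_mono) auto
    then show ?thesis
      by (simp add: norm_mult norm_divide norm_power divide_inverse power_mult_distrib mult_ac norm_inverse)
  qed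
  moreover have "summable (\<lambda>k. C * (inverse (fact k) * (C * norm z) ^ k))"
    using summable_exp[of "C * norm z"] by (intro summable_mult) auto
  ultimately show "summable (\<lambda>k. mpow B k $ i $ j / fact k * z ^ k)"
    by (rule summable_comparison_test'[rotated])
  have bl: "bounded_linear (\<lambda>X :: 'n cmat. X $ i $ j)"
    by (intro bounded_linear_compose[OF bounded_linear_vec_nth bounded_linear_vec_nth])
  show "mexp (t *\<^sub>R B) $ i $ j = (\<Sum>k. mpow B k $ i $ j / fact k * of_real t ^ k)"
    unfolding mexp_def bounded_linear.suminf[OF bl S]
    by (intro arg_cong[of _ _ suminf] ext) (simp add: mpow_scaleR scaleR_conv_of_real[where 'a=complex] divide_simps)
qed

text \<open>Since \<open>mpow B (Suc k)\<close> is \<open>B ** mpow B k\<close>, differentiating the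
  series of an entry gives a row of \<open>B\<close> applied to a column of series; the entries are
  reassembled through the standard basis.\<close>

lemma mexp_has_vector_derivative:
  fixes B :: "'n::finite cmat"
  shows "((\<lambda>t. mexp (t *\<^sub>R B)) has_vector_derivative B ** mexp (t *\<^sub>R B)) (at t within S)"
proof -
  have "((\<lambda>t. mexp (t *\<^sub>R B) $ i $ j) has_vector_derivative (B ** mexp (t *\<^sub>R B)) $ i $ j) (at t within S)" for i j
  proof -
    define c where "c k = mpow B k $ i $ j / fact k" for k
    have "((\<lambda>z. \<Sum>k. c k * z ^ k) has_field_derivative (\<Sum>k. diffs c k * (of_real t) ^ k)) (at (of_real t))"
      by (rule termdiffs_strong_converges_everywhere) (unfold c_def, rule summable_mexp_entry)
    moreover have "diffs c k * (of_real t) ^ k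
        = (\<Sum>l\<in>UNIV. B $ i $ l * (mpow B k $ l $ j / fact k * (of_real t) ^ k))" for k
    proof -
      have "diffs c k = (\<Sum>l\<in>UNIV. B $ i $ l * mpow B k $ l $ j) / fact k"
        by (simp add: diffs_def c_def matrix_matrix_mult_def divide_simps del: of_nat_Suc)
      then show ?thesis by (simp add: sum_divide_distrib sum_distrib_left sum_distrib_right mult_ac)
    qed
    moreover have "(\<Sum>k. \<Sum>l\<in>UNIV. B $ i $ l * (mpow B k $ l $ j / fact k * complex_of_real t ^ k))
        = (\<Sum>l\<in>UNIV. B $ i $ l * (\<Sum>k. mpow B k $ l $ j / fact k * complex_of_real t ^ k))"
      by (subst suminf_sum)
        (intro summable_mult summable_mexp_entry, intro sum.cong refl suminf_mult summable_mexp_entry)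
    ultimately have "((\<lambda>z. \<Sum>k. c k * z ^ k) has_field_derivative (B ** mexp (t *\<^sub>R B)) $ i $ j) (at (of_real t))"
      by (simp add: matrix_matrix_mult_def mexp_nth)
    from has_vector_derivative_real_field[OF this] show ?thesis
      by (simp add: mexp_nth c_def)
  qed
  note entry = this
  show ?thesis
    unfolding has_vector_derivative_def
  proof (subst has_derivative_componentwise_within, intro ballI)
    fix b :: "'n cmat" assume "b \<in> Basis"
    then obtain i j c where b: "b = axis i (axis j c)"
      by (auto simp: Basis_vec_def)
    show "((\<lambda>t. mexp (t *\<^sub>R B) \<bullet> b) has_derivative (\<lambda>h. (h *\<^sub>R (B ** mexp (t *\<^sub>R B))) \<bullet> b)) (at t within S)"
      using has_derivative_inner_left[OF entry[of i j, unfolded has_vector_derivative_def], of c]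
      by (simp add: b inner_axis)
  qed
qed

lemma mexp_0 [simp]: "mexp (0 :: 'n::finite cmat) = mat 1"
proof -
  have "mpow (0 :: 'n cmat) k = 0" if "k \<noteq> 0" for k
    using that by (cases k) (simp_all add: cm.zero_left)
  then show ?thesis
    unfolding mexp_def by (subst suminf_finite[of "{0}"]) simp_all
qed

lemma mexp_commute:
  fixes B X :: "'n::finite cmat"
  assumes "X ** B = B ** X"
  shows "X ** mexp (t *\<^sub>R B) = mexp (t *\<^sub>R B) ** X"
proof -
  have "X ** (t *\<^sub>R B) = (t *\<^sub>R B) ** X"
    by (simp add: assms matrix_scaleR_left matrix_scaleR_right)
  from mpow_commute[OF this] show ?thesis
    unfolding mexp_def
    by (subst bounded_linear.suminf[OF cm.bounded_linear_right summable_mexp],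
        subst bounded_linear.suminf[OF cm.bounded_linear_left summable_mexp])
      (simp add: matrix_scaleR_left matrix_scaleR_right)
qed

lemma const_of_zero_vector_derivative:
  fixes f :: "real \<Rightarrow> 'a::real_normed_vector"
  assumes "\<And>t. (f has_vector_derivative 0) (at t)"
  shows "f t = f 0"
proof -
  have "\<exists>c. \<forall>x\<in>UNIV. f x = c"
    by (rule has_derivative_zero_constant) (use assms in \<open>auto simp: has_vector_derivative_def\<close>)
  then show ?thesis by auto
qed

lemma vector_derivative_cmat_mult:
  fixes f g :: "real \<Rightarrow> 'n::finite cmat"
  assumes "(f has_vector_derivative f') (at t within S)" "(g has_vector_derivative g') (at t within S)"
  shows "((\<lambda>t. f t ** g t) has_vector_derivative (f t ** g' + f' ** g t)) (at t within S)"
  by (rule cm.has_vector_derivative[OF assms])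

text \<open>\<open>B\<close> commutes with its exponential, so the product of the exponentials at
  \<open>- u\<close> and \<open>u + t\<close> has derivative zero in \<open>u\<close> and keeps its
  value at \<open>u = 0\<close>. Taking \<open>t = 0\<close> shows that opposite arguments give
  inverse matrices.\<close>

lemma mexp_add:
  fixes B :: "'n::finite cmat"
  shows "mexp ((s + t) *\<^sub>R B) = mexp (s *\<^sub>R B) ** mexp (t *\<^sub>R B)"
proof -
  let ?F = "\<lambda>t. mexp (t *\<^sub>R B)"
  have comm: "B ** ?F u = ?F u ** B" for u
    by (rule mexp_commute) simp
  have neg: "((\<lambda>u. ?F (- u)) has_vector_derivative - (B ** ?F (- u))) (at u)" for u
    using vector_diff_chain_at[of uminus "-1" u ?F, OF _ mexp_has_vector_derivative]
    by (simp add: o_def has_vector_derivative_minus[OF has_vector_derivative_id, simplified])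
  have shift: "((\<lambda>u. ?F (u + t)) has_vector_derivative (B ** ?F (u + t))) (at u)" for u t
    using vector_diff_chain_at[of "\<lambda>u. u + t" 1 u ?F, OF _ mexp_has_vector_derivative]
    by (simp add: o_def has_vector_derivative_add_const)
  have "((\<lambda>u. ?F (- u) ** ?F (u + t)) has_vector_derivative 0) (at u)" for u t
  proof -
    have "?F (- u) ** (B ** ?F (u + t)) + (- (B ** ?F (- u))) ** ?F (u + t) = 0"
      unfolding comm[of "- u"] cm.minus_left by (simp add: matrix_mul_assoc)
    then show ?thesis using vector_derivative_cmat_mult[OF neg[where u=u] shift[where u=u and t=t]] by simp
  qed
  from const_of_zero_vector_derivative[OF this] have *: "?F (- s) ** ?F (s + t) = ?F t" for s t
    by simp
  from *[of "- s" 0] have "?F s ** ?F (- s) = mat 1" by simp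
  then show ?thesis using *[of s t] by (metis matrix_mul_assoc matrix_mul_lid)
qed

section \<open>The evolution groups\<close>

definition gen :: "'n::finite cmat \<Rightarrow> 'n cmat" where
  "gen H = cscale (- \<i>) H"

definition skew :: "'n::finite cmat \<Rightarrow> bool" where
  "skew A \<longleftrightarrow> ctrans A = - A"

lemma evol_eq_mexp: "evol H t = mexp (t *\<^sub>R gen H)"
  unfolding evol_def gen_def cscale_def by (rule arg_cong[of _ _ mexp]) (simp add: vec_eq_iff scaleR_conv_of_real[where 'a=complex])

lemma skew_gen: "hermitian H \<Longrightarrow> skew (gen H)"
  unfolding hermitian_def skew_def gen_def cscale_def
  by (auto simp: vec_eq_iff)

lemma mexp_unitary:
  assumes "skew A"
  shows "mexp (t *\<^sub>R A) \<in> unitary_group"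
proof -
  let ?F = "\<lambda>t. mexp (t *\<^sub>R A)"
  have "((\<lambda>t. ctrans (?F t) ** ?F t) has_vector_derivative 0) (at t)" for t
  proof -
    have "((\<lambda>t. ctrans (?F t)) has_vector_derivative ctrans (A ** ?F t)) (at t)"
      by (rule bounded_linear.has_vector_derivative[OF bounded_linear_ctrans mexp_has_vector_derivative])
    from vector_derivative_cmat_mult[OF this mexp_has_vector_derivative, of A]
    show ?thesis
      using assms by (simp add: ctrans_mult skew_def matrix_mul_assoc cm.minus_left cm.minus_right)
  qed
  from const_of_zero_vector_derivative[OF this] show ?thesis
    by (simp add: unitary_group_def)
qed

lemma evol_unitary: "hermitian H \<Longrightarrow> evol H t \<in> unitary_group"
  by (simp add: evol_eq_mexp mexp_unitary skew_gen)

lemma evol_0 [simp]: "evol H 0 = mat 1"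
  by (simp add: evol_eq_mexp)

lemma evol_has_vector_derivative:
  "(evol H has_vector_derivative gen H ** evol H t) (at t within S)"
  using mexp_has_vector_derivative[of "gen H" t S] by (simp add: evol_eq_mexp[abs_def])

text \<open>The velocity is a fixed generator times a unitary matrix, so its norm is constant and
  the bound is global in time.\<close>

lemma evol_lipschitz:
  assumes "hermitian H"
  shows "norm (evol H s - evol H t) \<le> norm (gen H) * \<bar>s - t\<bar>"
proof -
  have "norm (evol H s - evol H t) \<le> norm (gen H) * norm (s - t)"
  proof (rule differentiable_bound[of UNIV "evol H" "\<lambda>t h. h *\<^sub>R (gen H ** evol H t)"])
    fix x :: real
    show "(evol H has_derivative (\<lambda>h. h *\<^sub>R (gen H ** evol H x))) (at x within UNIV)"
      using evol_has_vector_derivative[of H x] by (simp add: has_vector_derivative_def)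
    show "onorm (\<lambda>h. h *\<^sub>R (gen H ** evol H x)) \<le> norm (gen H)"
      by (rule onorm_le) (simp add: norm_unitary_right evol_unitary assms mult.commute)
  qed auto
  then show ?thesis by simp
qed

lemma continuous_on_evol: "continuous_on S (evol H)"
  by (rule continuous_on_vector_derivative) (rule evol_has_vector_derivative)

lemma evol_measurable [measurable]: "evol H \<in> borel_measurable borel"
  by (intro borel_measurable_continuous_onI continuous_on_evol)

section \<open>Controllability and the rank condition\<close>

lemma mexp_has_vector_derivative_0:
  "((\<lambda>t. mexp (t *\<^sub>R B)) has_vector_derivative B) (at 0)"
  using mexp_has_vector_derivative[of B 0 UNIV] by simp

text \<open>The commutator \<open>X\<close> of \<open>K\<close> and \<open>A\<close> is skew. Along
  conjugations of \<open>A\<close> by \<open>mexp (t *\<^sub>R X)\<close> the inner product with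
  \<open>K\<close> vanishes identically, while its derivative at 0 is the squared norm of
  \<open>X\<close>.\<close>

lemma commute_if_orthogonal_to_orbit:
  fixes A K :: "'n::finite cmat"
  assumes A: "skew A" and K: "skew K"
    and orth: "\<And>g. g \<in> unitary_group \<Longrightarrow> inner K (ctrans g ** A ** g) = 0"
  shows "K ** A = A ** K"
proof -
  define X where "X = K ** A - A ** K"
  have cA: "ctrans A = - A" and cK: "ctrans K = - K"
    using A K by (auto simp: skew_def)
  have X: "skew X"
    by (simp add: skew_def X_def ctrans_diff ctrans_mult cA cK cm.minus_left cm.minus_right)
  let ?F = "\<lambda>t. mexp (t *\<^sub>R X)"
  have F: "(?F has_vector_derivative X) (at 0)"
    by (rule mexp_has_vector_derivative_0)
  have "((\<lambda>t. ctrans (?F t)) has_vector_derivative ctrans X) (at 0)"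
    by (rule bounded_linear.has_vector_derivative[OF bounded_linear_ctrans F])
  from vector_derivative_cmat_mult[OF vector_derivative_cmat_mult[OF this has_vector_derivative_const] F, of A]
  have "((\<lambda>t. ctrans (?F t) ** A ** ?F t) has_vector_derivative (A ** X - X ** A)) (at 0)"
    using X by (simp add: skew_def cm.minus_left)
  from bounded_linear.has_vector_derivative[OF bounded_linear_inner_right this, of K]
  have "((\<lambda>t. 0) has_vector_derivative inner K (A ** X - X ** A)) (at (0::real))"
    by (simp add: orth mexp_unitary[OF X])
  then have "inner K (A ** X - X ** A) = 0"
    using has_vector_derivative_const vector_derivative_unique_at by blast
  moreover have "inner K (A ** X - X ** A) = inner X X"
  proof -
    have "inner K (A ** X) = - inner (A ** K) X"
      using inner_mult_left[of A X K] by (simp add: cA cm.minus_left inner_commute)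
    moreover have "inner K (X ** A) = - inner (K ** A) X"
      using inner_mult_right[of X A K] by (simp add: cA cm.minus_right inner_commute)
    ultimately show ?thesis
      by (simp add: inner_diff_right inner_diff_left X_def)
  qed
  ultimately show ?thesis by (simp add: X_def)
qed

text \<open>Differentiation at the identity extends commutation to all skew matrices. A matrix with
  the single diagonal entry \<open>\<i>\<close> kills off-diagonal entries of \<open>K\<close>, and
  elementary rotation generators equate the diagonal ones.\<close>

lemma scalar_if_commutes_unitary:
  fixes K :: "'n::finite cmat"
  assumes comm: "\<And>g. g \<in> unitary_group \<Longrightarrow> K ** g = g ** K"
  shows "\<exists>c. K = cscale c (mat 1)"
proof -
  have sk: "K ** X = X ** K" if X: "skew X" for X
  proof -
    have "((\<lambda>t. K ** mexp (t *\<^sub>R X)) has_vector_derivative K ** X) (at 0)"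
      by (rule bounded_linear.has_vector_derivative[OF cm.bounded_linear_right mexp_has_vector_derivative_0])
    moreover have "((\<lambda>t. mexp (t *\<^sub>R X) ** K) has_vector_derivative X ** K) (at 0)"
      by (rule bounded_linear.has_vector_derivative[OF cm.bounded_linear_left mexp_has_vector_derivative_0])
    ultimately show ?thesis
      using comm[OF mexp_unitary[OF X]] vector_derivative_unique_at by (metis (no_types, lifting) ext)
  qed
  have off: "K $ i $ k = 0" if "i \<noteq> k" for i k
  proof -
    define X :: "'n cmat" where "X = (\<chi> a b. if a = k \<and> b = k then \<i> else 0)"
    have "skew X" by (auto simp: skew_def X_def vec_eq_iff)
    from sk[OF this] have "(K ** X) $ i $ k = (X ** K) $ i $ k" by simp
    moreover have "(K ** X) $ i $ k = K $ i $ k * \<i>"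
      by (simp add: matrix_matrix_mult_def X_def if_distrib cong: if_cong)
    moreover have "(X ** K) $ i $ k = 0"
      using that by (simp add: matrix_matrix_mult_def X_def)
    ultimately show ?thesis by simp
  qed
  have diag: "K $ i $ i = K $ j $ j" for i j
  proof (cases "i = j")
    case False
    define X :: "'n cmat" where "X = (\<chi> a b. if a = i \<and> b = j then 1 else if a = j \<and> b = i then -1 else 0)"
    have "skew X" using False by (auto simp: skew_def X_def vec_eq_iff)
    from sk[OF this] have "(K ** X) $ i $ j = (X ** K) $ i $ j" by simp
    moreover have "(K ** X) $ i $ j = (\<Sum>k\<in>UNIV. if k = i then K $ i $ i else 0)"
      using False unfolding matrix_matrix_mult_def vec_lambda_beta
      by (intro sum.cong refl) (simp add: X_def)
    moreover have "(X ** K) $ i $ j = (\<Sum>k\<in>UNIV. if k = j then K $ j $ j else 0)"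
      using False unfolding matrix_matrix_mult_def vec_lambda_beta
      by (intro sum.cong refl) (simp add: X_def)
    ultimately show ?thesis by simp
  qed simp
  have "K = cscale (K $ undefined $ undefined) (mat 1)"
    unfolding vec_eq_iff
  proof (intro allI)
    fix i j
    show "K $ i $ j = cscale (K $ undefined $ undefined) (mat 1) $ i $ j"
      using off[of i j] diag[of i undefined] by (cases "i = j") (simp_all add: cscale_def mat_def)
  qed
  then show ?thesis by blast
qed

text \<open>At 0 the exponential is the identity, where the derivative of the Leibniz sum is the
  trace. Multiplicativity of the determinant along the one-parameter group carries the zero
  derivative to every time.\<close>

lemma det_mexp_traceless:
  fixes A :: "'n::finite cmat"
  assumes tr: "(\<Sum>i\<in>UNIV. A $ i $ i) = 0"
  shows "det (mexp (t *\<^sub>R A)) = 1"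
proof -
  let ?F = "\<lambda>t. mexp (t *\<^sub>R A)"
  define D where "D t = det (?F t)" for t
  have Fij: "((\<lambda>t. ?F t $ i $ j) has_derivative (\<lambda>h. h *\<^sub>R A $ i $ j)) (at 0)" for i j
    using bounded_linear.has_vector_derivative[OF
        bounded_linear_compose[OF bounded_linear_vec_nth bounded_linear_vec_nth] mexp_has_vector_derivative_0]
    unfolding has_vector_derivative_def by fastforce
  have perm: "((\<lambda>t. \<Prod>i\<in>UNIV. ?F t $ i $ p i) has_derivative (\<lambda>h. 0)) (at 0)"
    if p: "p permutes (UNIV :: 'n set)" for p
  proof -
    have "(\<Sum>i\<in>UNIV. h *\<^sub>R A $ i $ p i * (\<Prod>j\<in>UNIV - {i}. ?F 0 $ j $ p j)) = 0" for h
    proof (cases "p = id")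
      case True
      then have "(\<Sum>i\<in>UNIV. h *\<^sub>R A $ i $ p i * (\<Prod>j\<in>UNIV - {i}. ?F 0 $ j $ p j)) = h *\<^sub>R (\<Sum>i\<in>UNIV. A $ i $ i)"
        by (simp add: mat_def scaleR_sum_right)
      then show ?thesis by (simp add: tr)
    next
      case False
      \<comment> \<open>A permutation that moves \<open>a\<close> also moves \<open>p a\<close>;
        deleting one factor of the product still leaves an off-diagonal entry of the
        identity.\<close>
      then obtain a where a: "p a \<noteq> a" by (auto simp: fun_eq_iff)
      have b: "p (p a) \<noteq> p a" using a permutes_inj[OF p] by (auto dest: injD)
      have "(\<Prod>j\<in>UNIV - {i}. ?F 0 $ j $ p j) = 0" for i
      proof -
        have "\<exists>j. j \<noteq> i \<and> p j \<noteq> j" using a b by metis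
        then obtain j where j: "j \<noteq> i" "p j \<noteq> j" by auto
        then show ?thesis by (intro prod_zero) (auto simp: mat_def intro!: bexI[of _ j])
      qed
      then show ?thesis by (intro sum.neutral) simp
    qed
    moreover have "((\<lambda>t. \<Prod>i\<in>UNIV. ?F t $ i $ p i) has_derivative
        (\<lambda>h. \<Sum>i\<in>UNIV. h *\<^sub>R A $ i $ p i * (\<Prod>j\<in>UNIV - {i}. ?F 0 $ j $ p j))) (at 0)"
      by (rule has_derivative_prod) (rule Fij)
    ultimately show ?thesis by simp
  qed
  have D0: "(D has_derivative (\<lambda>h. 0)) (at 0)"
  proof -
    have "((\<lambda>t. \<Sum>p\<in>{p. p permutes (UNIV :: 'n set)}. of_int (sign p) * (\<Prod>i\<in>UNIV. ?F t $ i $ p i))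
       has_derivative (\<lambda>h. \<Sum>p\<in>{p. p permutes (UNIV :: 'n set)}. of_int (sign p) * 0)) (at 0)"
      by (intro has_derivative_sum has_derivative_mult_right perm) simp
    then show ?thesis by (simp add: D_def[abs_def] det_def)
  qed
  have "(D has_vector_derivative 0) (at t)" for t
  proof -
    have "((\<lambda>u. D (u - t)) has_derivative (\<lambda>h. 0)) (at t)"
    proof -
      have "(D has_derivative (\<lambda>h. 0)) (at (t - t))" using D0 by simp
      moreover have "((\<lambda>u. u - t) has_derivative (\<lambda>h. h)) (at t)"
        by (auto intro!: derivative_eq_intros)
      ultimately show ?thesis
        using has_derivative_compose[of "\<lambda>u. u - t" "\<lambda>h. h" t UNIV D "\<lambda>h. 0"] by simp
    qed
    then have "((\<lambda>u. D (u - t) * D t) has_derivative (\<lambda>h. 0 * D t)) (at t)"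
      by (rule has_derivative_mult_left)
    moreover have "D (u - t) * D t = D u" for u
      using mexp_add[of "u - t" t A] by (simp add: D_def det_mul)
    ultimately show ?thesis by (simp add: has_vector_derivative_def)
  qed
  from const_of_zero_vector_derivative[OF this, of t] show ?thesis
    by (simp add: D_def)
qed

section \<open>The control map: Lipschitz bound, derivative and reachability\<close>

locale herm_pair =
  fixes H1 H2 :: "'n::finite cmat"
  assumes herm1: "hermitian H1" and herm2: "hermitian H2"
begin

definition A :: "nat \<Rightarrow> 'n cmat" where "A j = gen (if odd j then H1 else H2)"

definition ev :: "nat \<Rightarrow> real \<Rightarrow> 'n cmat" where "ev j = evol (if odd j then H1 else H2)"

definition J :: "(nat \<Rightarrow> real) \<Rightarrow> nat \<Rightarrow> 'n cmat" where "J = Jn H1 H2"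

text \<open>One Lipschitz constant for both evolutions; the summand 1 keeps it positive when both
  generators vanish.\<close>

definition cA :: real where "cA = norm (gen H1) + norm (gen H2) + 1"

lemma J_0 [simp]: "J s 0 = mat 1"
  and J_Suc [simp]: "J s (Suc n) = ev (Suc n) (s (Suc n)) ** J s n"
  by (simp_all add: J_def ev_def)

lemma ev_parity: "even m \<Longrightarrow> ev (m + j) = ev j"
  by (auto simp: ev_def)

lemma ev_unitary [simp]: "ev j t \<in> unitary_group"
  using herm1 herm2 by (simp add: ev_def evol_unitary)

lemma ev_0 [simp]: "ev j 0 = mat 1"
  by (simp add: ev_def)

lemma skew_A: "skew (A j)"
  using herm1 herm2 by (simp add: A_def skew_gen)

lemma ev_measurable [measurable]: "ev j \<in> borel_measurable borel"
  by (simp add: ev_def)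

lemma ev_deriv: "(ev j has_vector_derivative A j ** ev j t) (at t within S)"
  by (simp add: A_def ev_def evol_has_vector_derivative)

lemma cA_pos: "cA > 0"
  by (simp add: cA_def add_nonneg_pos)

lemma ev_lipschitz: "norm (ev j s - ev j t) \<le> cA * \<bar>s - t\<bar>"
proof -
  have "norm (ev j s - ev j t) \<le> norm (A j) * \<bar>s - t\<bar>"
    unfolding ev_def A_def using herm1 herm2 by (simp add: evol_lipschitz)
  also have "\<dots> \<le> cA * \<bar>s - t\<bar>"
    by (intro mult_right_mono) (auto simp: A_def cA_def add.assoc)
  finally show ?thesis .
qed

lemma ev_A_commute: "A j ** ev j t = ev j t ** A j"
  unfolding A_def ev_def evol_eq_mexp by (rule mexp_commute) simp

lemma J_unitary [simp]: "J s n \<in> unitary_group"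
  by (induction n) (simp_all add: unitary_mult)

lemma J_cong: "(\<And>j. j \<in> {1..n} \<Longrightarrow> s j = s' j) \<Longrightarrow> J s n = J s' n"
  by (induction n) auto

text \<open>After an even number of factors the alternation starts again with \<open>H1\<close>, so
  the tail is itself a control map with shifted times.\<close>

lemma J_add: "even m \<Longrightarrow> J s (m + n) = J (\<lambda>j. s (m + j)) n ** J s m"
proof (induction n)
  case (Suc n)
  then show ?case using ev_parity[of m "Suc n"] by (simp add: matrix_mul_assoc)
qed simp

text \<open>Telescoping over the factors: the unchanged ones are unitary and preserve norms, so the
  errors in the single times add up without amplification.\<close>

lemma J_lipschitz: "norm (J s n - J s' n) \<le> cA * (\<Sum>j\<in>{1..n}. \<bar>s j - s' j\<bar>)"
proof (induction n)
  case (Suc n)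
  let ?e = "ev (Suc n) (s (Suc n))" and ?e' = "ev (Suc n) (s' (Suc n))"
  have "J s (Suc n) - J s' (Suc n) = ?e ** (J s n - J s' n) + (?e - ?e') ** J s' n"
    by (simp add: cm.diff_left cm.diff_right)
  then have "norm (J s (Suc n) - J s' (Suc n)) \<le> norm (J s n - J s' n) + norm (?e - ?e')"
    using norm_triangle_ineq[of "?e ** (J s n - J s' n)" "(?e - ?e') ** J s' n"]
    by (simp add: norm_unitary_left norm_unitary_right)
  also have "\<dots> \<le> cA * (\<Sum>j\<in>{1..n}. \<bar>s j - s' j\<bar>) + cA * \<bar>s (Suc n) - s' (Suc n)\<bar>"
    by (intro add_mono Suc.IH ev_lipschitz)
  finally show ?case by (simp add: distrib_left)
qed simp

text \<open>Left-trivialised derivative of the control map in its \<open>j\<close>-th time, see \<open>J_has_derivative\<close>.\<close>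
definition slot :: "(nat \<Rightarrow> real) \<Rightarrow> nat \<Rightarrow> 'n cmat" where
  "slot s j = ctrans (J s j) ** A j ** J s j"

lemma skew_slot: "skew (slot s j)"
  using skew_A[of j] by (simp add: slot_def skew_def ctrans_mult cm.minus_left cm.minus_right matrix_mul_assoc)

text \<open>The generator of the \<open>j\<close>-th factor is moved to the right end, past the
  factors up to \<open>j\<close>, which conjugates it into \<open>slot\<close>; a slot thus depends
  on the times up to \<open>j\<close> alone. The times are functions of a vector parameter so that
  some can vary while others stay frozen.\<close>

lemma J_has_derivative:
  fixes s :: "nat \<Rightarrow> 'e::real_normed_vector \<Rightarrow> real"
  assumes s: "\<And>j. (s j has_derivative s' j) (at x)"
  shows "((\<lambda>x. J (\<lambda>j. s j x) n) has_derivative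
    (\<lambda>v. J (\<lambda>j. s j x) n ** (\<Sum>j\<in>{1..n}. s' j v *\<^sub>R slot (\<lambda>j. s j x) j))) (at x)"
proof (induction n)
  case (Suc n)
  let ?s = "\<lambda>j. s j x" and ?m = "Suc n"
  have "((\<lambda>x. ev ?m (s ?m x)) has_derivative (\<lambda>v. s' ?m v *\<^sub>R (A ?m ** ev ?m (s ?m x)))) (at x)"
    using has_derivative_compose[OF s[of ?m] ev_deriv[of ?m _ UNIV, unfolded has_vector_derivative_def]] .
  from cm.FDERIV[OF this Suc.IH]
  have 1: "((\<lambda>x. J (\<lambda>j. s j x) ?m) has_derivative
      (\<lambda>v. ev ?m (s ?m x) ** (J ?s n ** (\<Sum>j\<in>{1..n}. s' j v *\<^sub>R slot ?s j))
           + (s' ?m v *\<^sub>R (A ?m ** ev ?m (s ?m x))) ** J ?s n)) (at x)"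
    by simp
  have "J ?s ?m ** slot ?s ?m = A ?m ** J ?s ?m"
    unfolding slot_def by (simp add: matrix_mul_assoc unitary_right del: J_Suc)
  then show ?case
    by (intro has_derivative_eq_rhs[OF 1] ext)
      (simp add: cm.add_right matrix_scaleR_left matrix_scaleR_right matrix_mul_assoc)
qed simp

definition reach :: "nat \<Rightarrow> bool" where
  "reach n \<longleftrightarrow> (\<forall>g\<in>unitary_group. \<exists>s. (\<forall>j. s j \<ge> 0) \<and> J s n = g)"

lemma reach_Suc: "reach n \<Longrightarrow> reach (Suc n)"
  unfolding reach_def
proof safe
  fix g :: "'n cmat" assume *: "\<forall>g\<in>unitary_group. \<exists>s. (\<forall>j. 0 \<le> s j) \<and> J s n = g" and "g \<in> unitary_group"
  then obtain s where s: "\<forall>j. 0 \<le> s j" "J s n = g" by blast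
  have "J (s(Suc n := 0)) n = J s n" by (rule J_cong) auto
  then show "\<exists>s. (\<forall>j. 0 \<le> s j) \<and> J s (Suc n) = g"
    using s by (intro exI[of _ "s(Suc n := 0)"]) auto
qed

text \<open>A further factor with time 0 is the identity, so reachability is monotone in the number
  of factors. Evenness serves concatenation, and \<open>m \<ge> 2\<close> lets the positions
  \<open>i * m\<close> and \<open>Suc (i * m)\<close> belong to the same block.\<close>

lemma reach_even:
  assumes "U_controllable H1 H2"
  obtains m where "even m" "m \<ge> 2" "reach m"
proof -
  obtain n where n: "{Jn H1 H2 s n | s. \<forall>j. s j \<ge> 0} = unitary_group"
    using assms by (auto simp: U_controllable_def)
  have "\<exists>s. (\<forall>j. 0 \<le> s j) \<and> Jn H1 H2 s n = g" if "g \<in> unitary_group" for g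
    using that unfolding n[symmetric] by blast
  then have "reach n" by (simp add: reach_def J_def)
  then have "reach (n + k)" for k by (induction k) (auto intro: reach_Suc)
  from this[of "n + 2"] show ?thesis by (intro that[of "n + (n + 2)"]) auto
qed

text \<open>Block \<open>K + 1\<close> realises \<open>g (Suc K)\<close> times the inverse of the
  current position, so a single trajectory is steered through any finite list of unitary
  matrices.\<close>

lemma reach_prefix:
  assumes m: "even m" "reach m" and g: "\<And>k. g k \<in> unitary_group"
  shows "\<exists>s. (\<forall>j. s j \<ge> 0) \<and> (\<forall>k\<in>{1..K}. J s (k * m) = g k)"
proof (induction K)
  case 0
  show ?case by (intro exI[of _ "\<lambda>_. 0"]) auto
next
  case (Suc K)
  then obtain s where s: "\<forall>j. s j \<ge> 0" "\<forall>k\<in>{1..K}. J s (k * m) = g k" by blast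
  have "g (Suc K) ** ctrans (J s (K * m)) \<in> unitary_group"
    by (intro unitary_mult g unitary_ctrans J_unitary)
  then obtain r where r: "\<forall>j. r j \<ge> 0" "J r m = g (Suc K) ** ctrans (J s (K * m))"
    using m unfolding reach_def by blast
  define s' where "s' j = (if j \<le> K * m then s j else r (j - K * m))" for j
  have old: "J s' (k * m) = J s (k * m)" if "k \<le> K" for k
  proof (rule J_cong)
    fix j assume "j \<in> {1..k * m}"
    then have "j \<le> k * m" by simp
    also note mult_le_mono1[OF that, of m]
    finally have "j \<le> K * m" .
    then show "s' j = s j" by (simp add: s'_def)
  qed
  have "J s' (K * m + m) = J (\<lambda>j. s' (K * m + j)) m ** J s' (K * m)"
    using m by (intro J_add) auto
  also have "J (\<lambda>j. s' (K * m + j)) m = J r m"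
    by (intro J_cong) (auto simp: s'_def)
  also have "J r m ** J s' (K * m) = g (Suc K)"
    using r old[of K] by (simp add: matrix_mul_assoc[symmetric] unitary_left)
  finally have "J s' (Suc K * m) = g (Suc K)" by (simp add: add.commute)
  then have "\<forall>k\<in>{1..Suc K}. J s' (k * m) = g k"
    using s old by (auto simp: le_Suc_eq)
  moreover have "\<forall>j. s' j \<ge> 0" using s r by (auto simp: s'_def)
  ultimately show ?case by blast
qed

lemma slot_even: "even j \<Longrightarrow> slot s j = ctrans (J s j) ** A 2 ** J s j"
  by (simp add: slot_def A_def)

text \<open>The factor at an odd position is generated by \<open>A 1\<close> and commutes with it,
  hence cancels in the conjugation. So at an even index \<open>j\<close> the slots \<open>j\<close>
  and \<open>Suc j\<close> show both generators conjugated by the same unitary matrix.\<close>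

lemma slot_Suc_even:
  assumes "even j"
  shows "slot s (Suc j) = ctrans (J s j) ** A 1 ** J s j"
proof -
  let ?e = "ev 1 (s (Suc j))"
  have e: "ev (Suc j) = ev 1" "A (Suc j) = A 1" using assms by (auto simp: ev_def A_def)
  have "ctrans ?e ** A 1 ** ?e = A 1"
    by (metis ev_A_commute ev_unitary matrix_mul_assoc unitary_cancel_left)
  then have "ctrans (J s j) ** (ctrans ?e ** A 1 ** ?e) ** J s j = ctrans (J s j) ** A 1 ** J s j"
    by simp
  then show ?thesis by (simp add: slot_def e ctrans_mult matrix_mul_assoc)
qed

lemma det_neq_1_unitary: "\<exists>u :: 'n cmat. u \<in> unitary_group \<and> det u \<noteq> 1"
proof -
  define u :: "'n cmat" where "u = (\<chi> i j. if i = j then (if i = undefined then -1 else 1) else 0)"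
  have "det u = (\<Prod>i\<in>UNIV. u $ i $ i)"
    by (rule det_diagonal) (simp add: u_def)
  also have "\<dots> = -1"
    by (simp add: u_def prod.If_cases)
  finally have "det u \<noteq> 1" by simp
  moreover have "u \<in> unitary_group"
  proof -
    have "(ctrans u ** u) $ i $ j = (mat 1 :: 'n cmat) $ i $ j" for i j
    proof -
      have "(ctrans u ** u) $ i $ j = (\<Sum>k\<in>UNIV. if k = i then (if i = j then 1 else 0) else 0)"
        unfolding matrix_matrix_mult_def vec_lambda_beta by (intro sum.cong refl) (simp add: u_def)
      then show ?thesis by (simp add: mat_def)
    qed
    then show ?thesis by (simp add: unitary_group_def vec_eq_iff)
  qed
  ultimately show ?thesis by blast
qed

text \<open>A skew matrix orthogonal to both orbits commutes with the whole group, so it is scalar;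
  the generators are then traceless and everything reachable has determinant one.\<close>
lemma orthogonal_to_orbits_zero:
  assumes reach: "reach n" and K: "skew K"
    and orth: "\<And>g k. g \<in> unitary_group \<Longrightarrow> inner K (ctrans g ** A k ** g) = 0"
  shows "K = 0"
proof (rule ccontr)
  assume "K \<noteq> 0"
  have "K ** A j = A j ** K" for j
    by (rule commute_if_orthogonal_to_orbit[OF skew_A K orth])
  then have "K ** ev j t = ev j t ** K" for j t
    unfolding ev_def A_def evol_eq_mexp by (intro mexp_commute)
  then have "K ** J s n = J s n ** K" for s n
    by (induction n) (simp, metis J_Suc matrix_mul_assoc)
  then have "\<exists>c. K = cscale c (mat 1)"
    using reach unfolding reach_def by (intro scalar_if_commutes_unitary) metis
  then obtain c where c: "K = cscale c (mat 1)" by blast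
  have "c \<noteq> 0" using \<open>K \<noteq> 0\<close> by (auto simp: c cscale_def vec_eq_iff)
  have "Re c = 0"
  proof -
    have "ctrans K $ undefined $ undefined = - K $ undefined $ undefined" using K by (simp add: skew_def)
    then show ?thesis by (simp add: c cscale_def mat_def complex_eq_iff)
  qed
  \<comment> \<open>Orthogonality with \<open>g = mat 1\<close> tests the generator against a
    nonzero imaginary scalar, which reads off the imaginary part of the trace; the real part
    vanishes by skewness.\<close>
  have tr: "(\<Sum>i\<in>UNIV. A j $ i $ i) = 0" for j
  proof -
    have "cnj (A j $ i $ i) = - A j $ i $ i" for i
      using skew_A[of j] by (metis ctrans_nth skew_def vector_uminus_component)
    then have re: "Re (A j $ i $ i) = 0" for i by (simp add: complex_eq_iff)
    have "0 = inner K (A j)" using orth[of "mat 1" j] by simp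
    also have "\<dots> = (\<Sum>i\<in>UNIV. Re (c * cnj (A j $ i $ i)))"
      by (simp add: inner_cmat c cscale_def mat_def if_distrib if_distribR cong: if_cong)
    also have "\<dots> = Im c * (\<Sum>i\<in>UNIV. Im (A j $ i $ i))"
      by (simp add: \<open>Re c = 0\<close> sum_distrib_left)
    finally show ?thesis
      using \<open>c \<noteq> 0\<close> \<open>Re c = 0\<close> by (simp add: complex_eq_iff re)
  qed
  have "det (ev j t) = 1" for j t
    unfolding ev_def evol_eq_mexp using tr[of j] by (intro det_mexp_traceless) (simp add: A_def)
  then have "det (J s n) = 1" for s n
    by (induction n) (simp_all add: det_mul)
  then have "det u = 1" if "u \<in> unitary_group" for u :: "'n cmat"
    using reach that unfolding reach_def by metis
  then show False using det_neq_1_unitary by blast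
qed

end

section \<open>Lipschitz images and Lebesgue measure\<close>

text \<open>The image is enclosed in a measurable set, so its own measurability is no issue. An open
  superset of \<open>S\<close> of nearly the same measure contains small cubes that cover
  \<open>S\<close>; the part of \<open>S\<close> in such a cube is sent into a cube with side larger
  by the factor \<open>2 * B * DIM('a)\<close>.\<close>

lemma lipschitz_image_outer_measure:
  fixes f :: "'a::euclidean_space \<Rightarrow> 'a" and B :: real
  assumes S: "S \<in> lmeasurable" "bounded S" and B: "B > 0" and e: "e > 0"
    and lip: "\<And>x y. x \<in> S \<Longrightarrow> y \<in> S \<Longrightarrow> norm (f x - f y) \<le> B * norm (x - y)"
  shows "\<exists>T\<in>lmeasurable. f ` S \<subseteq> T \<and>
    measure lebesgue T \<le> (2 * B * DIM('a)) ^ DIM('a) * (measure lebesgue S + e)"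
proof -
  let ?d = "DIM('a)"
  obtain U where U: "open U" "S \<subseteq> U" "U - S \<in> lmeasurable" "emeasure lebesgue (U - S) < ennreal e"
    using sets_lebesgue_outer_open[OF _ e, of S] S(1) by blast
  have Um: "U \<in> lmeasurable"
    using U S(1) fmeasurable_Diff_D by blast
  have "measure lebesgue (U - S) \<le> e"
    using U(3,4) e by (simp add: emeasure_eq_measure2 ennreal_less_iff)
  moreover have "measure lebesgue (U - S) = measure lebesgue U - measure lebesgue S"
    by (rule measurable_measure_Diff) (use Um S(1) U(2) in auto)
  ultimately have mU: "measure lebesgue U \<le> measure lebesgue S + e" by simp
  obtain b where b: "\<And>x. x \<in> S \<Longrightarrow> norm x \<le> b"
    using S(2) bounded_iff by blast
  define c where "c = \<bar>b\<bar> + 1"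
  have c: "c > 0" by (simp add: c_def)
  have Sc: "S \<subseteq> cbox (- c *\<^sub>R One) (c *\<^sub>R One)"
  proof
    fix x assume "x \<in> S"
    have "\<bar>x \<bullet> i\<bar> \<le> c" if "i \<in> Basis" for i
      using Basis_le_norm[OF that, of x] b[OF \<open>x \<in> S\<close>] by (simp add: c_def)
    then show "x \<in> cbox (- c *\<^sub>R One) (c *\<^sub>R One)"
      by (fastforce simp: mem_box abs_le_iff)
  qed
  have ne: "box (- c *\<^sub>R One :: 'a) (c *\<^sub>R One) \<noteq> {}"
    using c by (simp add: box_ne_empty)
  \<comment> \<open>This gauge forces every cube tagged by a point of \<open>S\<close> into
    \<open>U\<close>. The subdivision starts from a cube, so all pieces have equal sides.\<close>
  have "gauge (\<lambda>x. if x \<in> U then U else UNIV)"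
    using U(1) by (auto simp: gauge_def)
  from covering_lemma[OF Sc ne this]
  obtain D where D: "countable D"
    "\<And>K. K \<in> D \<Longrightarrow> interior K \<noteq> {} \<and> (\<exists>c d. K = cbox c d)"
    "pairwise (\<lambda>A B. interior A \<inter> interior B = {}) D"
    "\<And>K. K \<in> D \<Longrightarrow> \<exists>x \<in> S \<inter> K. K \<subseteq> (if x \<in> U then U else UNIV)"
    "\<And>u v. cbox u v \<in> D \<Longrightarrow> \<exists>n. \<forall>i \<in> Basis. v \<bullet> i - u \<bullet> i = (c *\<^sub>R One \<bullet> i - (- c *\<^sub>R One) \<bullet> i) / 2^n"
    "S \<subseteq> \<Union>D"
    by metis
  have "\<exists>u v w z. K = cbox u v \<and> w > 0 \<and> (\<forall>i\<in>Basis. v \<bullet> i - u \<bullet> i = w) \<and> z \<in> S \<and> z \<in> K \<and> K \<subseteq> U"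
    if K: "K \<in> D" for K
  proof -
    obtain u v where uv: "K = cbox u v" using D(2)[OF K] by blast
    obtain n where n: "\<forall>i \<in> Basis. v \<bullet> i - u \<bullet> i = (c *\<^sub>R One \<bullet> i - (- c *\<^sub>R One) \<bullet> i) / 2^n"
      using D(5) K uv by blast
    have "\<forall>i\<in>Basis. v \<bullet> i - u \<bullet> i = 2 * c / 2 ^ n" using n by simp
    moreover have "2 * c / 2 ^ n > 0" using c by simp
    moreover obtain z where "z \<in> S" "z \<in> K" "K \<subseteq> U"
      using D(4)[OF K] U(2) by (auto split: if_splits)
    ultimately show ?thesis using uv by blast
  qed
  then obtain u v w z where K: "\<And>K. K \<in> D \<Longrightarrow> K = cbox (u K) (v K) \<and> w K > 0 \<and>
      (\<forall>i\<in>Basis. v K \<bullet> i - u K \<bullet> i = w K) \<and> z K \<in> S \<and> z K \<in> K \<and> K \<subseteq> U"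
    by metis
  \<comment> \<open>Half the side: two points of a cube of side \<open>w K\<close> differ in norm by
    at most the sum of their coordinate differences, that is \<open>?d * w K\<close>, and
    \<open>f\<close> stretches this by at most \<open>B\<close>.\<close>
  define q where "q K = cbox (f (z K) - (B * ?d * w K) *\<^sub>R One) (f (z K) + (B * ?d * w K) *\<^sub>R One)" for K
  have cover: "f ` S \<subseteq> (\<Union>K\<in>D. q K)"
  proof
    fix y assume "y \<in> f ` S"
    then obtain x where x: "x \<in> S" "y = f x" by blast
    then obtain L where L: "L \<in> D" "x \<in> L" using D(6) by blast
    note KL = K[OF L(1)]
    have "\<bar>(x - z L) \<bullet> i\<bar> \<le> w L" if i: "i \<in> Basis" for i
    proof -
      have "x \<in> cbox (u L) (v L)" "z L \<in> cbox (u L) (v L)" using KL L(2) by auto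
      then have "u L \<bullet> i \<le> x \<bullet> i" "x \<bullet> i \<le> v L \<bullet> i" "u L \<bullet> i \<le> z L \<bullet> i" "z L \<bullet> i \<le> v L \<bullet> i"
        using i by (auto simp: mem_box)
      moreover have "v L \<bullet> i - u L \<bullet> i = w L" using KL i by blast
      ultimately show ?thesis by (simp add: inner_diff_left abs_le_iff)
    qed
    then have "(\<Sum>i\<in>Basis. \<bar>(x - z L) \<bullet> i\<bar>) \<le> (\<Sum>i\<in>(Basis::'a set). w L)"
      by (rule sum_mono)
    then have "norm (x - z L) \<le> ?d * w L"
      using norm_le_l1[of "x - z L"] by simp
    then have "B * norm (x - z L) \<le> B * (?d * w L)" using B by simp
    moreover have "norm (f x - f (z L)) \<le> B * norm (x - z L)" using lip x(1) KL by blast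
    ultimately have *: "norm (f x - f (z L)) \<le> B * ?d * w L" by (simp add: mult.assoc)
    have "\<bar>(f x - f (z L)) \<bullet> i\<bar> \<le> B * ?d * w L" if "i \<in> Basis" for i
      using Basis_le_norm[OF that, of "f x - f (z L)"] * by linarith
    then have "f x \<in> q L"
      unfolding q_def mem_box by (fastforce simp: inner_diff_left inner_add_left abs_le_iff)
    then show "y \<in> (\<Union>K\<in>D. q K)" using L x by blast
  qed
  \<comment> \<open>Finite subfamilies suffice, as the bound passes to the countable union. Their
    cubes do not overlap and lie in \<open>U\<close>, so their volumes add up to at most that of
    \<open>U\<close>.\<close>
  have bound: "measure lebesgue (\<Union>K\<in>I. q K) \<le> (2 * B * ?d) ^ ?d * measure lebesgue U"
    if I: "I \<subseteq> D" "finite I" for I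
  proof -
    have "measure lebesgue (\<Union>K\<in>I. q K) \<le> (\<Sum>K\<in>I. measure lebesgue (q K))"
      by (rule measure_UNION_le) (use I in \<open>auto simp: q_def\<close>)
    also have "\<dots> = (\<Sum>K\<in>I. (2 * B * ?d) ^ ?d * measure lebesgue K)"
    proof (rule sum.cong)
      fix L assume "L \<in> I"
      then have KL: "L = cbox (u L) (v L)" "w L > 0" "\<forall>i\<in>Basis. v L \<bullet> i - u L \<bullet> i = w L"
        using K I by blast+
      have "measure lebesgue (q L) = (\<Prod>i\<in>(Basis::'a set). 2 * (B * ?d * w L))"
        unfolding q_def using KL(2) B
        by (subst measure_completion, simp, subst content_cbox) (auto simp: inner_diff_left inner_add_left mult_ac)
      also have "\<dots> = (2 * B * ?d) ^ ?d * w L ^ ?d"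
        by (simp add: power_mult_distrib)
      also have "w L ^ ?d = measure lebesgue (cbox (u L) (v L))"
      proof -
        have "u L \<bullet> i \<le> v L \<bullet> i" if "i \<in> Basis" for i using KL(2,3) that by (metis diff_ge_0_iff_ge less_imp_le)
        then have "measure lborel (cbox (u L) (v L)) = (\<Prod>i\<in>(Basis::'a set). w L)"
          using KL(3) by (simp add: content_cbox inner_diff_left)
        then show ?thesis by simp
      qed
      finally show "measure lebesgue (q L) = (2 * B * ?d) ^ ?d * measure lebesgue L"
        using KL(1) by simp
    qed simp
    also have "\<dots> = (2 * B * ?d) ^ ?d * (\<Sum>K\<in>I. measure lebesgue K)"
      by (simp add: sum_distrib_left)
    also have "(\<Sum>K\<in>I. measure lebesgue K) \<le> measure lebesgue U"
    proof -
      have "I division_of \<Union>I"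
        unfolding division_of_def
      proof (intro conjI ballI impI)
        fix L assume "L \<in> I"
        then have "L \<in> D" using I(1) by blast
        then show "L \<subseteq> \<Union>I" "L \<noteq> {}" "\<exists>a b. L = cbox a b"
          using K[of L] \<open>L \<in> I\<close> by blast+
        fix L' assume "L' \<in> I" "L \<noteq> L'"
        then show "interior L \<inter> interior L' = {}"
          using D(3) I(1) \<open>L \<in> D\<close> by (auto simp: pairwise_def)
      qed (use I in auto)
      note div = this
      have "(\<Sum>K\<in>I. measure lebesgue K) = measure lebesgue (\<Union>I)"
      proof -
        have "\<Union>I \<in> sets lborel"
        proof (rule sets.finite_Union)
          show "I \<subseteq> sets lborel" using K I(1) by (metis cbox_borel sets_lborel subsetD subsetI)
        qed (use I in auto)
        then show ?thesis using content_division[OF div] by simp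
      qed
      also have "\<dots> \<le> measure lebesgue U"
        by (rule measure_mono_fmeasurable[OF _ _ Um]) (use K I div lmeasurable_division in blast)+
      finally show ?thesis .
    qed
    finally show ?thesis using B by (simp add: mult_left_mono)
  qed
  have qm: "q K \<in> lmeasurable" for K by (simp add: q_def)
  show ?thesis
  proof (intro bexI conjI)
    show "(\<Union>K\<in>D. q K) \<in> lmeasurable"
      by (rule fmeasurable_UN_bound[OF D(1) qm bound])
    show "f ` S \<subseteq> (\<Union>K\<in>D. q K)" by (rule cover)
    have "measure lebesgue (\<Union>K\<in>D. q K) \<le> (2 * B * ?d) ^ ?d * measure lebesgue U"
      by (rule measure_UN_bound[OF D(1) qm bound])
    also have "\<dots> \<le> (2 * B * ?d) ^ ?d * (measure lebesgue S + e)"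
      using B mU by (intro mult_left_mono) auto
    finally show "measure lebesgue (\<Union>K\<in>D. q K) \<le> (2 * B * ?d) ^ ?d * (measure lebesgue S + e)" .
  qed
qed

section \<open>A linear chart of the unitary group near the identity\<close>

text \<open>On a skew matrix the real parts form an antisymmetric and the imaginary parts a
  symmetric real matrix. Their sum determines both, so \<open>Lam\<close> gives real coordinates on
  the skew matrices with one coordinate per index pair.\<close>

definition Lam :: "'n::finite cmat \<Rightarrow> real ^ ('n \<times> 'n)" where
  "Lam X = (\<chi> p. Re (X $ fst p $ snd p) + Im (X $ fst p $ snd p))"

text \<open>The skew part of \<open>X\<close> in the coordinates of \<open>Lam\<close>, a stand-in
  for the logarithm. Being linear on the whole matrix space, it is Lipschitz and its own
  derivative.\<close>

definition chart :: "'n::finite cmat \<Rightarrow> real ^ ('n \<times> 'n)" where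
  "chart X = Lam ((1 / 2) *\<^sub>R (X - ctrans X))"

lemma linear_Lam: "linear Lam"
  by (rule linearI) (auto simp: Lam_def vec_eq_iff algebra_simps)

lemma linear_chart: "linear (chart :: 'n::finite cmat \<Rightarrow> _)"
proof -
  have "linear (\<lambda>X :: 'n cmat. (1 / 2) *\<^sub>R (X - ctrans X))"
    by (rule linearI) (simp_all add: ctrans_add ctrans_scaleR algebra_simps)
  from linear_compose[OF this linear_Lam] show ?thesis
    by (simp add: o_def chart_def[abs_def])
qed

lemma Lam_skew_eq_0:
  assumes "skew X" "Lam X = 0"
  shows "X = 0"
proof -
  have "X $ i $ j = 0" for i j
  proof -
    have "cnj (X $ j $ i) = - X $ i $ j"
      using assms(1) by (metis ctrans_nth skew_def vector_uminus_component)
    moreover have "Re (X $ i $ j) + Im (X $ i $ j) = 0" "Re (X $ j $ i) + Im (X $ j $ i) = 0"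
      using assms(2) by (auto simp: Lam_def vec_eq_iff)
    ultimately show ?thesis by (simp add: complex_eq_iff)
  qed
  then show ?thesis by (simp add: vec_eq_iff)
qed

lemma chart_skew: "skew X \<Longrightarrow> chart X = Lam X"
  by (simp add: chart_def skew_def flip: scaleR_2)

lemma chart_one [simp]: "chart (mat 1) = 0"
  by (simp add: chart_def linear_0[OF linear_Lam])

text \<open>If \<^term>\<open>P = u - v\<close> is Hermitian with u, v unitary, then \<^term>\<open>ctrans v ** P + P ** u = 0\<close>;
  near the identity this forces \<^term>\<open>P = 0\<close>.\<close>
lemma chart_inj_near_one:
  "\<exists>\<rho>>0. \<forall>(u :: 'n::finite cmat) v. u \<in> unitary_group \<longrightarrow> v \<in> unitary_group \<longrightarrow> norm (u - mat 1) < \<rho> \<longrightarrow>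
     norm (v - mat 1) < \<rho> \<longrightarrow> chart u = chart v \<longrightarrow> u = v"
proof -
  have "\<exists>K>0. \<forall>(A :: 'n cmat) (B :: 'n cmat). norm (A ** B) \<le> norm A * norm B * K"
    by (rule cm.pos_bounded)
  then obtain K where K: "K > 0" "\<forall>(A :: 'n cmat) (B :: 'n cmat). norm (A ** B) \<le> norm A * norm B * K"
    by (elim exE conjE)
  have "u = v" if uv: "u \<in> unitary_group" "v \<in> unitary_group" "norm (u - mat 1) < 1 / (2 * K)"
    "norm (v - mat 1) < 1 / (2 * K)" "chart u = chart v" for u v :: "'n cmat"
  proof (rule ccontr)
    assume "u \<noteq> v"
    define P where "P = u - v"
    have "P \<noteq> 0" using \<open>u \<noteq> v\<close> by (simp add: P_def)
    define X where "X = (1 / 2) *\<^sub>R (P - ctrans P)"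
    have "skew X" by (simp add: skew_def X_def ctrans_scaleR ctrans_diff algebra_simps)
    moreover have "Lam X = 0"
      using uv(5) linear_diff[OF linear_chart, of u v] by (simp add: X_def P_def chart_def)
    ultimately have "X = 0" by (rule Lam_skew_eq_0)
    then have P: "ctrans P = P" by (simp add: X_def)
    have "ctrans v ** P + P ** u = 0"
    proof -
      have "P ** u = ctrans (u - v) ** u" using P by (simp add: P_def)
      then show ?thesis
        using uv(1,2) by (simp add: P_def ctrans_diff cm.diff_left cm.diff_right unitary_left)
    qed
    \<comment> \<open>At \<open>u = v = mat 1\<close> the relation would say that twice
      \<open>P\<close> is 0. The radius \<open>1 / (2 * K)\<close> keeps the perturbation below
      \<open>norm P\<close>, hence \<open>2 * norm P \<le> norm P\<close>.\<close>
    then have "2 *\<^sub>R P = - (ctrans (v - mat 1) ** P + P ** (u - mat 1))"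
      by (simp add: ctrans_diff cm.diff_left cm.diff_right algebra_simps scaleR_2)
    then have "norm (2 *\<^sub>R P) = norm (ctrans (v - mat 1) ** P + P ** (u - mat 1))"
      by (simp only: norm_minus_cancel)
    then have "2 * norm P = norm (ctrans (v - mat 1) ** P + P ** (u - mat 1))" by simp
    also have "\<dots> \<le> norm (v - mat 1) * norm P * K + norm P * norm (u - mat 1) * K"
      using K(2)[rule_format, of "ctrans (v - mat 1)" P] K(2)[rule_format, of P "u - mat 1"]
      by (intro norm_triangle_mono) simp_all
    also have "\<dots> = (norm (v - mat 1) + norm (u - mat 1)) * (norm P * K)" by (simp add: algebra_simps)
    also have "\<dots> \<le> (1 / (2 * K) + 1 / (2 * K)) * (norm P * K)"
      using uv K(1) by (intro mult_right_mono) auto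
    also have "\<dots> = norm P" using K(1) by (simp add: field_simps)
    finally show False using \<open>P \<noteq> 0\<close> by simp
  qed
  then show ?thesis using K(1) by (intro exI[of _ "1 / (2 * K)"]) auto
qed

section \<open>A full-rank point of the control map\<close>

context herm_pair begin

text \<open>Otherwise a nonzero functional annihilates all images of orbit elements; written as an
  inner product, its skew part is a matrix excluded by
  \<open>orthogonal_to_orbits_zero\<close>.\<close>

lemma span_orbit_UNIV:
  assumes "reach n"
  shows "span {Lam (ctrans g ** A k ** g) | g k. g \<in> unitary_group} = UNIV" (is "span ?V = UNIV")
proof (rule ccontr)
  assume "span ?V \<noteq> UNIV"
  then obtain a where a: "a \<noteq> 0" "span ?V \<subseteq> {x. a \<bullet> x = 0}"
    using span_not_univ_subset_hyperplane by blast
  \<comment> \<open>Represents the functional \<open>a\<close> composed with \<open>Lam\<close>. On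
    skew matrices \<open>K\<close>, twice the skew part of \<open>K0\<close>, acts as twice the
    functional.\<close>
  define K0 :: "'n cmat" where "K0 = (\<chi> i j. Complex (a $ (i, j)) (a $ (i, j)))"
  define K where "K = K0 - ctrans K0"
  have aL: "inner K0 X = a \<bullet> Lam X" for X
    by (simp add: inner_cmat K0_def inner_vec_def[of a] Lam_def sum.cartesian_product
        UNIV_Times_UNIV[symmetric] distrib_left case_prod_unfold del: UNIV_Times_UNIV)
  have "skew K" by (simp add: K_def skew_def ctrans_diff)
  moreover have "inner K (ctrans g ** A k ** g) = 0" if g: "g \<in> unitary_group" for g k
  proof -
    let ?X = "ctrans g ** A k ** g"
    have "ctrans ?X = - ?X"
      using skew_A[of k] by (simp add: skew_def ctrans_mult cm.minus_left cm.minus_right matrix_mul_assoc)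
    then have "inner (ctrans K0) ?X = - inner K0 ?X"
      using inner_ctrans[of K0 ?X] by simp
    moreover have "Lam ?X \<in> span ?V" using g by (intro span_base) blast
    then have "inner K0 ?X = 0" using a(2) by (auto simp: aL)
    ultimately show ?thesis by (simp add: K_def inner_diff_left)
  qed
  ultimately have "K = 0" by (rule orthogonal_to_orbits_zero[OF assms])
  \<comment> \<open>A Hermitian \<open>K0\<close> gives \<open>a $ (i, j) = a $ (j, i)\<close> from
    real parts and \<open>a $ (i, j) = - a $ (j, i)\<close> from imaginary parts.\<close>
  have "a $ (i, j) = 0" for i j
  proof -
    have "K0 $ i $ j = ctrans K0 $ i $ j" using \<open>K = 0\<close> by (simp add: K_def)
    then show ?thesis by (simp add: K0_def complex_eq_iff)
  qed
  then have "a = 0" by (simp add: vec_eq_iff split_paired_All)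
  then show False using a(1) by simp
qed

text \<open>A basis of the chart space is picked among the images of orbit elements, and
  \<open>reach_prefix\<close> leads one trajectory through all the conjugating matrices. The times
  in \<open>C\<close>, matched with the standard basis by \<open>c\<close>, then have independent
  derivatives, and \<open>Dinv\<close> inverts the resulting square differential.\<close>

lemma full_rank_point:
  assumes m: "even m" "m \<ge> 2" "reach m"
  obtains n s0 C and c :: "nat \<Rightarrow> real ^ ('n \<times> 'n)" and Dinv where
    "even n" "\<forall>j. s0 j \<ge> 0" "C \<subseteq> {1..n}" "bij_betw c C Basis" "linear Dinv"
    "\<And>v. Dinv (\<Sum>j\<in>C. (v \<bullet> c j) *\<^sub>R Lam (slot s0 j)) = v"
    "inj Dinv"
proof -
  let ?V = "{Lam (ctrans g ** A k ** g) | g k. g \<in> unitary_group}"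
  let ?d = "DIM(real ^ ('n \<times> 'n))"
  obtain B where B: "B \<subseteq> ?V" "independent B" "?V \<subseteq> span B" "card B = dim ?V"
    using basis_exists by blast
  have "dim ?V = ?d"
    using span_orbit_UNIV[OF m(3)] dim_span[of ?V] by simp
  then have cB: "card B = ?d" using B by simp
  have "finite B" using B(2) independent_imp_finite by blast
  have spanB: "span B = UNIV"
    using span_mono[OF B(3)] span_orbit_UNIV[OF m(3)] by (simp only: span_span top.extremum_unique)
  obtain b where b: "bij_betw b {1..?d} B"
    using ex_bij_betw_nat_finite_1[OF \<open>finite B\<close>] cB by auto
  obtain e :: "nat \<Rightarrow> real ^ ('n \<times> 'n)" where e: "bij_betw e {1..?d} Basis"
    using ex_bij_betw_nat_finite_1[OF finite_Basis] by metis
  have "\<exists>g k. g \<in> unitary_group \<and> (i \<in> {1..?d} \<longrightarrow> b i = Lam (ctrans g ** A k ** g))" for i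
  proof (cases "i \<in> {1..?d}")
    case True
    then have "b i \<in> ?V" using b B(1) bij_betwE by blast
    then show ?thesis by blast
  next
    case False
    then show ?thesis using unitary_one by blast
  qed
  then obtain g k where gk: "\<And>i. g i \<in> unitary_group"
    "\<And>i. i \<in> {1..?d} \<Longrightarrow> b i = Lam (ctrans (g i) ** A (k i) ** g i)"
    by metis
  have "\<exists>s. (\<forall>j. s j \<ge> 0) \<and> (\<forall>i\<in>{1..?d}. J s (i * m) = g i)"
    by (rule reach_prefix[OF m(1,3) gk(1)])
  then obtain s0 where s0: "\<forall>j. s0 j \<ge> 0" "\<forall>i\<in>{1..?d}. J s0 (i * m) = g i"
    by (elim exE conjE)
  \<comment> \<open>The end of block \<open>i\<close> offers the conjugate of \<open>A 2\<close>,
    and the next position that of \<open>A 1\<close>.\<close>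
  define pos where "pos i = (if odd (k i) then Suc (i * m) else i * m)" for i :: nat
  have slot_pos: "Lam (slot s0 (pos i)) = b i" if i: "i \<in> {1..?d}" for i
  proof (cases "odd (k i)")
    case True
    then show ?thesis
      using slot_Suc_even[of "i * m" s0] m(1) s0(2) gk(2)[OF i] i by (simp add: pos_def A_def)
  next
    case False
    then show ?thesis
      using slot_even[of "i * m" s0] m(1) s0(2) gk(2)[OF i] i by (simp add: pos_def A_def)
  qed
  have pos_div: "pos i div m = i" for i
  proof -
    have "Suc (i * m) div m = i" using m(2) div_mult_self1[of m 1 i] by simp
    then show ?thesis using m(2) by (simp add: pos_def)
  qed
  define C where "C = pos ` {1..?d}"
  define c where "c j = e (j div m)" for j
  have posb: "bij_betw pos {1..?d} C"
    unfolding C_def by (rule inj_on_imp_bij_betw, rule inj_on_inverseI[of _ "\<lambda>j. j div m"], rule pos_div)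
  have "bij_betw (\<lambda>j. j div m) C {1..?d}"
    by (rule bij_betw_byWitness[where f'=pos]) (auto simp: C_def pos_div)
  from bij_betw_trans[OF this e] have cC: "bij_betw c C Basis"
    by (simp add: c_def[abs_def] o_def)
  \<comment> \<open>The last position in use can be \<open>?d * m + 1\<close>; adding 2 makes room
    for it and keeps the length even.\<close>
  define n where "n = ?d * m + 2"
  have Cn: "C \<subseteq> {1..n}"
  proof
    fix j assume "j \<in> C"
    then obtain i where i: "i \<in> {1..?d}" "j = pos i" by (auto simp: C_def)
    have "i * m \<le> ?d * m" using i by (intro mult_le_mono1) simp
    moreover have "1 * 1 \<le> i * m" using i m(2) by (intro mult_le_mono) auto
    moreover have "j = i * m \<or> j = i * m + 1" using i by (simp add: pos_def)
    ultimately show "j \<in> {1..n}" unfolding atLeastAtMost_iff n_def by linarith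
  qed
  define D where "D v = (\<Sum>j\<in>C. (v \<bullet> c j) *\<^sub>R Lam (slot s0 j))" for v
  have D: "D v = (\<Sum>i\<in>{1..?d}. (v \<bullet> e i) *\<^sub>R b i)" for v
    unfolding D_def
    by (subst sum.reindex_bij_betw[OF posb, symmetric]) (auto intro!: sum.cong simp: c_def pos_div slot_pos)
  have linD: "linear D"
    unfolding D_def by (rule linearI) (simp_all add: inner_add_left sum.distrib scaleR_add_left scaleR_sum_right)
  have De: "D (e i) = b i" if i: "i \<in> {1..?d}" for i
  proof -
    have "e i \<bullet> e i' = (if i' = i then 1 else 0)" if "i' \<in> {1..?d}" for i'
      using e i that by (subst inner_Basis) (auto dest: bij_betwE bij_betw_imp_inj_on[THEN inj_onD])
    then have "D (e i) = (\<Sum>i'\<in>{1..?d}. (if i' = i then b i else 0))"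
      unfolding D by (intro sum.cong) auto
    then show ?thesis using i by simp
  qed
  have "B \<subseteq> range D"
    using De b by (auto simp: bij_betw_def) (metis rangeI atLeastAtMost_iff)
  then have "span B \<subseteq> range D"
    using linD by (intro span_minimal) (auto intro: linear_subspace_image subspace_UNIV)
  then have "surj D" using spanB by auto
  then obtain Dinv where Dinv: "linear Dinv" "\<And>v. Dinv (D v) = v" "\<And>v. D (Dinv v) = v"
    using linear_surj_right_inverse linD linear_surjective_isomorphism[OF linD] by blast
  show ?thesis
    by (rule that[OF _ s0(1) Cn cC Dinv(1) Dinv(2)[unfolded D_def]])
      (use m in \<open>auto simp: n_def intro: inj_on_inverseI[of _ D] Dinv(3)\<close>)
qed

end

section \<open>Overlap of the laws started near the identity\<close>

context herm_pair begin

text \<open>Lets a vector of a Euclidean space act as a list of switching times: its coordinates are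
  the free times, and the others stay frozen at \<open>y\<close>.\<close>

definition fill :: "nat set \<Rightarrow> (nat \<Rightarrow> 'e::real_inner) \<Rightarrow> 'e \<Rightarrow> (nat \<Rightarrow> real) \<Rightarrow> nat \<Rightarrow> real" where
  "fill C c x y j = (if j \<in> C then x \<bullet> c j else y j)"

lemma sum_Basis_coordinate:
  fixes c :: "nat \<Rightarrow> 'e::euclidean_space"
  assumes "finite C" and c: "bij_betw c C Basis" and j: "j \<in> C"
  shows "(\<Sum>i\<in>C. u i *\<^sub>R c i) \<bullet> c j = u j"
proof -
  have "c i \<bullet> c j = (if i = j then 1 else 0)" if "i \<in> C" for i
    using c that j by (subst inner_Basis) (auto dest: bij_betwE bij_betw_imp_inj_on[THEN inj_onD])
  then have "(\<Sum>i\<in>C. u i *\<^sub>R c i) \<bullet> c j = (\<Sum>i\<in>C. if i = j then u j else 0)"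
    unfolding inner_sum_left by (intro sum.cong) auto
  then show ?thesis using assms by simp
qed

lemma fill_dist:
  fixes c :: "nat \<Rightarrow> 'e::euclidean_space"
  assumes "C \<subseteq> {1..n}" "\<And>j. j \<in> C \<Longrightarrow> c j \<in> Basis"
  shows "(\<Sum>j\<in>{1..n}. \<bar>fill C c x y j - fill C c x' y' j\<bar>)
    \<le> real n * norm (x - x') + (\<Sum>j\<in>{1..n} - C. \<bar>y j - y' j\<bar>)"
proof -
  have fin: "finite C" using assms(1) finite_subset by blast
  have "(\<Sum>j\<in>{1..n}. \<bar>fill C c x y j - fill C c x' y' j\<bar>)
      = (\<Sum>j\<in>{1..n} - C. \<bar>y j - y' j\<bar>) + (\<Sum>j\<in>C. \<bar>(x - x') \<bullet> c j\<bar>)"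
    by (subst sum.subset_diff[OF assms(1)]) (auto simp: fill_def inner_diff_left intro!: sum.cong)
  also have "(\<Sum>j\<in>C. \<bar>(x - x') \<bullet> c j\<bar>) \<le> (\<Sum>j\<in>C. norm (x - x'))"
    using assms(2) by (intro sum_mono Basis_le_norm) auto
  also have "\<dots> \<le> real n * norm (x - x')"
    using card_mono[OF _ assms(1)] by (simp add: mult_right_mono)
  finally show ?thesis by simp
qed

text \<open>The normalised map \<open>f\<close> is close to the translation by \<open>- x0\<close>
  on the ball, uniformly in frozen times near \<open>s0\<close> and starts near the identity, so
  both starts cover the same ball \<open>T\<close>. The chart is injective there, so a common value
  is a common endpoint. It lies in \<open>Q\<close> or outside, hence the images of the two sets
  whose measures are added cover \<open>T\<close>.\<close>

theorem overlap_lebesgue: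
  assumes m: "even m" "m \<ge> 2" "reach m"
  obtains n s0 C r \<eta> m0 and c :: "nat \<Rightarrow> real ^ ('n \<times> 'n)" and a where
    "even n" "\<forall>j. s0 j \<ge> 0" "C \<subseteq> {1..n}" "bij_betw c C Basis" "r > 0" "\<eta> > 0" "m0 > 0"
    "\<And>x b. x \<in> cball a r \<Longrightarrow> b \<in> Basis \<Longrightarrow> x \<bullet> b \<ge> 0"
    "\<And>y (h1 :: 'n cmat) (h2 :: 'n cmat) Q. (\<And>j. j \<in> {1..n} - C \<Longrightarrow> \<bar>y j - s0 j\<bar> \<le> \<eta>) \<Longrightarrow> h1 \<in> unitary_group \<Longrightarrow> h2 \<in> unitary_group \<Longrightarrow>
       norm (h1 - mat 1) \<le> \<eta> \<Longrightarrow> norm (h2 - mat 1) \<le> \<eta> \<Longrightarrow> Q \<in> sets borel \<Longrightarrow>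
       m0 \<le> measure lborel {x \<in> cball a r. J (fill C c x y) n ** h1 \<in> Q}
            + measure lborel {x \<in> cball a r. J (fill C c x y) n ** h2 \<notin> Q}"
proof -
  obtain n s0 C and c :: "nat \<Rightarrow> real ^ ('n \<times> 'n)" and Dinv where
    n: "even n" and s0: "\<forall>j. s0 j \<ge> 0" and C: "C \<subseteq> {1..n}" and c: "bij_betw c C Basis"
    and linDinv: "linear Dinv"
    and Dinv: "\<And>v. Dinv (\<Sum>j\<in>C. (v \<bullet> c j) *\<^sub>R Lam (slot s0 j)) = v"
    and Dinj: "inj Dinv"
    by (rule full_rank_point[OF m], rule that)
  let ?d = "real DIM(real ^ ('n \<times> 'n))"
  have cB: "c j \<in> Basis" if "j \<in> C" for j using c that bij_betwE by blast
  have fin: "finite C" using C finite_subset by blast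
  define x0 where "x0 = (\<Sum>j\<in>C. s0 j *\<^sub>R c j)"
  have x0: "x0 \<bullet> c j = s0 j" if "j \<in> C" for j
    unfolding x0_def by (rule sum_Basis_coordinate[OF fin c that])
  have fill0: "fill C c x0 s0 = s0" by (auto simp: fill_def x0 fun_eq_iff)
  define g0 where "g0 = J s0 n"
  have g0 [simp]: "g0 \<in> unitary_group" by (simp add: g0_def)
  \<comment> \<open>Translation by the inverse of \<open>g0\<close> brings the endpoints near the
    identity, where the chart separates unitary matrices; \<open>Dinv\<close> in \<open>f\<close>
    makes the derivative at \<open>x0\<close> the identity.\<close>
  define U where "U y h x = ctrans g0 ** (J (fill C c x y) n ** h)" for y and h :: "'n cmat" and x
  define f where "f y h x = Dinv (chart (U y h x))" for y and h :: "'n cmat" and x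
  define N where "N y = (\<Sum>j\<in>{1..n} - C. \<bar>y j - s0 j\<bar>)" for y
  have U0: "U s0 (mat 1) x0 = mat 1"
    by (simp add: U_def fill0 g0_def[symmetric] unitary_left)
  have U_unitary: "U y h x \<in> unitary_group" if "h \<in> unitary_group" for y and h :: "'n cmat" and x
    unfolding U_def using that by (intro unitary_mult unitary_ctrans g0 J_unitary)
  have Ulip: "norm (U y h x - U y' h' x') \<le> cA * (real n * norm (x - x') + (\<Sum>j\<in>{1..n} - C. \<bar>y j - y' j\<bar>)) + norm (h - h')"
    if h: "h \<in> unitary_group" for y y' h h' x x'
  proof -
    let ?J = "J (fill C c x y) n" and ?J' = "J (fill C c x' y') n"
    have "U y h x - U y' h' x' = ctrans g0 ** ((?J - ?J') ** h + ?J' ** (h - h'))"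
      by (simp add: U_def cm.diff_left cm.diff_right cm.add_right)
    then have "norm (U y h x - U y' h' x') = norm ((?J - ?J') ** h + ?J' ** (h - h'))"
      by (simp add: norm_unitary_left unitary_ctrans)
    also have "\<dots> \<le> norm (?J - ?J') + norm (h - h')"
      by (rule norm_triangle_le) (simp add: norm_unitary_left norm_unitary_right h)
    also have "norm (?J - ?J') \<le> cA * (\<Sum>j\<in>{1..n}. \<bar>fill C c x y j - fill C c x' y' j\<bar>)"
      by (rule J_lipschitz)
    also have "\<dots> \<le> cA * (real n * norm (x - x') + (\<Sum>j\<in>{1..n} - C. \<bar>y j - y' j\<bar>))"
      using cA_pos by (intro mult_left_mono fill_dist C cB) auto
    finally show ?thesis by simp
  qed
  obtain LB where LB: "LB > 0" "\<And>X. norm (Dinv (chart X)) \<le> LB * norm X"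
    using linear_bounded_pos[OF linear_compose[OF linear_chart linDinv]] by (auto simp: o_def)
  have flip: "norm (f y h x - f y' h' x') \<le> LB * norm (U y h x - U y' h' x')" for y h x y' h' x'
    using LB(2)[of "U y h x - U y' h' x'"] by (simp add: f_def linear_diff[OF linDinv] linear_diff[OF linear_chart])
  have f0: "f s0 (mat 1) x0 = 0"
    by (simp add: f_def U0 linear_0[OF linDinv])
  have fderiv: "(f s0 (mat 1) has_derivative (\<lambda>v. v)) (at x0)"
  proof -
    define s where "s j x = fill C c x s0 j" for j x
    define s' where "s' j v = (if j \<in> C then v \<bullet> c j else 0)" for j and v :: "real ^ ('n \<times> 'n)"
    have s: "(s j has_derivative s' j) (at x0)" for j
      by (cases "j \<in> C") (auto simp: s_def[abs_def] s'_def[abs_def] fill_def intro!: derivative_eq_intros)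
    have s0': "(\<lambda>j. s j x0) = s0" using fill0 by (simp add: s_def[abs_def])
    have "((\<lambda>x. J (\<lambda>j. s j x) n) has_derivative (\<lambda>v. g0 ** (\<Sum>j\<in>{1..n}. s' j v *\<^sub>R slot s0 j))) (at x0)"
      using J_has_derivative[of s s' x0 n, OF s] unfolding s0' g0_def .
    then have "((\<lambda>x. ctrans g0 ** J (\<lambda>j. s j x) n) has_derivative
        (\<lambda>v. ctrans g0 ** (g0 ** (\<Sum>j\<in>{1..n}. s' j v *\<^sub>R slot s0 j)))) (at x0)"
      by (rule bounded_linear.has_derivative[OF cm.bounded_linear_right])
    then have "((\<lambda>x. U s0 (mat 1) x) has_derivative (\<lambda>v. (\<Sum>j\<in>{1..n}. s' j v *\<^sub>R slot s0 j))) (at x0)"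
      by (simp add: U_def s_def unitary_cancel_left)
    then have "((\<lambda>x. Dinv (chart (U s0 (mat 1) x))) has_derivative
        (\<lambda>v. Dinv (chart (\<Sum>j\<in>{1..n}. s' j v *\<^sub>R slot s0 j)))) (at x0)"
      by (intro bounded_linear.has_derivative[OF linear_conv_bounded_linear[THEN iffD1, OF linDinv]]
          bounded_linear.has_derivative[OF linear_conv_bounded_linear[THEN iffD1, OF linear_chart]])
    moreover have "Dinv (chart (\<Sum>j\<in>{1..n}. s' j v *\<^sub>R slot s0 j)) = v" for v
    proof -
      have "chart (\<Sum>j\<in>{1..n}. s' j v *\<^sub>R slot s0 j) = (\<Sum>j\<in>{1..n}. s' j v *\<^sub>R Lam (slot s0 j))"
        by (simp add: linear_sum[OF linear_chart] linear_cmul[OF linear_chart] chart_skew[OF skew_slot])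
      also have "\<dots> = (\<Sum>j\<in>C. (v \<bullet> c j) *\<^sub>R Lam (slot s0 j))"
        by (rule sum.mono_neutral_cong_right) (use C in \<open>auto simp: s'_def\<close>)
      finally show ?thesis by (simp add: Dinv)
    qed
    ultimately show ?thesis by (simp add: f_def[abs_def])
  qed
  obtain \<rho> where \<rho>: "\<rho> > 0" "\<And>u v :: 'n cmat. u \<in> unitary_group \<Longrightarrow> v \<in> unitary_group \<Longrightarrow> norm (u - mat 1) < \<rho> \<Longrightarrow>
     norm (v - mat 1) < \<rho> \<Longrightarrow> chart u = chart v \<Longrightarrow> u = v"
    using chart_inj_near_one by metis
  \<comment> \<open>The ball will be centred at \<open>x0 + r *\<^sub>R One\<close>, so its points
    are within \<open>dd * r\<close> of \<open>x0\<close>.\<close>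
  define dd where "dd = ?d + 1"
  have dd: "dd > 0" unfolding dd_def by (rule add_nonneg_pos) auto
  then have "1 / (4 * dd) > 0" by simp
  then obtain \<delta> where \<delta>: "\<delta> > 0" "\<And>x. norm (x - x0) < \<delta> \<Longrightarrow>
      norm (f s0 (mat 1) x - f s0 (mat 1) x0 - (x - x0)) \<le> 1 / (4 * dd) * norm (x - x0)"
    using fderiv unfolding has_derivative_at_alt by metis
  \<comment> \<open>The first bound limits the linearisation error on the ball to
    \<open>r / 4\<close>, the second limits the drift of \<open>U\<close> over the ball to
    \<open>\<rho> / 4\<close>.\<close>
  define r where "r = min (\<delta> / (2 * dd)) (\<rho> / (4 * (cA * real n + 1) * dd))"
  have cn: "cA * real n + 1 > 0" using cA_pos by (simp add: add_nonneg_pos)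
  have r: "r > 0" using \<delta>(1) \<rho>(1) cn dd by (simp add: r_def)
  have r1: "dd * r < \<delta>"
  proof -
    have "dd * r \<le> dd * (\<delta> / (2 * dd))" using dd by (intro mult_left_mono) (auto simp: r_def)
    also have "\<dots> = \<delta> / 2" using dd by (simp add: field_simps)
    finally show ?thesis using \<delta>(1) by simp
  qed
  have r2: "cA * (real n * (dd * r)) \<le> \<rho> / 4"
  proof -
    have "cA * (real n * (dd * r)) = (cA * real n) * (dd * r)" by simp
    also have "\<dots> \<le> (cA * real n + 1) * (dd * r)" using r dd by (intro mult_right_mono) auto
    also have "\<dots> \<le> (cA * real n + 1) * (dd * (\<rho> / (4 * (cA * real n + 1) * dd)))"
      using cn dd by (intro mult_left_mono) (auto simp: r_def)
    also have "\<dots> = \<rho> / 4"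
    proof -
      have "X * (dd * (\<rho> / (4 * X * dd))) = \<rho> / 4" if "X > 0" for X
        using that dd by (simp add: field_simps)
      from this[OF cn] show ?thesis .
    qed
    finally show ?thesis .
  qed
  \<comment> \<open>Moving \<open>y\<close> and \<open>h\<close> by \<open>\<eta>\<close> shifts
    \<open>f\<close> by at most \<open>r / 4\<close> and \<open>U\<close> by at most
    \<open>\<rho> / 4\<close>.\<close>
  define \<eta> where "\<eta> = min (r / (4 * LB)) (\<rho> / 4) / (cA * real n + 1)"
  have \<eta>: "\<eta> > 0" using r LB(1) \<rho>(1) cn by (simp add: \<eta>_def)
  have \<eta>1: "cA * (real n * \<eta>) + \<eta> \<le> r / (4 * LB)" "cA * (real n * \<eta>) + \<eta> \<le> \<rho> / 4"
  proof -
    have "cA * (real n * \<eta>) + \<eta> = (cA * real n + 1) * \<eta>" by (simp add: algebra_simps)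
    also have "\<dots> = min (r / (4 * LB)) (\<rho> / 4)" using cn by (simp add: \<eta>_def)
    finally show "cA * (real n * \<eta>) + \<eta> \<le> r / (4 * LB)" "cA * (real n * \<eta>) + \<eta> \<le> \<rho> / 4" by simp_all
  qed
  \<comment> \<open>Times must be nonnegative and those of \<open>s0\<close> may vanish, so the ball is moved into the orthant.\<close>
  define a where "a = x0 + r *\<^sub>R One"
  have xx0: "norm (x - x0) \<le> dd * r" if "x \<in> cball a r" for x
  proof -
    have "norm (One :: real ^ ('n \<times> 'n)) \<le> ?d"
      using norm_sum[of "\<lambda>b. b" "Basis :: (real ^ ('n \<times> 'n)) set"] by simp
    then have "norm (r *\<^sub>R (One :: real ^ ('n \<times> 'n))) \<le> r * ?d" using r by simp
    moreover have "norm (x - a) \<le> r" using that by (simp add: dist_norm norm_minus_commute)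
    moreover have "norm (x - x0) \<le> norm (x - a) + norm (r *\<^sub>R (One :: real ^ ('n \<times> 'n)))"
      using norm_triangle_ineq[of "x - a" "r *\<^sub>R One"] by (simp add: a_def algebra_simps)
    ultimately show ?thesis unfolding dd_def by (simp add: algebra_simps)
  qed
  have orth: "x \<bullet> b \<ge> 0" if x: "x \<in> cball a r" and b: "b \<in> Basis" for x b
  proof -
    obtain j where j: "j \<in> C" "b = c j" using c b by (auto simp: bij_betw_def)
    have "\<bar>(x - a) \<bullet> b\<bar> \<le> norm (x - a)" by (rule Basis_le_norm[OF b])
    also have "\<dots> \<le> r" using x by (simp add: dist_norm norm_minus_commute)
    finally have "a \<bullet> b - r \<le> x \<bullet> b" by (simp add: inner_diff_left abs_le_iff)
    moreover have "a \<bullet> b = s0 j + r"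
      using j b by (simp add: a_def inner_add_left x0 inner_sum_left_Basis)
    ultimately show ?thesis using s0 by (metis add_diff_cancel_right' order_trans)
  qed
  define Bf where "Bf = LB * (cA * real n) + 1"
  have Bf: "Bf > 0" using LB(1) cA_pos by (simp add: Bf_def add_nonneg_pos)
  define Bm where "Bm = (2 * Bf * ?d) ^ DIM(real ^ ('n \<times> 'n))"
  have Bm: "Bm > 0" using Bf by (simp add: Bm_def)
  \<comment> \<open>The translate of the ball, shrunk to radius \<open>r / 2\<close> to absorb the
    total error \<open>r / 2\<close> of \<open>f\<close>. In \<open>m0\<close>, half of the measure
    of \<open>T\<close> is reserved for the slack \<open>e\<close> of the two coverings.\<close>
  define T where "T = cball (a - x0) (r / 2)"
  define m0 where "m0 = measure lborel T / (2 * Bm)"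
  have mT: "measure lborel T > 0" using r by (simp add: T_def content_cball_pos)
  have m0: "m0 > 0" using mT Bm by (simp add: m0_def)
  show ?thesis
  proof (rule that[OF n s0 C c r \<eta> m0 orth])
    fix y and h1 h2 :: "'n cmat" and Q :: "'n cmat set"
    assume y: "\<And>j. j \<in> {1..n} - C \<Longrightarrow> \<bar>y j - s0 j\<bar> \<le> \<eta>"
      and h: "h1 \<in> unitary_group" "h2 \<in> unitary_group" "norm (h1 - mat 1) \<le> \<eta>" "norm (h2 - mat 1) \<le> \<eta>"
      and Q: "Q \<in> sets borel"
    have Ny: "(\<Sum>j\<in>{1..n} - C. \<bar>y j - s0 j\<bar>) \<le> real n * \<eta>"
    proof -
      have "(\<Sum>j\<in>{1..n} - C. \<bar>y j - s0 j\<bar>) \<le> (\<Sum>j\<in>{1..n} - C. \<eta>)" by (rule sum_mono) (rule y)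
      also have "\<dots> \<le> real n * \<eta>"
        using \<eta> card_mono[of "{1..n}" "{1..n} - C"] by (simp add: mult_right_mono)
      finally show ?thesis .
    qed
    define near where "near h \<longleftrightarrow> h \<in> unitary_group \<and> norm (h - mat 1) \<le> \<eta>" for h :: "'n cmat"
    have near: "near h1" "near h2" using h by (auto simp: near_def)
    have Unear: "norm (U y h x - mat 1) < \<rho>" if hh: "near h" and x: "x \<in> cball a r" for h x
    proof -
      have "norm (U y h x - mat 1) \<le> cA * (real n * norm (x - x0) + (\<Sum>j\<in>{1..n} - C. \<bar>y j - s0 j\<bar>)) + norm (h - mat 1)"
        using Ulip[of h y x s0 "mat 1" x0] hh by (simp add: U0 near_def)
      also have "\<dots> \<le> cA * (real n * (dd * r) + real n * \<eta>) + \<eta>"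
        using xx0[OF x] Ny hh cA_pos by (intro add_mono mult_left_mono) (auto simp: near_def)
      also have "\<dots> = cA * (real n * (dd * r)) + (cA * (real n * \<eta>) + \<eta>)" by (simp add: algebra_simps)
      also have "\<dots> \<le> \<rho> / 4 + \<rho> / 4" by (intro add_mono r2 \<eta>1)
      also have "\<dots> < \<rho>" using \<rho>(1) by simp
      finally show ?thesis .
    qed
    have fnear: "norm (f y h x - (x - x0)) \<le> r / 2" if hh: "near h" and x: "x \<in> cball a r" for h x
    proof -
      have "norm (f y h x - f s0 (mat 1) x) \<le> LB * norm (U y h x - U s0 (mat 1) x)" by (rule flip)
      also have "\<dots> \<le> LB * (cA * (real n * \<eta>) + \<eta>)"
      proof (rule mult_left_mono)
        have "norm (U y h x - U s0 (mat 1) x) \<le> cA * (real n * norm (x - x) + (\<Sum>j\<in>{1..n} - C. \<bar>y j - s0 j\<bar>)) + norm (h - mat 1)"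
          using hh by (intro Ulip) (simp add: near_def)
        also have "\<dots> \<le> cA * (real n * \<eta>) + \<eta>"
          using Ny hh cA_pos by (intro add_mono mult_left_mono) (auto simp: near_def)
        finally show "norm (U y h x - U s0 (mat 1) x) \<le> cA * (real n * \<eta>) + \<eta>" .
      qed (use LB in auto)
      also have "\<dots> \<le> LB * (r / (4 * LB))" using LB(1) \<eta>1 by (intro mult_left_mono) auto
      also have "\<dots> = r / 4" using LB(1) by simp
      finally have 1: "norm (f y h x - f s0 (mat 1) x) \<le> r / 4" .
      have "norm (x - x0) < \<delta>" using xx0[OF x] r1 by linarith
      from \<delta>(2)[OF this] have "norm (f s0 (mat 1) x - (x - x0)) \<le> 1 / (4 * dd) * norm (x - x0)"
        by (simp add: f0)
      also have "\<dots> \<le> 1 / (4 * dd) * (dd * r)" using dd by (intro mult_left_mono xx0[OF x]) auto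
      also have "\<dots> = r / 4" using dd by (simp add: field_simps)
      finally have 2: "norm (f s0 (mat 1) x - (x - x0)) \<le> r / 4" .
      have "f y h x - (x - x0) = (f y h x - f s0 (mat 1) x) + (f s0 (mat 1) x - (x - x0))" by simp
      then show ?thesis
        using norm_triangle_mono[OF 1 2] by (simp only:)
    qed
    have flips: "norm (f y h x - f y h x') \<le> Bf * norm (x - x')" if "near h" for h x x'
    proof -
      have "norm (f y h x - f y h x') \<le> LB * norm (U y h x - U y h x')" by (rule flip)
      also have "\<dots> \<le> LB * (cA * (real n * norm (x - x')))"
        using LB(1) Ulip[of h y x y h x'] that by (intro mult_left_mono) (auto simp: near_def)
      also have "\<dots> \<le> Bf * norm (x - x')" by (simp add: Bf_def algebra_simps)
      finally show ?thesis .
    qed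
    \<comment> \<open>A solution is a fixed point of the map taking \<open>w\<close> to
      \<open>z + (w - f y h w)\<close>; it preserves the ball because \<open>z\<close> and the error
      of \<open>f\<close> each deviate by at most \<open>r / 2\<close>.\<close>
    have surj: "\<exists>x\<in>cball a r. f y h x = z" if hh: "near h" and z: "z \<in> T" for h z
    proof (rule brouwer_surjective_cball[of a r "f y h" z T])
      show "continuous_on (cball a r) (f y h)"
      proof (rule lipschitz_on_continuous_on)
        show "Bf-lipschitz_on (cball a r) (f y h)"
          using flips[OF hh] Bf by (intro lipschitz_onI) (auto simp: dist_norm)
      qed
      show "0 < r" by (rule r)
      show "z \<in> T" by (rule z)
      fix z w assume z: "z \<in> T" and w: "w \<in> cball a r"
      have "norm (z - (a - x0)) \<le> r / 2" using z by (simp add: T_def dist_norm norm_minus_commute)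
      from norm_triangle_mono[OF this fnear[OF hh w], THEN order_trans[rotated]]
      have "norm ((z - (a - x0)) - (f y h w - (w - x0))) \<le> r"
        using fnear[OF hh w] \<open>norm (z - (a - x0)) \<le> r / 2\<close> norm_triangle_ineq4[of "z - (a - x0)" "f y h w - (w - x0)"] by linarith
      then show "z + (w - f y h w) \<in> cball a r"
        by (simp add: dist_norm norm_minus_commute algebra_simps)
    qed
    define S1 where "S1 = {x \<in> cball a r. J (fill C c x y) n ** h1 \<in> Q}"
    define S2 where "S2 = {x \<in> cball a r. J (fill C c x y) n ** h2 \<notin> Q}"
    have contJ: "continuous_on UNIV (\<lambda>x. J (fill C c x y) n ** h)" if "h \<in> unitary_group" for h
    proof (rule lipschitz_on_continuous_on)
      show "(cA * real n)-lipschitz_on UNIV (\<lambda>x. J (fill C c x y) n ** h)"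
      proof (rule lipschitz_onI)
        fix x x'
        have "norm (U y h x - U y h x') = norm (J (fill C c x y) n ** h - J (fill C c x' y) n ** h)"
          unfolding U_def cm.diff_right[symmetric] by (rule norm_unitary_left) (rule unitary_ctrans[OF g0])
        then show "dist (J (fill C c x y) n ** h) (J (fill C c x' y) n ** h) \<le> cA * real n * dist x x'"
          using Ulip[OF that, of y x y h x'] by (simp add: dist_norm)
      qed (use cA_pos in auto)
    qed
    have Jm: "(\<lambda>x. J (fill C c x y) n ** h) -` P \<in> sets borel" if "h \<in> unitary_group" "P \<in> sets borel" for h P
      using measurable_sets[OF borel_measurable_continuous_onI[OF contJ[OF that(1)]] that(2)] by simp
    have S1b: "S1 \<in> sets borel"
    proof -
      have "S1 = cball a r \<inter> (\<lambda>x. J (fill C c x y) n ** h1) -` Q" by (auto simp: S1_def)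
      then show ?thesis using Jm[OF h(1) Q] by simp
    qed
    have S2b: "S2 \<in> sets borel"
    proof -
      have "S2 = cball a r \<inter> (\<lambda>x. J (fill C c x y) n ** h2) -` (- Q)" by (auto simp: S2_def)
      then show ?thesis using Jm[OF h(2), of "- Q"] Q by simp
    qed
    have Sb: "S1 \<subseteq> cball a r" "S2 \<subseteq> cball a r" by (auto simp: S1_def S2_def)
    have Slm: "S1 \<in> lmeasurable" "S2 \<in> lmeasurable" "bounded S1" "bounded S2"
      using Sb S1b S2b bounded_subset[OF bounded_cball]
      by (auto intro!: bounded_set_imp_lmeasurable)
    have cov: "T \<subseteq> f y h1 ` S1 \<union> f y h2 ` S2"
    proof
      fix z assume "z \<in> T"
      then obtain x1 x2 where x: "x1 \<in> cball a r" "f y h1 x1 = z" "x2 \<in> cball a r" "f y h2 x2 = z"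
        using surj near by metis
      then have ch: "chart (U y h1 x1) = chart (U y h2 x2)"
        using Dinj unfolding f_def by (metis injD)
      have "U y h1 x1 = U y h2 x2"
        by (rule \<rho>(2)[OF U_unitary[OF h(1)] U_unitary[OF h(2)] Unear[OF near(1) x(1)] Unear[OF near(2) x(3)] ch])
      then have "g0 ** U y h1 x1 = g0 ** U y h2 x2" by simp
      then have "J (fill C c x1 y) n ** h1 = J (fill C c x2 y) n ** h2"
        by (simp add: U_def matrix_mul_assoc unitary_right)
      then show "z \<in> f y h1 ` S1 \<union> f y h2 ` S2"
      proof (cases "J (fill C c x1 y) n ** h1 \<in> Q")
        case True
        then have "x1 \<in> S1" using x(1) by (simp add: S1_def)
        then show ?thesis using x(2) by blast
      next
        case False
        then have "x2 \<in> S2" using x(3) \<open>J (fill C c x1 y) n ** h1 = _\<close> by (simp add: S2_def)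
        then show ?thesis using x(4) by blast
      qed
    qed
    have "measure lebesgue T \<le> Bm * (measure lebesgue S1 + measure lebesgue S2) + measure lebesgue T / 2"
    proof -
      define e where "e = measure lborel T / (4 * Bm)"
      have e: "e > 0" using mT Bm by (simp add: e_def)
      obtain T1 where T1: "T1 \<in> lmeasurable" "f y h1 ` S1 \<subseteq> T1" "measure lebesgue T1 \<le> Bm * (measure lebesgue S1 + e)"
        using lipschitz_image_outer_measure[OF Slm(1,3) Bf e flips[OF near(1)]] unfolding Bm_def by blast
      obtain T2 where T2: "T2 \<in> lmeasurable" "f y h2 ` S2 \<subseteq> T2" "measure lebesgue T2 \<le> Bm * (measure lebesgue S2 + e)"
        using lipschitz_image_outer_measure[OF Slm(2,4) Bf e flips[OF near(2)]] unfolding Bm_def by blast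
      have "T \<subseteq> T1 \<union> T2" using cov T1(2) T2(2) by blast
      then have "measure lebesgue T \<le> measure lebesgue (T1 \<union> T2)"
        using T1(1) T2(1) by (intro measure_mono_fmeasurable) (simp_all add: T_def fmeasurable.Un)
      also have "\<dots> \<le> measure lebesgue T1 + measure lebesgue T2"
        using T1 T2 by (intro measure_Un_le) auto
      also have "\<dots> \<le> Bm * (measure lebesgue S1 + e) + Bm * (measure lebesgue S2 + e)"
        by (intro add_mono T1 T2)
      also have "\<dots> = Bm * (measure lebesgue S1 + measure lebesgue S2) + measure lborel T / 2"
        using Bm by (simp add: e_def field_simps)
      finally show ?thesis by (simp add: T_def)
    qed
    then have "m0 \<le> measure lebesgue S1 + measure lebesgue S2"
      using Bm by (simp add: m0_def T_def field_simps)
    then show "m0 \<le> measure lborel {x \<in> cball a r. J (fill C c x y) n ** h1 \<in> Q}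
            + measure lborel {x \<in> cball a r. J (fill C c x y) n ** h2 \<notin> Q}"
      using S1b S2b by (simp add: S1_def S2_def)
  qed
qed

end

section \<open>The transition operators\<close>

lemma borel_measurable_cmat_mult [measurable]:
  fixes f g :: "'a \<Rightarrow> 'n::finite cmat"
  assumes "f \<in> borel_measurable M" "g \<in> borel_measurable M"
  shows "(\<lambda>x. f x ** g x) \<in> borel_measurable M"
  by (rule borel_measurable_continuous_Pair[OF assms]) (intro cm.continuous_on continuous_intros)

locale walk = herm_pair H1 H2 for H1 H2 :: "'n::finite cmat" +
  fixes \<mu> :: "real measure" and p :: "real \<Rightarrow> ennreal"
  assumes p_meas [measurable]: "p \<in> borel_measurable borel"
    and \<mu>_density: "\<mu> = density lborel p"
    and \<mu>_prob: "prob_space \<mu>"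
    and p_pos: "x \<ge> 0 \<Longrightarrow> p x > 0"
begin

sublocale mu: prob_space \<mu> by (rule \<mu>_prob)

sublocale P: product_sigma_finite "\<lambda>_::nat. \<mu>"
  by (simp add: product_sigma_finite_def mu.sigma_finite_measure_axioms)

lemma sets_\<mu> [measurable_cong, simp]: "sets \<mu> = sets borel"
  by (simp add: \<mu>_density)

lemma space_\<mu> [simp]: "space \<mu> = UNIV"
  by (simp add: \<mu>_density)

lemma prob_PiM: "prob_space (PiM I (\<lambda>_::nat. \<mu>))"
  by (rule prob_space_PiM) (rule \<mu>_prob)

lemma J_measurable:
  assumes "{1..n} \<subseteq> I"
  shows "(\<lambda>s. J s n) \<in> borel_measurable (PiM I (\<lambda>_. \<mu>))"
  using assms
proof (induction n)
  case (Suc n)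
  have sub: "Suc n \<in> I" "{1..n} \<subseteq> I" using Suc.prems by auto
  have [measurable]: "(\<lambda>s. s (Suc n)) \<in> borel_measurable (PiM I (\<lambda>_. \<mu>))"
    using measurable_component_singleton[OF sub(1), of "\<lambda>_. \<mu>"]
    by (subst (asm) measurable_cong_sets[OF refl sets_\<mu>])
  note Suc.IH[OF sub(2), measurable]
  show ?case by simp
qed simp

text \<open>Test functions live on all matrices, so measurability is plain Borel measurability; the
  explicit bound makes every integral below finite.\<close>

definition bm :: "real \<Rightarrow> ('n cmat \<Rightarrow> real) \<Rightarrow> bool" where
  "bm B \<phi> \<longleftrightarrow> \<phi> \<in> borel_measurable borel \<and> (\<forall>x. \<bar>\<phi> x\<bar> \<le> B)"

lemma bm_measurable: "bm B \<phi> \<Longrightarrow> \<phi> \<in> borel_measurable borel"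
  by (simp add: bm_def)

lemma bm_integrable:
  assumes "bm B \<phi>" "prob_space N" "f \<in> borel_measurable N"
  shows "integrable N (\<lambda>x. \<phi> (f x))"
proof -
  interpret prob_space N by fact
  show ?thesis
    by (rule integrable_const_bound[of _ B])
      (use assms in \<open>auto simp: bm_def intro: measurable_compose\<close>)
qed

lemma bm_affine: "bm B \<phi> \<Longrightarrow> bm (\<bar>\<alpha>\<bar> * B + \<bar>\<beta>\<bar>) (\<lambda>x. \<alpha> * \<phi> x + \<beta>)"
  unfolding bm_def
  by (auto intro!: order_trans[OF abs_triangle_ineq] add_mono mult_left_mono simp: abs_mult)

lemma bm_indicator: "Q \<in> sets borel \<Longrightarrow> bm 1 (indicator Q)"
  by (auto simp: bm_def indicator_def)

definition Kop :: "nat \<Rightarrow> ('n cmat \<Rightarrow> real) \<Rightarrow> 'n cmat \<Rightarrow> real" where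
  "Kop j \<phi> x = (\<integral>s. \<phi> (ev j s ** x) \<partial>\<mu>)"

lemma Kop_integrable: "bm B \<phi> \<Longrightarrow> integrable \<mu> (\<lambda>s. \<phi> (ev j s ** x))"
  by (rule bm_integrable[OF _ \<mu>_prob]) auto

lemma Kop_bm: "bm B \<phi> \<Longrightarrow> bm B (Kop j \<phi>)"
  unfolding bm_def
proof safe
  assume [measurable]: "\<phi> \<in> borel_measurable borel" and B: "\<forall>x. \<bar>\<phi> x\<bar> \<le> B"
  show "Kop j \<phi> \<in> borel_measurable borel" unfolding Kop_def by measurable
  fix x
  have "norm (Kop j \<phi> x) \<le> (\<integral>s. norm (\<phi> (ev j s ** x)) \<partial>\<mu>)"
    unfolding Kop_def by (rule integral_norm_bound)
  also have "\<dots> \<le> (\<integral>s. B \<partial>\<mu>)"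
    using Kop_integrable[of B \<phi> j x] B by (intro integral_mono) (auto simp: bm_def)
  finally show "\<bar>Kop j \<phi> x\<bar> \<le> B" by (simp add: mu.prob_space[unfolded space_\<mu>])
qed

lemma Kop_affine: "bm B \<phi> \<Longrightarrow> Kop j (\<lambda>x. \<alpha> * \<phi> x + \<beta>) = (\<lambda>x. \<alpha> * Kop j \<phi> x + \<beta>)"
  using Kop_integrable[of B \<phi> j] by (auto simp: Kop_def fun_eq_iff mu.prob_space[unfolded space_\<mu>])

lemma Kop_mono:
  assumes "bm B \<phi>" "bm B' \<psi>" "\<And>x. x \<in> unitary_group \<Longrightarrow> \<phi> x \<le> \<psi> x" "x \<in> unitary_group"
  shows "Kop j \<phi> x \<le> Kop j \<psi> x"
  unfolding Kop_def
  by (intro integral_mono Kop_integrable[OF assms(1)] Kop_integrable[OF assms(2)] assms unitary_mult ev_unitary)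

text \<open>The composition of \<open>Kop (a + 1)\<close> up to \<open>Kop (a + n)\<close>, the last
  step acting on \<open>\<phi>\<close> innermost: the mean of \<open>\<phi>\<close> after
  \<open>n\<close> steps begun at index \<open>a\<close>. The offset records which generator comes
  next.\<close>

fun T :: "nat \<Rightarrow> nat \<Rightarrow> ('n cmat \<Rightarrow> real) \<Rightarrow> 'n cmat \<Rightarrow> real" where
  "T a 0 \<phi> = \<phi>"
| "T a (Suc n) \<phi> = T a n (Kop (a + Suc n) \<phi>)"

lemma T_bm: "bm B \<phi> \<Longrightarrow> bm B (T a n \<phi>)"
  by (induction n arbitrary: \<phi>) (auto intro: Kop_bm)

lemma T_add: "T a (n + k) \<phi> = T a n (T (a + n) k \<phi>)"
  by (induction k arbitrary: \<phi>) (simp_all add: add.assoc)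

lemma Kop_parity: "even a \<Longrightarrow> Kop (a + j) = Kop j"
  by (simp add: Kop_def fun_eq_iff ev_parity)

lemma T_parity: "even a \<Longrightarrow> T (a + b) n \<phi> = T b n \<phi>"
proof (induction n arbitrary: \<phi>)
  case (Suc n)
  then show ?case using Kop_parity[of a "b + Suc n"] by (simp add: add.assoc)
qed simp

lemma T_affine: "bm B \<phi> \<Longrightarrow> T a n (\<lambda>x. \<alpha> * \<phi> x + \<beta>) = (\<lambda>x. \<alpha> * T a n \<phi> x + \<beta>)"
  by (induction n arbitrary: \<phi>) (simp_all add: Kop_affine Kop_bm)

lemma T_mono:
  assumes "bm B \<phi>" "bm B' \<psi>" "\<And>x. x \<in> unitary_group \<Longrightarrow> \<phi> x \<le> \<psi> x" "x \<in> unitary_group"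
  shows "T a n \<phi> x \<le> T a n \<psi> x"
  using assms
proof (induction n arbitrary: \<phi> \<psi> x)
  case (Suc n)
  show ?case unfolding T.simps
    by (rule Suc.IH[OF Kop_bm[OF Suc.prems(1)] Kop_bm[OF Suc.prems(2)] Kop_mono[OF Suc.prems(1,2,3)] Suc.prems(4)])
qed simp

lemma T_integral:
  assumes "bm B \<phi>"
  shows "T 0 n \<phi> h = (\<integral>s. \<phi> (J s n ** h) \<partial>PiM {1..n} (\<lambda>_. \<mu>))"
  using assms
proof (induction n arbitrary: \<phi>)
  case 0
  interpret prob_space "PiM {} (\<lambda>_::nat. \<mu>)" by (rule prob_PiM)
  show ?case by (simp add: prob_space)
next
  case (Suc n)
  note bm_measurable[OF Suc.prems, measurable] J_measurable[of "Suc n" "insert (Suc n) {1..n}", measurable]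
  have [measurable]: "(\<lambda>s. J s (Suc n)) \<in> borel_measurable (PiM (insert (Suc n) {1..n}) (\<lambda>_. \<mu>))"
    by (rule J_measurable) auto
  have "(\<integral>s. \<phi> (J s (Suc n) ** h) \<partial>PiM (insert (Suc n) {1..n}) (\<lambda>_. \<mu>))
      = (\<integral>s. (\<integral>y. \<phi> (J (s(Suc n := y)) (Suc n) ** h) \<partial>\<mu>) \<partial>PiM {1..n} (\<lambda>_. \<mu>))"
    by (rule P.product_integral_insert) (auto intro!: bm_integrable[OF Suc.prems prob_PiM] borel_measurable_cmat_mult J_measurable simp del: J_Suc)
  also have "\<dots> = (\<integral>s. Kop (Suc n) \<phi> (J s n ** h) \<partial>PiM {1..n} (\<lambda>_. \<mu>))"
  proof -
    have "J (s(Suc n := y)) n = J s n" for s y by (rule J_cong) auto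
    then show ?thesis by (simp add: Kop_def matrix_mul_assoc)
  qed
  also have "\<dots> = T 0 (Suc n) \<phi> h"
    using Suc.IH[OF Kop_bm[OF Suc.prems]] by simp
  finally show ?case by (simp add: atLeastAtMostSuc_conv del: T.simps)
qed

lemma T_indicator:
  assumes "Q \<in> sets borel"
  shows "T 0 n (indicator Q) h = measure (PiM {1..n} (\<lambda>_. \<mu>)) {s \<in> space (PiM {1..n} (\<lambda>_. \<mu>)). J s n ** h \<in> Q}"
proof -
  let ?P = "PiM {1..n} (\<lambda>_. \<mu>)"
  have [measurable]: "(\<lambda>s. J s n) \<in> borel_measurable ?P" by (rule J_measurable) auto
  note assms[measurable]
  have "T 0 n (indicator Q) h = (\<integral>s. indicator Q (J s n ** h) \<partial>?P)"
    by (rule T_integral[OF bm_indicator[OF assms]])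
  also have "\<dots> = (\<integral>s. indicator {s \<in> space ?P. J s n ** h \<in> Q} s \<partial>?P)"
    by (rule Bochner_Integration.integral_cong) (auto simp: indicator_def)
  also have "\<dots> = measure ?P ({s \<in> space ?P. J s n ** h \<in> Q} \<inter> space ?P)" by simp
  also have "{s \<in> space ?P. J s n ** h \<in> Q} \<inter> space ?P = {s \<in> space ?P. J s n ** h \<in> Q}" by auto
  finally show ?thesis .
qed

section \<open>Positive probability of reaching a neighbourhood of the identity\<close>

lemma \<mu>_interval_pos:
  assumes "a \<ge> 0" "d > 0"
  shows "measure \<mu> {a..a + d} > 0"
proof -
  have "emeasure \<mu> {a..a + d} \<noteq> 0"
  proof
    assume "emeasure \<mu> {a..a + d} = 0"
    then have "(\<integral>\<^sup>+x. p x * indicator {a..a + d} x \<partial>lborel) = 0"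
      by (simp add: \<mu>_density emeasure_density)
    then have "AE x in lborel. p x * indicator {a..a + d} x = 0"
      by (subst (asm) nn_integral_0_iff_AE) auto
    then have "AE x in lborel. x \<notin> {a..a + d}"
    proof eventually_elim
      case (elim x)
      then show ?case using p_pos[of x] assms by (auto simp: indicator_def)
    qed
    then have "emeasure lborel {a..a + d} = 0"
      by (subst (asm) AE_iff_measurable[of "{a..a + d}"]) auto
    then show False using assms by simp
  qed
  then show ?thesis by (simp add: mu.emeasure_eq_measure zero_less_measure_iff)
qed

lemma measure_PiE: "finite (I :: nat set) \<Longrightarrow> (\<And>i. i \<in> I \<Longrightarrow> S i \<in> sets borel) \<Longrightarrow>
   measure (PiM I (\<lambda>_. \<mu>)) (Pi\<^sub>E I S) = (\<Prod>i\<in>I. measure \<mu> (S i))"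
proof -
  assume *: "finite (I :: nat set)" "\<And>i. i \<in> I \<Longrightarrow> S i \<in> sets borel"
  then have "emeasure (PiM I (\<lambda>_. \<mu>)) (Pi\<^sub>E I S) = (\<Prod>i\<in>I. emeasure \<mu> (S i))"
    by (intro P.emeasure_PiM) auto
  also have "\<dots> = ennreal (\<Prod>i\<in>I. measure \<mu> (S i))"
    by (simp add: mu.emeasure_eq_measure prod_ennreal)
  finally show ?thesis
    by (rule measure_eq_emeasure_eq_ennreal[rotated]) (simp add: prod_nonneg)
qed

text \<open>From \<open>h\<close>, controls leading to the inverse of \<open>h\<close> and a small
  box of times around them have positive probability; the same box serves all starts near
  \<open>h\<close>. Compactness of the group makes the bound uniform.\<close>

lemma reach_identity:
  assumes m: "reach m" and \<delta>: "\<delta> > 0"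
  shows "\<exists>\<beta>>0. \<forall>h\<in>unitary_group. \<beta> \<le> T 0 m (indicator {x. norm (x - mat 1) \<le> \<delta>}) h"
proof -
  let ?Q = "{x :: 'n cmat. norm (x - mat 1) \<le> \<delta>}"
  let ?P = "PiM {1..m} (\<lambda>_. \<mu>)"
  have Qb [measurable]: "?Q \<in> sets borel"
    by (intro borel_closed closed_Collect_le continuous_intros)
  interpret PP: prob_space ?P by (rule prob_PiM)
  have [measurable]: "(\<lambda>s. J s m) \<in> borel_measurable ?P" by (rule J_measurable) auto
  have "\<exists>\<beta>>0. \<forall>h'\<in>unitary_group \<inter> ball h (\<delta> / 2). \<beta> \<le> T 0 m (indicator ?Q) h'" if h: "h \<in> unitary_group" for h
  proof -
    obtain s where s: "\<forall>j. s j \<ge> 0" "J s m = ctrans h"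
      using m unitary_ctrans[OF h] unfolding reach_def by blast
    \<comment> \<open>With times within \<open>d\<close> of the control the Lipschitz bound costs at
      most \<open>\<delta> / 2\<close>; the distance of the start from \<open>h\<close> costs the
      other half.\<close>
    define X where "X = cA * real m + 1"
    define d where "d = \<delta> / (2 * X)"
    have cm: "X > 0" using cA_pos by (simp add: X_def add_nonneg_pos)
    have d: "d > 0" using \<delta> cm by (simp add: d_def)
    \<comment> \<open>The intervals extend to the right only and so remain where \<open>p\<close> is
      positive, even if a control time is 0.\<close>
    define E where "E = Pi\<^sub>E {1..m} (\<lambda>j. {s j..s j + d})"
    have "measure ?P E = (\<Prod>j\<in>{1..m}. measure \<mu> {s j..s j + d})"
      unfolding E_def by (rule measure_PiE) auto
    also have "\<dots> > 0" using s(1) d by (intro prod_pos \<mu>_interval_pos) auto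
    finally have E: "measure ?P E > 0" .
    have "measure ?P E \<le> T 0 m (indicator ?Q) h'" if h': "h' \<in> unitary_group \<inter> ball h (\<delta> / 2)" for h'
      unfolding T_indicator[OF Qb]
    proof (rule PP.finite_measure_mono)
      show "E \<subseteq> {u \<in> space ?P. J u m ** h' \<in> ?Q}"
      proof
        fix u assume u: "u \<in> E"
        have "J u m ** h' - mat 1 = (J u m - J s m) ** h' + J s m ** (h' - h)"
          by (simp add: cm.diff_left cm.diff_right s(2) unitary_left[OF h])
        then have "norm (J u m ** h' - mat 1) \<le> norm (J u m - J s m) + norm (h' - h)"
          using h' norm_triangle_ineq[of "(J u m - J s m) ** h'" "J s m ** (h' - h)"]
          by (simp add: norm_unitary_left norm_unitary_right)
        also have "norm (J u m - J s m) \<le> cA * (\<Sum>j\<in>{1..m}. \<bar>u j - s j\<bar>)" by (rule J_lipschitz)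
        also have "\<dots> \<le> cA * (\<Sum>j\<in>{1..m}. d)"
        proof (intro mult_left_mono sum_mono)
          fix j assume "j \<in> {1..m}"
          then have "u j \<in> {s j..s j + d}" using u by (auto simp: E_def)
          then show "\<bar>u j - s j\<bar> \<le> d" by auto
        qed (use cA_pos in auto)
        also have "\<dots> = cA * real m * d" by simp
        also have "\<dots> \<le> X * d" using d by (intro mult_right_mono) (auto simp: X_def)
        also have "\<dots> = \<delta> / 2" using cm by (simp add: d_def)
        also have "norm (h' - h) \<le> \<delta> / 2" using h' by (simp add: dist_norm norm_minus_commute)
        finally have "norm (J u m ** h' - mat 1) \<le> \<delta>" by simp
        moreover have "u \<in> space ?P" using u by (auto simp: E_def space_PiM PiE_def Pi_def)
        ultimately show "u \<in> {u \<in> space ?P. J u m ** h' \<in> ?Q}" by simp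
      qed
    qed measurable
    then show ?thesis using E by blast
  qed
  then obtain \<beta> where \<beta>: "\<And>h. h \<in> unitary_group \<Longrightarrow> \<beta> h > 0 \<and>
      (\<forall>h'\<in>unitary_group \<inter> ball h (\<delta> / 2). \<beta> h \<le> T 0 m (indicator ?Q) h')"
    by metis
  have "(unitary_group :: 'n cmat set) \<subseteq> (\<Union>h\<in>unitary_group. ball h (\<delta> / 2))" using \<delta> by auto
  then obtain F :: "'n cmat set" where F: "F \<subseteq> unitary_group" "finite F" "unitary_group \<subseteq> (\<Union>h\<in>F. ball h (\<delta> / 2))"
    using compactE_image[OF compact_unitary_group, of unitary_group "\<lambda>h. ball h (\<delta> / 2)"] by auto
  have "F \<noteq> {}" using F(3) unitary_one by blast
  show ?thesis
  proof (intro exI[of _ "Min (\<beta> ` F)"] conjI ballI)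
    show "Min (\<beta> ` F) > 0" using F(1,2) \<open>F \<noteq> {}\<close> \<beta> by (subst Min_gr_iff) auto
    fix h :: "'n cmat" assume h: "h \<in> unitary_group"
    then obtain f where f: "f \<in> F" "h \<in> ball f (\<delta> / 2)" using F(3) by blast
    have "Min (\<beta> ` F) \<le> \<beta> f" using f F(2) by simp
    also have "\<dots> \<le> T 0 m (indicator ?Q) h" using \<beta>[of f] F(1) f h by blast
    finally show "Min (\<beta> ` F) \<le> T 0 m (indicator ?Q) h" .
  qed
qed

end

section \<open>Contraction of the oscillation\<close>

context walk begin

lemma lborel_eq_distr_fill:
  fixes c :: "nat \<Rightarrow> 'e::euclidean_space"
  assumes C: "finite C" and c: "bij_betw c C Basis"
  shows "lborel = distr (PiM C (\<lambda>_. lborel)) borel (\<lambda>u. \<Sum>j\<in>C. u j *\<^sub>R c j)"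
    (is "_ = distr ?P borel ?F")
proof (rule lborel_eqI)
  interpret L: product_sigma_finite "\<lambda>_::nat. lborel :: real measure"
    by (simp add: product_sigma_finite_def lborel.sigma_finite_measure_axioms)
  have F [measurable]: "?F \<in> borel_measurable ?P" by measurable
  fix l u :: 'e assume lu: "\<And>b. b \<in> Basis \<Longrightarrow> l \<bullet> b \<le> u \<bullet> b"
  have cB: "c j \<in> Basis" if "j \<in> C" for j using c that bij_betwE by blast
  have in_box: "?F w \<in> box l u \<longleftrightarrow> (\<forall>j\<in>C. l \<bullet> c j < w j \<and> w j < u \<bullet> c j)" for w
  proof -
    have "?F w \<bullet> c j = w j" if "j \<in> C" for j
      by (rule sum_Basis_coordinate[OF C c that])
    then show ?thesis
      unfolding mem_box bij_betw_imp_surj_on[OF c, symmetric] by auto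
  qed
  have "emeasure (distr ?P borel ?F) (box l u) = emeasure ?P (?F -` box l u \<inter> space ?P)"
    by (rule emeasure_distr) auto
  also have "?F -` box l u \<inter> space ?P = (\<Pi>\<^sub>E j\<in>C. {l \<bullet> c j<..<u \<bullet> c j})"
    by (auto simp: in_box[simplified] space_PiM PiE_def Pi_def)
  also have "emeasure ?P \<dots> = (\<Prod>j\<in>C. emeasure lborel {l \<bullet> c j<..<u \<bullet> c j})"
    using C by (intro L.emeasure_PiM) auto
  also have "\<dots> = (\<Prod>j\<in>C. ennreal ((u - l) \<bullet> c j))"
    using lu cB by (intro prod.cong) (auto simp: inner_diff_left)
  also have "\<dots> = ennreal (\<Prod>j\<in>C. (u - l) \<bullet> c j)"
    using lu cB by (intro prod_ennreal) (auto simp: inner_diff_left)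
  also have "(\<Prod>j\<in>C. (u - l) \<bullet> c j) = (\<Prod>b\<in>Basis. (u - l) \<bullet> b)"
    by (rule prod.reindex_bij_betw[OF c])
  finally show "emeasure (distr ?P borel ?F) (box l u) = ennreal (\<Prod>b\<in>Basis. (u - l) \<bullet> b)" .
qed simp

lemma PiM_density:
  assumes C: "finite (C :: nat set)"
  shows "PiM C (\<lambda>_. \<mu>) = density (PiM C (\<lambda>_. lborel)) (\<lambda>u. \<Prod>j\<in>C. p (u j))"
proof (rule P.PiM_eqI[OF C, symmetric])
  interpret L: product_sigma_finite "\<lambda>_::nat. lborel :: real measure"
    by (simp add: product_sigma_finite_def lborel.sigma_finite_measure_axioms)
  show "sets (density (PiM C (\<lambda>_. lborel)) (\<lambda>u. \<Prod>j\<in>C. p (u j))) = sets (PiM C (\<lambda>_. \<mu>))"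
    by (simp cong: sets_PiM_cong)
  fix A assume A: "\<And>i. i \<in> C \<Longrightarrow> A i \<in> sets \<mu>"
  have pm: "(\<lambda>u. \<Prod>j\<in>C. p (u j)) \<in> borel_measurable (PiM C (\<lambda>_. lborel))"
    by measurable
  have AC: "Pi\<^sub>E C A \<in> sets (PiM C (\<lambda>_. lborel))"
    using A C by (intro sets_PiM_I_finite) auto
  have "emeasure (density (PiM C (\<lambda>_. lborel)) (\<lambda>u. \<Prod>j\<in>C. p (u j))) (Pi\<^sub>E C A)
      = (\<integral>\<^sup>+u. (\<Prod>j\<in>C. p (u j)) * indicator (Pi\<^sub>E C A) u \<partial>PiM C (\<lambda>_. lborel))"
    by (rule emeasure_density[OF pm AC])
  also have "\<dots> = (\<integral>\<^sup>+u. (\<Prod>j\<in>C. p (u j) * indicator (A j) (u j)) \<partial>PiM C (\<lambda>_. lborel))"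
  proof (rule nn_integral_cong)
    fix u assume u: "u \<in> space (PiM C (\<lambda>_. lborel :: real measure))"
    have "indicator (Pi\<^sub>E C A) u = (\<Prod>j\<in>C. indicator (A j) (u j) :: ennreal)"
    proof (cases "u \<in> Pi\<^sub>E C A")
      case True
      then show ?thesis by (auto simp: PiE_def Pi_def)
    next
      case False
      then obtain j where "j \<in> C" "u j \<notin> A j" using u by (auto simp: space_PiM PiE_def Pi_def)
      then show ?thesis using False C by (auto simp: prod_zero_iff indicator_def intro!: bexI[of _ j])
    qed
    then show "(\<Prod>j\<in>C. p (u j)) * indicator (Pi\<^sub>E C A) u = (\<Prod>j\<in>C. p (u j) * indicator (A j) (u j))"
      by (simp add: prod.distrib)
  qed
  also have "\<dots> = (\<Prod>j\<in>C. \<integral>\<^sup>+x. p x * indicator (A j) x \<partial>lborel)"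
    using A C by (intro L.product_nn_integral_prod) auto
  also have "\<dots> = (\<Prod>j\<in>C. emeasure \<mu> (A j))"
    using A by (intro prod.cong) (auto simp: \<mu>_density emeasure_density)
  finally show "emeasure (density (PiM C (\<lambda>_. lborel)) (\<lambda>u. \<Prod>j\<in>C. p (u j))) (Pi\<^sub>E C A)
      = (\<Prod>j\<in>C. emeasure \<mu> (A j))" .
qed

text \<open>Independent switching times indexed by \<open>C\<close> become a vector with product
  density; this turns the Lebesgue estimate of the overlap into one for probabilities.\<close>

lemma nn_integral_fill:
  fixes c :: "nat \<Rightarrow> 'e::euclidean_space" and F :: "'e \<Rightarrow> ennreal"
  assumes C: "finite C" and c: "bij_betw c C Basis" and F [measurable]: "F \<in> borel_measurable borel"
  shows "(\<integral>\<^sup>+u. F (\<Sum>j\<in>C. u j *\<^sub>R c j) \<partial>PiM C (\<lambda>_. \<mu>)) = (\<integral>\<^sup>+x. (\<Prod>j\<in>C. p (x \<bullet> c j)) * F x \<partial>lborel)"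
proof -
  note coord = sum_Basis_coordinate[OF C c]
  have "(\<integral>\<^sup>+u. F (\<Sum>j\<in>C. u j *\<^sub>R c j) \<partial>PiM C (\<lambda>_. \<mu>))
      = (\<integral>\<^sup>+u. (\<Prod>j\<in>C. p (u j)) * F (\<Sum>j\<in>C. u j *\<^sub>R c j) \<partial>PiM C (\<lambda>_. lborel))"
    unfolding PiM_density[OF C] by (rule nn_integral_density) measurable
  also have "\<dots> = (\<integral>\<^sup>+u. (\<lambda>x. (\<Prod>j\<in>C. p (x \<bullet> c j)) * F x) (\<Sum>j\<in>C. u j *\<^sub>R c j) \<partial>PiM C (\<lambda>_. lborel))"
    using coord by (intro nn_integral_cong) (simp cong: prod.cong)
  also have "\<dots> = (\<integral>\<^sup>+x. (\<Prod>j\<in>C. p (x \<bullet> c j)) * F x \<partial>lborel)"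
  proof -
    let ?H = "\<lambda>x. (\<Prod>j\<in>C. p (x \<bullet> c j)) * F x"
    have "(\<integral>\<^sup>+x. ?H x \<partial>lborel) = (\<integral>\<^sup>+x. ?H x \<partial>distr (PiM C (\<lambda>_. lborel)) borel (\<lambda>u. \<Sum>j\<in>C. u j *\<^sub>R c j))"
      using lborel_eq_distr_fill[OF C c] by simp
    also have "\<dots> = (\<integral>\<^sup>+u. ?H (\<Sum>j\<in>C. u j *\<^sub>R c j) \<partial>PiM C (\<lambda>_. lborel))"
      by (rule nn_integral_distr) measurable
    finally show ?thesis by simp
  qed
  finally show ?thesis .
qed

lemma local_overlap:
  assumes m: "even m" "m \<ge> 2" "reach m"
  obtains n \<epsilon> \<eta> where "even n" "\<epsilon> > 0" "\<eta> > 0"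
    "\<And>h1 h2 Q. h1 \<in> unitary_group \<Longrightarrow> h2 \<in> unitary_group \<Longrightarrow> norm (h1 - mat 1) \<le> \<eta> \<Longrightarrow> norm (h2 - mat 1) \<le> \<eta> \<Longrightarrow>
       Q \<in> sets borel \<Longrightarrow> \<epsilon> \<le> T 0 n (indicator Q) h1 + T 0 n (indicator (- Q)) h2"
proof -
  show ?thesis
  proof (rule overlap_lebesgue[OF m], goal_cases)
  case (1 n s0 C r \<eta> m0 c a)
  note n = 1(1) and s0 = 1(2) and C = 1(3) and c = 1(4) and pos = 1(5,6,7) and orth = 1(8) and over = 1(9)
  have finC: "finite C" using C finite_subset by blast
  have cB: "c j \<in> Basis" if "j \<in> C" for j using c that bij_betwE by blast
  define R where "R x = (\<Prod>j\<in>C. p (x \<bullet> c j))" for x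
  have R [measurable]: "R \<in> borel_measurable borel" unfolding R_def by measurable
  \<comment> \<open>Coordinates of points of the ball are nonnegative, so \<open>R\<close> is
    positive there: these sublevel sets decrease to the empty set and their measures tend to
    0.\<close>
  define D where "D k = {x \<in> cball a r. R x < ennreal (1 / real (Suc k))}" for k
  have Db [measurable]: "D k \<in> sets borel" for k unfolding D_def by measurable
  have Dsub: "D k \<subseteq> cball a r" for k by (auto simp: D_def)
  have cfin: "emeasure lborel (cball a r) < \<infinity>" by (rule emeasure_lborel_cball_finite)
  have Dfin: "emeasure lborel (D k) \<noteq> \<infinity>" for k
    using le_less_trans[OF emeasure_mono[OF Dsub, of lborel k] cfin] by simp
  have Dint: "(\<Inter>k. D k) = {}"
  proof (rule ccontr)
    assume "(\<Inter>k. D k) \<noteq> {}"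
    then obtain x where x: "\<And>k. x \<in> D k" by blast
    have "x \<in> cball a r" using x Dsub by blast
    then have Rx: "R x > 0" using orth cB p_pos by (auto simp: R_def zero_less_iff_neq_zero finC)
    show False
    proof (cases "R x")
      case top
      then show False using x[of 0] by (simp add: D_def)
    next
      case (real z)
      then have "z > 0" using Rx by simp
      then obtain k where "1 / real (Suc k) < z" using nat_approx_posE by blast
      moreover have "z < 1 / real (Suc k)" using x[of k] real \<open>z > 0\<close> by (simp add: D_def ennreal_less_iff)
      ultimately show False by simp
    qed
  qed
  have "decseq D"
    unfolding D_def by (rule decseq_SucI) (auto intro: less_le_trans simp: frac_le ennreal_leI)
  then have "(\<lambda>k. measure lborel (D k)) \<longlonglongrightarrow> measure lborel (\<Inter>k. D k)"
    using Dfin by (intro Lim_measure_decseq) auto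
  then have "(\<lambda>k. measure lborel (D k)) \<longlonglongrightarrow> 0" by (simp add: Dint)
  then have "eventually (\<lambda>k. measure lborel (D k) < m0 / 4) sequentially"
    using pos(3) by (intro order_tendstoD) auto
  then obtain k where k: "measure lborel (D k) < m0 / 4" by (auto simp: eventually_sequentially)
  define \<kappa> where "\<kappa> = 1 / real (Suc k)"
  have \<kappa>: "\<kappa> > 0" by (simp add: \<kappa>_def)
  have lower: "ennreal (\<kappa> * (measure lborel S - m0 / 4)) \<le> (\<integral>\<^sup>+x. R x * indicator S x \<partial>lborel)"
    if S [measurable]: "S \<in> sets borel" and Sc: "S \<subseteq> cball a r" for S
  proof -
    have SD: "S - D k \<subseteq> cball a r" using Sc by blast
    have fin: "emeasure lborel (S - D k) \<noteq> \<infinity>" "emeasure lborel S \<noteq> \<infinity>"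
      using le_less_trans[OF emeasure_mono[OF SD, of lborel] cfin]
        le_less_trans[OF emeasure_mono[OF Sc, of lborel] cfin] by auto
    have "measure lborel S \<le> measure lborel ((S - D k) \<union> D k)"
    proof (rule measure_mono_fmeasurable)
      show "S - D k \<union> D k \<in> fmeasurable lborel"
        using fin Dfin[of k] by (intro fmeasurable.Un fmeasurableI) (auto simp: less_top)
    qed auto
    also have "\<dots> \<le> measure lborel (S - D k) + measure lborel (D k)"
      by (rule measure_Un_le) auto
    finally have "measure lborel S - m0 / 4 \<le> measure lborel (S - D k)" using k by simp
    then have "ennreal (\<kappa> * (measure lborel S - m0 / 4)) \<le> ennreal (\<kappa> * measure lborel (S - D k))"
      using \<kappa> by (intro ennreal_leI mult_left_mono) auto
    also have "\<dots> = ennreal \<kappa> * emeasure lborel (S - D k)"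
      using \<kappa> fin(1) by (simp add: ennreal_mult emeasure_eq_ennreal_measure)
    also have "\<dots> = (\<integral>\<^sup>+x. ennreal \<kappa> * indicator (S - D k) x \<partial>lborel)"
      by (simp add: nn_integral_cmult_indicator)
    also have "\<dots> \<le> (\<integral>\<^sup>+x. R x * indicator S x \<partial>lborel)"
      using Sc by (intro nn_integral_mono) (auto simp: indicator_def D_def \<kappa>_def not_less)
    finally show ?thesis .
  qed
  define Y where "Y = {1..n} - C"
  define B where "B = Pi\<^sub>E Y (\<lambda>j. {s0 j..s0 j + \<eta>})"
  define \<beta> where "\<beta> = measure (PiM Y (\<lambda>_. \<mu>)) B"
  have \<beta>: "\<beta> > 0"
    unfolding \<beta>_def B_def using s0 pos
    by (subst measure_PiE) (auto simp: Y_def intro!: prod_pos \<mu>_interval_pos)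
  have YC: "Y \<inter> C = {}" "Y \<union> C = {1..n}" "finite Y" using C by (auto simp: Y_def)
  interpret PY: prob_space "PiM Y (\<lambda>_. \<mu>)" by (rule prob_PiM)
  have Bs [measurable]: "B \<in> sets (PiM Y (\<lambda>_. \<mu>))"
    unfolding B_def using YC by (intro sets_PiM_I_finite) auto
  \<comment> \<open>Each of the two sets loses at most \<open>m0 / 4\<close>, so
    \<open>m0 / 2\<close> of the overlap survives.\<close>
  have main: "\<kappa> * m0 / 2 * \<beta> \<le> T 0 n (indicator Q) h1 + T 0 n (indicator (- Q)) h2"
    if h: "h1 \<in> unitary_group" "h2 \<in> unitary_group" "norm (h1 - mat 1) \<le> \<eta>" "norm (h2 - mat 1) \<le> \<eta>"
      and Q: "Q \<in> sets borel" for h1 h2 Q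
  proof -
    let ?P = "PiM {1..n} (\<lambda>_. \<mu>)"
    have Jm [measurable]: "(\<lambda>s. J s n) \<in> borel_measurable ?P" by (rule J_measurable) auto
    have mQ [measurable]: "Measurable.pred borel (\<lambda>x. x \<in> Q)" "Measurable.pred borel (\<lambda>x. x \<notin> Q)" 
      using Q by auto
    interpret PP: prob_space ?P by (rule prob_PiM)
    define F where "F s = (indicator Q (J s n ** h1) + indicator (- Q) (J s n ** h2) :: ennreal)" for s
    have Qi: "(indicator Q :: _ \<Rightarrow> ennreal) \<in> borel_measurable borel" "(indicator (- Q) :: _ \<Rightarrow> ennreal) \<in> borel_measurable borel"
      using Q by auto
    have g1: "(\<lambda>s. J s n ** h1) \<in> borel_measurable ?P" "(\<lambda>s. J s n ** h2) \<in> borel_measurable ?P"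
      by measurable
    have Fm1: "(\<lambda>s. indicator Q (J s n ** h1) :: ennreal) \<in> borel_measurable ?P"
      "(\<lambda>s. indicator (- Q) (J s n ** h2) :: ennreal) \<in> borel_measurable ?P"
      using measurable_compose[OF g1(1) Qi(1)] measurable_compose[OF g1(2) Qi(2)] by auto
    have Fm: "F \<in> borel_measurable ?P" unfolding F_def using Fm1 by simp
    have e: "ennreal (T 0 n (indicator Q') h) = (\<integral>\<^sup>+s. indicator Q' (J s n ** h) \<partial>?P)"
      if Q': "Q' \<in> sets borel" for Q' h
    proof -
      have "{s \<in> space ?P. J s n ** h \<in> Q'} \<in> sets ?P"
      proof -
        have "(\<lambda>s. J s n ** h) \<in> borel_measurable ?P" by measurable
        from measurable_sets[OF this Q'] show ?thesis by (simp add: vimage_def Int_def conj_commute)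
      qed
      then have "ennreal (T 0 n (indicator Q') h) = (\<integral>\<^sup>+s. indicator {s \<in> space ?P. J s n ** h \<in> Q'} s \<partial>?P)"
        by (simp add: T_indicator[OF Q'] PP.emeasure_eq_measure del: One_nat_def)
      also have "\<dots> = (\<integral>\<^sup>+s. indicator Q' (J s n ** h) \<partial>?P)"
        by (rule nn_integral_cong) (auto simp: indicator_def)
      finally show ?thesis .
    qed
    have "ennreal (\<kappa> * m0 / 2 * \<beta>) = ennreal (\<kappa> * m0 / 2) * ennreal \<beta>"
      using \<kappa> pos \<beta> by (intro ennreal_mult) auto
    also have "\<dots> = (\<integral>\<^sup>+y. ennreal (\<kappa> * m0 / 2) * indicator B y \<partial>PiM Y (\<lambda>_. \<mu>))"
      by (simp add: nn_integral_cmult_indicator \<beta>_def PY.emeasure_eq_measure)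
    also have "\<dots> \<le> (\<integral>\<^sup>+y. (\<integral>\<^sup>+u. F (merge Y C (y, u)) \<partial>PiM C (\<lambda>_. \<mu>)) \<partial>PiM Y (\<lambda>_. \<mu>))"
    proof (rule nn_integral_mono)
      fix y assume "y \<in> space (PiM Y (\<lambda>_. \<mu>))"
      show "ennreal (\<kappa> * m0 / 2) * indicator B y \<le> (\<integral>\<^sup>+u. F (merge Y C (y, u)) \<partial>PiM C (\<lambda>_. \<mu>))"
      proof (cases "y \<in> B")
        case True
        have yb: "\<bar>y j - s0 j\<bar> \<le> \<eta>" if "j \<in> {1..n} - C" for j
        proof -
          have "y j \<in> {s0 j..s0 j + \<eta>}" using True that by (auto simp: B_def Y_def)
          then show ?thesis by auto
        qed
        define G where "G x = (indicator Q (J (fill C c x y) n ** h1) + indicator (- Q) (J (fill C c x y) n ** h2) :: ennreal)" for x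
        define S1 where "S1 = {x \<in> cball a r. J (fill C c x y) n ** h1 \<in> Q}"
        define S2 where "S2 = {x \<in> cball a r. J (fill C c x y) n ** h2 \<notin> Q}"
        have fm: "(\<lambda>x. J (fill C c x y) n) \<in> borel_measurable borel"
        proof -
          have "(\<lambda>x. J (fill C c x y) l) \<in> borel_measurable borel" for l
          proof (induction l)
            case (Suc l)
            have "(\<lambda>x. fill C c x y (Suc l)) \<in> borel_measurable borel"
              by (cases "Suc l \<in> C") (auto simp: fill_def)
            then show ?case using Suc by simp
          qed simp
          then show ?thesis .
        qed
        have fm1: "(\<lambda>x. J (fill C c x y) n ** h) \<in> borel_measurable borel" for h :: "'n cmat"
          using fm by simp
        have G: "G \<in> borel_measurable borel"
          unfolding G_def using measurable_compose[OF fm1 Qi(1), of h1] measurable_compose[OF fm1 Qi(2), of h2] by simp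
        have Sb: "S1 \<in> sets borel" "S2 \<in> sets borel"
        proof -
          have "S1 = cball a r \<inter> (\<lambda>x. J (fill C c x y) n ** h1) -` Q" by (auto simp: S1_def)
          then show "S1 \<in> sets borel" using measurable_sets[OF fm1 Q, of h1] by simp
          have "S2 = cball a r \<inter> (\<lambda>x. J (fill C c x y) n ** h2) -` (- Q)" by (auto simp: S2_def)
          then show "S2 \<in> sets borel" using measurable_sets[OF fm1, of "- Q" h2] Q by simp
        qed
        have FG: "F (merge Y C (y, u)) = G (\<Sum>j\<in>C. u j *\<^sub>R c j)" for u
        proof -
          have "J (merge Y C (y, u)) n = J (fill C c (\<Sum>j\<in>C. u j *\<^sub>R c j) y) n"
          proof (rule J_cong)
            fix j assume j: "j \<in> {1..n}"
            show "merge Y C (y, u) j = fill C c (\<Sum>j\<in>C. u j *\<^sub>R c j) y j"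
            proof (cases "j \<in> C")
              case True
              then show ?thesis
                using YC sum_Basis_coordinate[OF finC c True, of u] by (auto simp: fill_def merge_def)
            next
              case False
              then show ?thesis using j by (simp add: fill_def merge_def Y_def)
            qed
          qed
          then show ?thesis by (simp add: F_def G_def)
        qed
        have "\<kappa> * m0 / 2 \<le> \<kappa> * (measure lborel S1 - m0 / 4) + \<kappa> * (measure lborel S2 - m0 / 4)"
        proof -
          have "m0 \<le> measure lborel S1 + measure lborel S2"
            unfolding S1_def S2_def by (rule over[OF yb h Q])
          then have "m0 / 2 \<le> (measure lborel S1 - m0 / 4) + (measure lborel S2 - m0 / 4)" by simp
          from mult_left_mono[OF this, of \<kappa>] show ?thesis using \<kappa> by (simp add: algebra_simps)
        qed
        then have "ennreal (\<kappa> * m0 / 2) \<le> ennreal (\<kappa> * (measure lborel S1 - m0 / 4) + \<kappa> * (measure lborel S2 - m0 / 4))"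
          by (rule ennreal_leI)
        \<comment> \<open>A summand is negative if its set is small; \<open>ennreal\<close> sends it
          to 0, and subadditivity still holds.\<close>
        also have "\<dots> \<le> ennreal (\<kappa> * (measure lborel S1 - m0 / 4)) + ennreal (\<kappa> * (measure lborel S2 - m0 / 4))"
          by (auto simp: ennreal_plus_if intro!: ennreal_leI)
        also have "\<dots> \<le> (\<integral>\<^sup>+x. R x * indicator S1 x \<partial>lborel) + (\<integral>\<^sup>+x. R x * indicator S2 x \<partial>lborel)"
          by (intro add_mono lower Sb) (auto simp: S1_def S2_def)
        also have "\<dots> = (\<integral>\<^sup>+x. R x * indicator S1 x + R x * indicator S2 x \<partial>lborel)"
          using Sb by (intro nn_integral_add[symmetric]) auto
        also have "\<dots> \<le> (\<integral>\<^sup>+x. R x * G x \<partial>lborel)"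
        proof (rule nn_integral_mono)
          fix x
          have "R x * indicator S1 x + R x * indicator S2 x = R x * (indicator S1 x + indicator S2 x)"
            by (simp add: distrib_left)
          also have "\<dots> \<le> R x * G x"
            unfolding G_def by (intro mult_left_mono add_mono) (auto simp: S1_def S2_def indicator_def)
          finally show "R x * indicator S1 x + R x * indicator S2 x \<le> R x * G x" .
        qed
        also have "\<dots> = (\<integral>\<^sup>+u. G (\<Sum>j\<in>C. u j *\<^sub>R c j) \<partial>PiM C (\<lambda>_. \<mu>))"
          unfolding R_def by (rule nn_integral_fill[OF finC c G, symmetric])
        finally show ?thesis using True by (simp add: FG)
      qed simp
    qed
    also have "\<dots> = (\<integral>\<^sup>+s. F s \<partial>?P)"
      using P.product_nn_integral_fold[OF YC(1,3) finC, of F] Fm by (simp add: YC(2))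
    also have "\<dots> = ennreal (T 0 n (indicator Q) h1) + ennreal (T 0 n (indicator (- Q)) h2)"
      unfolding F_def using e[OF Q, of h1] e[of "- Q" h2] Q Fm1 by (simp add: nn_integral_add)
    also have "\<dots> = ennreal (T 0 n (indicator Q) h1 + T 0 n (indicator (- Q)) h2)"
      using Q by (intro ennreal_plus[symmetric]) (simp_all add: T_indicator)
    finally show ?thesis
      using Q by (subst (asm) ennreal_le_iff) (simp_all add: T_indicator)
  qed
  show ?thesis
    by (rule that[OF n _ pos(2) main]) (use \<kappa> pos \<beta> in auto)
  qed
qed

text \<open>A bound on the oscillation as a predicate, which spares suprema; it looks at the group
  alone, where the walk lives.\<close>

definition osc :: "('n cmat \<Rightarrow> real) \<Rightarrow> real \<Rightarrow> bool" where
  "osc \<phi> r \<longleftrightarrow> (\<forall>x\<in>unitary_group. \<forall>y\<in>unitary_group. \<phi> x - \<phi> y \<le> r)"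

lemma oscD: "osc \<phi> r \<Longrightarrow> x \<in> unitary_group \<Longrightarrow> y \<in> unitary_group \<Longrightarrow> \<phi> x - \<phi> y \<le> r"
  by (simp add: osc_def)

lemma osc_nonneg: "osc \<phi> r \<Longrightarrow> r \<ge> 0"
  using oscD[of \<phi> r "mat 1" "mat 1"] by simp

lemma osc_mono: "osc \<phi> r \<Longrightarrow> r \<le> r' \<Longrightarrow> osc \<phi> r'"
  by (force simp: osc_def)

text \<open>The same random time drives both starting points, so the values are compared under a
  synchronous coupling.\<close>

lemma osc_Kop:
  assumes "bm B \<phi>" "osc \<phi> r"
  shows "osc (Kop j \<phi>) r"
  unfolding osc_def
proof safe
  fix x y :: "'n cmat" assume xy: "x \<in> unitary_group" "y \<in> unitary_group"
  have "Kop j \<phi> x - Kop j \<phi> y = (\<integral>s. \<phi> (ev j s ** x) - \<phi> (ev j s ** y) \<partial>\<mu>)"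
    unfolding Kop_def using Kop_integrable[OF assms(1)] by (intro Bochner_Integration.integral_diff[symmetric]) auto
  also have "\<dots> \<le> (\<integral>s. r \<partial>\<mu>)"
    using Kop_integrable[OF assms(1)] xy by (intro integral_mono oscD[OF assms(2)] unitary_mult) auto
  finally show "Kop j \<phi> x - Kop j \<phi> y \<le> r" by (simp add: mu.prob_space[unfolded space_\<mu>])
qed

lemma osc_T: "bm B \<phi> \<Longrightarrow> osc \<phi> r \<Longrightarrow> osc (T a n \<phi>) r"
  by (induction n arbitrary: \<phi>) (auto intro: osc_Kop Kop_bm)

lemma T_const: "T a n (\<lambda>_. \<beta>) = (\<lambda>_. \<beta>)"
proof (induction n)
  case (Suc n)
  have "Kop (a + Suc n) (\<lambda>_. \<beta>) = (\<lambda>_. \<beta>)"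
    by (simp add: Kop_def fun_eq_iff mu.prob_space[unfolded space_\<mu>])
  then show ?case using Suc by simp
qed simp

lemma bm_const: "bm \<bar>\<beta>\<bar> (\<lambda>_. \<beta>)"
  by (simp add: bm_def)

text \<open>From any start, \<open>m\<close> steps lead into the neighbourhood \<open>V\<close> of
  the identity with probability at least \<open>\<beta>\<close>, and from any two points of
  \<open>V\<close> the laws after \<open>n\<close> more steps overlap by \<open>\<epsilon>\<close>.
  The gain \<open>\<gamma>\<close> multiplies the two effects.\<close>

lemma contraction_unit:
  assumes m: "even m" "m \<ge> 2" "reach m"
  obtains N \<gamma> where "even N" "N > 0" "0 < \<gamma>" "\<gamma> \<le> 1"
    "\<And>\<phi> B. bm B \<phi> \<Longrightarrow> (\<And>x. x \<in> unitary_group \<Longrightarrow> 0 \<le> \<phi> x \<and> \<phi> x \<le> 1) \<Longrightarrow> osc (T 0 N \<phi>) (1 - \<gamma>)"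
proof -
  show ?thesis
  proof (rule local_overlap[OF m], goal_cases)
  case (1 n \<epsilon> \<eta>)
  note ne = 1(1,2,3) and over = 1(4)
  obtain \<beta> where \<beta>0: "\<beta> > 0" "\<forall>h\<in>unitary_group. \<beta> \<le> T 0 m (indicator {x. norm (x - mat 1) \<le> \<eta>}) h"
    using reach_identity[OF m(3) ne(3)] by (elim exE conjE)
  note \<beta> = \<beta>0(1) \<beta>0(2)[rule_format]
  let ?V = "{x :: 'n cmat. norm (x - mat 1) \<le> \<eta>}"
  have Vb: "?V \<in> sets borel"
    by (intro borel_closed closed_Collect_le continuous_intros)
  define \<gamma> where "\<gamma> = min 1 (\<beta> * (\<epsilon> / 2))"
  have osc: "osc (T 0 (m + n) \<phi>) (1 - \<gamma>)"
    if \<phi>: "bm B \<phi>" and unit: "\<And>x. x \<in> unitary_group \<Longrightarrow> 0 \<le> \<phi> x \<and> \<phi> x \<le> 1" for \<phi> B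
  proof -
    define \<psi> where "\<psi> = T 0 n \<phi>"
    have \<psi>b: "bm B \<psi>" unfolding \<psi>_def by (rule T_bm[OF \<phi>])
    have \<psi>1: "0 \<le> \<psi> x" "\<psi> x \<le> 1" if x: "x \<in> unitary_group" for x
      using T_mono[OF bm_const[of 0] \<phi> _ x, of 0 n] T_mono[OF \<phi> bm_const[of 1] _ x, of 0 n] unit
      by (simp_all add: T_const \<psi>_def)
    have \<psi>2: "\<epsilon> / 2 \<le> \<psi> x + 1 - \<psi> y"
      if xy: "x \<in> unitary_group" "y \<in> unitary_group" "x \<in> ?V" "y \<in> ?V" for x y
    proof -
      \<comment> \<open>At level 1/2, \<open>\<phi>\<close> is at least 1/2 on \<open>Q\<close> and
        \<open>1 - \<phi>\<close> at least 1/2 off it, so the overlap for this single set costs a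
        factor 2.\<close>
      define Q where "Q = {x. 1 / 2 \<le> \<phi> x}"
      have Q: "Q \<in> sets borel" "- Q \<in> sets borel"
        using bm_measurable[OF \<phi>] unfolding Q_def by measurable
      have "T 0 n (\<lambda>x. (1 / 2) * indicator Q x + 0) x \<le> T 0 n \<phi> x"
        by (rule T_mono[OF bm_affine[OF bm_indicator[OF Q(1)]] \<phi> _ xy(1)]) (use unit in \<open>auto simp: Q_def indicator_def\<close>)
      then have 1: "1 / 2 * T 0 n (indicator Q) x \<le> \<psi> x"
        unfolding T_affine[OF bm_indicator[OF Q(1)]] by (simp add: \<psi>_def)
      have "T 0 n (\<lambda>x. (1 / 2) * indicator (- Q) x + 0) y \<le> T 0 n (\<lambda>x. (-1) * \<phi> x + 1) y"
        by (rule T_mono[OF bm_affine[OF bm_indicator[OF Q(2)]] bm_affine[OF \<phi>] _ xy(2)])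
          (use unit in \<open>auto simp: Q_def indicator_def\<close>)
      then have 2: "1 / 2 * T 0 n (indicator (- Q)) y \<le> 1 - \<psi> y"
        unfolding T_affine[OF bm_indicator[OF Q(2)]] T_affine[OF \<phi>] by (simp add: \<psi>_def)
      have "\<epsilon> \<le> T 0 n (indicator Q) x + T 0 n (indicator (- Q)) y"
        using over[OF xy(1,2) _ _ Q(1)] xy(3,4) by simp
      with 1 2 show ?thesis by simp
    qed
    define V where "V = unitary_group \<inter> ?V"
    have I: "mat 1 \<in> V" using ne(3) by (simp add: V_def)
    \<comment> \<open>Off \<open>V\<close> the bounds on \<open>\<psi>\<close> are just 0 and 1.
      Visits to \<open>V\<close> lift the mean from one start by \<open>i * \<beta>\<close> above 0
      and push it from the other by \<open>(1 - S) * \<beta>\<close> below 1; together these reach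
      \<open>\<gamma>\<close>, since \<open>S - i \<le> 1 - \<epsilon> / 2\<close>.\<close>
    define i where "i = Inf (\<psi> ` V)"
    define S where "S = Sup (\<psi> ` V)"
    have bb: "bdd_below (\<psi> ` V)" "bdd_above (\<psi> ` V)"
      using \<psi>1 by (auto simp: V_def intro!: bdd_belowI[of _ 0] bdd_aboveI[of _ 1])
    have i: "i \<le> \<psi> x" "\<psi> x \<le> S" if "x \<in> V" for x
      using that bb by (auto simp: i_def S_def intro: cINF_lower cSUP_upper)
    have Vne: "V \<noteq> {}" using I by blast
    have Vu: "x \<in> unitary_group" if "x \<in> V" for x using that by (simp add: V_def)
    have i0: "i \<ge> 0" unfolding i_def by (intro cINF_greatest Vne \<psi>1(1) Vu)
    have S1: "S \<le> 1" unfolding S_def by (intro cSUP_least Vne \<psi>1(2) Vu)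
    have Si: "S \<le> 1 - \<epsilon> / 2 + i"
      unfolding S_def
    proof (rule cSUP_least)
      fix x assume x: "x \<in> V"
      have "\<psi> x - (1 - \<epsilon> / 2) \<le> i"
        unfolding i_def
      proof (rule cINF_greatest)
        fix y assume y: "y \<in> V"
        show "\<psi> x - (1 - \<epsilon> / 2) \<le> \<psi> y" using \<psi>2[of y x] x y by (simp add: V_def)
      qed (use I in auto)
      then show "\<psi> x \<le> 1 - \<epsilon> / 2 + i" by simp
    qed (use I in auto)
    show ?thesis
      unfolding osc_def
    proof safe
      fix h2 h1 :: "'n cmat" assume h: "h2 \<in> unitary_group" "h1 \<in> unitary_group"
      have e: "T 0 (m + n) \<phi> = T 0 m \<psi>"
        using T_add[of 0 m n \<phi>] T_parity[OF m(1), of 0 n \<phi>] by (simp add: \<psi>_def)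
      have "T 0 m (\<lambda>x. i * indicator ?V x + 0) h1 \<le> T 0 m \<psi> h1"
        by (rule T_mono[OF bm_affine[OF bm_indicator[OF Vb]] \<psi>b _ h(2)])
          (use i(1) \<psi>1 in \<open>auto simp: V_def indicator_def\<close>)
      then have "i * T 0 m (indicator ?V) h1 \<le> T 0 m \<psi> h1"
        unfolding T_affine[OF bm_indicator[OF Vb]] by simp
      moreover have "i * \<beta> \<le> i * T 0 m (indicator ?V) h1" using i0 \<beta>(2)[OF h(2)] by (rule mult_left_mono[rotated])
      ultimately have 3: "i * \<beta> \<le> T 0 m \<psi> h1" by simp
      have "T 0 m (\<lambda>x. (1 - S) * indicator ?V x + 0) h2 \<le> T 0 m (\<lambda>x. (-1) * \<psi> x + 1) h2"
        by (rule T_mono[OF bm_affine[OF bm_indicator[OF Vb]] bm_affine[OF \<psi>b] _ h(1)])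
          (use i(2) \<psi>1 in \<open>auto simp: V_def indicator_def\<close>)
      then have "(1 - S) * T 0 m (indicator ?V) h2 \<le> 1 - T 0 m \<psi> h2"
        unfolding T_affine[OF bm_indicator[OF Vb]] T_affine[OF \<psi>b] by simp
      moreover have "(1 - S) * \<beta> \<le> (1 - S) * T 0 m (indicator ?V) h2" using S1 \<beta>(2)[OF h(1)] by (intro mult_left_mono) auto
      ultimately have 4: "(1 - S) * \<beta> \<le> 1 - T 0 m \<psi> h2" by simp
      have "\<gamma> \<le> \<beta> * (\<epsilon> / 2)" by (simp add: \<gamma>_def)
      also have "\<dots> \<le> \<beta> * (i + (1 - S))" using Si \<beta>(1) by (intro mult_left_mono) auto
      also have "\<dots> = i * \<beta> + (1 - S) * \<beta>" by (simp add: algebra_simps)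
      finally show "T 0 (m + n) \<phi> h2 - T 0 (m + n) \<phi> h1 \<le> 1 - \<gamma>"
        using 3 4 by (simp add: e)
    qed
  qed
  show ?thesis
    by (rule that[of "m + n" \<gamma>, OF _ _ _ _ osc]) (use m ne(1,2) \<beta>(1) in \<open>auto simp: \<gamma>_def\<close>)
  qed
qed

lemma geometric_osc:
  assumes m: "even m" "m \<ge> 2" "reach m"
  shows "\<exists>C q. C > 0 \<and> 0 < q \<and> q < 1 \<and>
    (\<forall>a n B \<phi> r. bm B \<phi> \<longrightarrow> osc \<phi> r \<longrightarrow> osc (T a n \<phi>) (C * q ^ n * r))"
proof (rule contraction_unit[OF m], goal_cases)
  case (1 N \<gamma>)
  note N = 1(1,2) and \<gamma> = 1(3,4) and unit = 1(5)
  have contr: "osc (T 0 N \<phi>) ((1 - \<gamma>) * r)" if \<phi>: "bm B \<phi>" "osc \<phi> r" for B \<phi> r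
  proof (cases "r = 0")
    case True
    then show ?thesis using osc_T[OF \<phi>] by simp
  next
    case False
    then have r: "r > 0" using osc_nonneg[OF \<phi>(2)] by simp
    define a where "a = Inf (\<phi> ` unitary_group)"
    have bb: "bdd_below (\<phi> ` unitary_group)"
      using \<phi>(1) by (auto simp: bm_def intro!: bdd_belowI[of _ "- B"]) (meson abs_le_D2 minus_le_iff)
    have a: "a \<le> \<phi> x" "\<phi> x \<le> a + r" if x: "x \<in> unitary_group" for x
    proof -
      show "a \<le> \<phi> x" unfolding a_def using bb x by (rule cINF_lower)
      have "\<phi> x - r \<le> a" unfolding a_def
      proof (rule cINF_greatest)
        fix y :: "'n cmat" assume "y \<in> unitary_group"
        then show "\<phi> x - r \<le> \<phi> y" using oscD[OF \<phi>(2) x] by force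
      qed (use x in auto)
      then show "\<phi> x \<le> a + r" by simp
    qed
    have "osc (T 0 N (\<lambda>x. (1 / r) * \<phi> x + (- a / r))) (1 - \<gamma>)"
    proof (rule unit[OF bm_affine[OF \<phi>(1)]])
      fix x :: "'n cmat" assume "x \<in> unitary_group"
      from a[OF this] show "0 \<le> (1 / r) * \<phi> x + (- a / r) \<and> (1 / r) * \<phi> x + (- a / r) \<le> 1"
        using r by (simp add: field_simps)
    qed
    then have *: "(1 / r) * T 0 N \<phi> x - (1 / r) * T 0 N \<phi> y \<le> 1 - \<gamma>"
      if "x \<in> unitary_group" "y \<in> unitary_group" for x y
      using that unfolding T_affine[OF \<phi>(1)] osc_def by force
    show ?thesis unfolding osc_def
    proof safe
      fix x y :: "'n cmat" assume "x \<in> unitary_group" "y \<in> unitary_group"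
      from *[OF this] show "T 0 N \<phi> x - T 0 N \<phi> y \<le> (1 - \<gamma>) * r"
        using r by (simp add: field_simps)
    qed
  qed
  \<comment> \<open>Halving \<open>\<gamma>\<close> keeps the rate positive when
    \<open>\<gamma> = 1\<close>.\<close>
  define \<theta> where "\<theta> = 1 - \<gamma> / 2"
  have \<theta>: "0 < \<theta>" "\<theta> < 1" "1 - \<gamma> \<le> \<theta>" using \<gamma> by (auto simp: \<theta>_def)
  have iter: "osc (T 0 (k * N) \<phi>) (\<theta> ^ k * r)" if \<phi>: "bm B \<phi>" "osc \<phi> r" for B \<phi> r k
  proof (induction k)
    case (Suc k)
    have "T 0 (Suc k * N) \<phi> = T 0 N (T 0 (k * N) \<phi>)"
      using T_add[of 0 N "k * N" \<phi>] T_parity[OF N(1), of 0 "k * N" \<phi>] by simp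
    moreover have "osc (T 0 N (T 0 (k * N) \<phi>)) ((1 - \<gamma>) * (\<theta> ^ k * r))"
      by (rule contr[OF T_bm[OF \<phi>(1)] Suc.IH])
    moreover have "(1 - \<gamma>) * (\<theta> ^ k * r) \<le> \<theta> * (\<theta> ^ k * r)"
      using \<theta> osc_nonneg[OF \<phi>(2)] by (intro mult_right_mono) auto
    ultimately show ?case by (auto intro: osc_mono simp: mult.assoc)
  qed (simp add: \<phi>)
  define q where "q = root N \<theta>"
  have q: "0 < q" "q < 1" "q ^ N = \<theta>"
    using \<theta> N by (auto simp: q_def real_root_pow_pos2)
  \<comment> \<open>The exponent \<open>Suc n\<close> holds a spare factor \<open>q\<close>: for odd
    \<open>a\<close> one step is split off to reach an even index, and that step merely preserves
    the oscillation.\<close>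
  have even_case: "osc (T a n \<phi>) (1 / \<theta> * q ^ Suc n * r)" if a: "even a" and \<phi>: "bm B \<phi>" "osc \<phi> r" for a n B \<phi> r
  proof -
    define k where "k = n div N"
    have n: "n = k * N + n mod N" by (simp add: k_def)
    have "T a n \<phi> = T 0 (k * N) (T (k * N) (n mod N) \<phi>)"
      using T_parity[OF a, of 0 n \<phi>] T_add[of 0 "k * N" "n mod N" \<phi>] n by simp
    then have 1: "osc (T a n \<phi>) (\<theta> ^ k * r)"
      using iter[OF T_bm[OF \<phi>(1)] osc_T[OF \<phi>]] by simp
    have "Suc n \<le> Suc k * N" using n mod_less_divisor[OF N(2), of n] by simp
    then have "q ^ (Suc k * N) \<le> q ^ Suc n" using q by (intro power_decreasing) auto
    moreover have "q ^ (Suc k * N) = \<theta> ^ Suc k" by (metis power_mult mult.commute q(3))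
    ultimately have "\<theta> * \<theta> ^ k \<le> q ^ Suc n" by simp
    then have "\<theta> ^ k \<le> 1 / \<theta> * q ^ Suc n" using \<theta> by (simp add: field_simps)
    then show ?thesis using osc_nonneg[OF \<phi>(2)] by (intro osc_mono[OF 1] mult_right_mono)
  qed
  have "osc (T a n \<phi>) (1 / \<theta> * q ^ n * r)" if \<phi>: "bm B \<phi>" "osc \<phi> r" for a n B \<phi> r
  proof (cases "even a")
    case True
    have "1 / \<theta> * q ^ Suc n * r \<le> 1 / \<theta> * q ^ n * r"
      using q \<theta> osc_nonneg[OF \<phi>(2)] by (intro mult_right_mono mult_left_mono power_decreasing) auto
    then show ?thesis using even_case[OF True \<phi>] osc_mono by blast
  next
    case False
    show ?thesis
    proof (cases n)
      case 0
      have "1 * r \<le> 1 / \<theta> * r" using \<theta> osc_nonneg[OF \<phi>(2)] by (intro mult_right_mono) auto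
      then show ?thesis using 0 \<phi>(2) by (auto intro: osc_mono)
    next
      case (Suc k)
      have "T a n \<phi> = T a 1 (T (Suc a) k \<phi>)" using T_add[of a 1 k \<phi>] Suc by simp
      moreover have "osc (T (Suc a) k \<phi>) (1 / \<theta> * q ^ n * r)" using even_case[OF _ \<phi>, of "Suc a" k] False Suc by simp
      ultimately show ?thesis using osc_T[OF T_bm[OF \<phi>(1)]] by metis
    qed
  qed
  then show ?case using q \<theta> by (intro exI[of _ "1 / \<theta>"] exI[of _ q]) auto
qed

section \<open>Convergence to Haar measure\<close>

lemma haar_borel:
  assumes "is_haar \<pi>" "\<phi> \<in> borel_measurable borel"
  shows "\<phi> \<in> borel_measurable \<pi>"
proof -
  have "\<phi> \<in> borel_measurable U_borel"
    unfolding U_borel_def using assms(2) by (rule measurable_restrict_space1)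
  then show ?thesis using assms(1) by (simp add: is_haar_def cong: measurable_cong_sets)
qed

lemma haar_shift:
  assumes \<pi>: "is_haar \<pi>" and g: "g \<in> unitary_group" and \<phi>: "\<phi> \<in> borel_measurable borel"
  shows "(\<integral>x. \<phi> (g ** x) \<partial>\<pi>) = (\<integral>x. \<phi> x \<partial>\<pi> :: real)"
proof -
  have s: "sets \<pi> = sets U_borel" "space \<pi> = unitary_group" "distr \<pi> U_borel (\<lambda>x. g ** x) = \<pi>"
    using \<pi> g by (auto simp: is_haar_def)
  have "(\<lambda>x. g ** x) \<in> \<pi> \<rightarrow>\<^sub>M U_borel"
    unfolding U_borel_def
  proof (rule measurable_restrict_space2)
    show "(\<lambda>x. g ** x) \<in> borel_measurable \<pi>" by (rule haar_borel[OF \<pi>]) simp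
  qed (use s g in \<open>auto intro: unitary_mult\<close>)
  moreover have "\<phi> \<in> borel_measurable U_borel"
    unfolding U_borel_def using \<phi> by (rule measurable_restrict_space1)
  ultimately have "integral\<^sup>L (distr \<pi> U_borel (\<lambda>x. g ** x)) \<phi> = (\<integral>x. \<phi> (g ** x) \<partial>\<pi>)"
    by (rule integral_distr)
  then show ?thesis by (simp add: s(3))
qed

text \<open>\<open>Kop\<close> averages left translations, each of which preserves
  \<open>\<pi>\<close>; Fubini exchanges the two integrals.\<close>

lemma haar_Kop:
  assumes \<pi>: "is_haar \<pi>" and \<phi>: "bm B \<phi>"
  shows "(\<integral>x. Kop j \<phi> x \<partial>\<pi>) = (\<integral>x. \<phi> x \<partial>\<pi>)"
proof -
  interpret pi: prob_space \<pi> using \<pi> by (simp add: is_haar_def)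
  interpret pp: pair_prob_space \<pi> \<mu> ..
  have [measurable]: "\<phi> \<in> borel_measurable borel" by (rule bm_measurable[OF \<phi>])
  have id: "(\<lambda>x. x) \<in> borel_measurable \<pi>" by (rule haar_borel[OF \<pi>]) simp
  have [measurable]: "(\<lambda>z. fst z) \<in> borel_measurable (\<pi> \<Otimes>\<^sub>M \<mu>)"
    by (rule measurable_compose[OF measurable_fst id])
  have "integrable (\<pi> \<Otimes>\<^sub>M \<mu>) (\<lambda>z. \<phi> (ev j (snd z) ** fst z))"
    by (rule bm_integrable[OF \<phi>]) (unfold_locales, measurable)
  then have "integrable (\<pi> \<Otimes>\<^sub>M \<mu>) (case_prod (\<lambda>x s. \<phi> (ev j s ** x)))"
    by (simp add: case_prod_unfold)
  from pp.Fubini_integral[OF this]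
  have "(\<integral>x. Kop j \<phi> x \<partial>\<pi>) = (\<integral>s. (\<integral>x. \<phi> (ev j s ** x) \<partial>\<pi>) \<partial>\<mu>)"
    by (simp add: Kop_def)
  also have "\<dots> = (\<integral>x. \<phi> x \<partial>\<pi>)"
    by (simp add: haar_shift[OF \<pi>] mu.prob_space[unfolded space_\<mu>])
  finally show ?thesis .
qed

lemma haar_T: "is_haar \<pi> \<Longrightarrow> bm B \<phi> \<Longrightarrow> (\<integral>x. T a n \<phi> x \<partial>\<pi>) = (\<integral>x. \<phi> x \<partial>\<pi>)"
  by (induction n arbitrary: \<phi>) (simp_all add: haar_Kop Kop_bm)

text \<open>A mean over the group cannot differ from any single value by more than the
  oscillation.\<close>

lemma osc_haar:
  assumes \<pi>: "is_haar \<pi>" and \<phi>: "bm B \<phi>" "osc \<phi> r" and x: "x \<in> unitary_group"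
  shows "\<bar>\<phi> x - (\<integral>x. \<phi> x \<partial>\<pi>)\<bar> \<le> r"
proof -
  interpret pi: prob_space \<pi> using \<pi> by (simp add: is_haar_def)
  have sp: "space \<pi> = unitary_group" using \<pi> by (simp add: is_haar_def)
  have i: "integrable \<pi> \<phi>"
    using bm_integrable[OF \<phi>(1) pi.prob_space_axioms haar_borel[OF \<pi>, of "\<lambda>x. x"]] by simp
  have "\<phi> y \<le> \<phi> x + r" "\<phi> x - r \<le> \<phi> y" if "y \<in> space \<pi>" for y
    using oscD[OF \<phi>(2), of x y] oscD[OF \<phi>(2), of y x] x that by (auto simp: sp)
  then have "(\<integral>y. \<phi> y \<partial>\<pi>) \<le> (\<integral>y. \<phi> x + r \<partial>\<pi>)" "(\<integral>y. \<phi> x - r \<partial>\<pi>) \<le> (\<integral>y. \<phi> y \<partial>\<pi>)"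
    using i by (intro integral_mono; simp)+
  then show ?thesis by (simp add: pi.prob_space)
qed

lemma T_haar:
  assumes \<pi>: "is_haar \<pi>" and \<phi>: "bm B \<phi>" and o: "osc (T a n \<phi>) r" and x: "x \<in> unitary_group"
  shows "\<bar>T a n \<phi> x - (\<integral>x. \<phi> x \<partial>\<pi>)\<bar> \<le> r"
  using osc_haar[OF \<pi> T_bm[OF \<phi>] o x] haar_T[OF \<pi> \<phi>] by simp

end

section \<open>A strong law of large numbers\<close>

lemma cesaro_mean:
  fixes a :: "nat \<Rightarrow> real"
  assumes "a \<longlonglongrightarrow> L"
  shows "(\<lambda>n. (\<Sum>i\<in>{1..n}. a i) / real n) \<longlonglongrightarrow> L"
proof (rule LIMSEQ_I)
  fix e :: real assume e: "e > 0"
  then obtain N where N: "\<And>n. n \<ge> N \<Longrightarrow> \<bar>a n - L\<bar> < e / 2"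
    using LIMSEQ_D[OF assms, of "e / 2"] by auto
  define D where "D = (\<Sum>i\<in>{1..N}. \<bar>a i - L\<bar>)"
  obtain N2 :: nat where N2: "2 * D / e < real N2" using reals_Archimedean2 by blast
  have D0: "D \<ge> 0" by (simp add: D_def)
  show "\<exists>no. \<forall>n\<ge>no. norm ((\<Sum>i\<in>{1..n}. a i) / real n - L) < e"
  proof (intro exI[of _ "max 1 (max N N2)"] allI impI)
    fix n assume n: "n \<ge> max 1 (max N N2)"
    have "(\<Sum>i\<in>{1..n}. a i) / real n - L = (\<Sum>i\<in>{1..n}. a i - L) / real n"
      using n by (simp add: sum_subtractf field_simps)
    then have "norm ((\<Sum>i\<in>{1..n}. a i) / real n - L) \<le> (\<Sum>i\<in>{1..n}. \<bar>a i - L\<bar>) / real n"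
      by (simp add: divide_right_mono)
    also have "(\<Sum>i\<in>{1..n}. \<bar>a i - L\<bar>) = D + (\<Sum>i\<in>{N<..n}. \<bar>a i - L\<bar>)"
    proof -
      have "{1..n} = {1..N} \<union> {N<..n}" "{1..N} \<inter> {N<..n} = {}" using n by auto
      then show ?thesis unfolding D_def by (simp add: sum.union_disjoint)
    qed
    also have "(\<Sum>i\<in>{N<..n}. \<bar>a i - L\<bar>) \<le> (\<Sum>i\<in>{N<..n}. e / 2)"
      using N by (intro sum_mono) (simp add: less_imp_le)
    also have "\<dots> \<le> real n * (e / 2)" using e by (simp add: mult_right_mono)
    finally have "norm ((\<Sum>i\<in>{1..n}. a i) / real n - L) \<le> (D + real n * (e / 2)) / real n"
      by (simp add: divide_right_mono)
    also have "\<dots> = D / real n + e / 2" using n by (simp add: field_simps)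
    also have "D / real n < e / 2"
    proof -
      have "2 * D / e < real n" using N2 n by linarith
      then show ?thesis using e n by (simp add: field_simps)
    qed
    finally show "norm ((\<Sum>i\<in>{1..n}. a i) / real n - L) < e" by simp
  qed
qed

text \<open>The bound is free of \<open>a\<close>: terms above 1 count as 0, and from the first
  surviving term on the sequence is dominated by the powers of \<open>x\<close>. In
  \<open>etemadi\<close> this turns truncated second moments into a first moment.\<close>

lemma truncated_geometric_sum_le:
  fixes x a :: real
  assumes x: "0 < x" "x < 1" and a: "a \<ge> 0"
  shows "(\<Sum>m<M. if a * x ^ m \<le> 1 then a * x ^ m else 0) \<le> 1 / (1 - x)"
  using a
proof (induction M arbitrary: a)
  case (Suc M)
  show ?case
  proof (cases "a \<le> 1")
    case True
    have "(\<Sum>m<Suc M. if a * x ^ m \<le> 1 then a * x ^ m else 0) \<le> (\<Sum>m<Suc M. x ^ m)"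
      using True Suc.prems x by (intro sum_mono) (auto intro: mult_left_le_one_le)
    also have "\<dots> \<le> (\<Sum>m. x ^ m)" using x by (intro sum_le_suminf summable_geometric) auto
    also have "\<dots> = 1 / (1 - x)" using x by (intro suminf_geometric) auto
    finally show ?thesis .
  next
    case False
    have "(\<Sum>m<Suc M. if a * x ^ m \<le> 1 then a * x ^ m else 0)
        = (\<Sum>m<M. if (a * x) * x ^ m \<le> 1 then (a * x) * x ^ m else 0)"
      using False by (subst sum.lessThan_Suc_shift) (simp add: mult.assoc cong: if_cong)
    also have "\<dots> \<le> 1 / (1 - x)" using Suc.prems x by (intro Suc.IH) auto
    finally show ?thesis .
  qed
qed (use x in auto)

text \<open>Between consecutive powers of a ratio close to 1 a monotone sequence is squeezed, and
  its average changes at most by that ratio.\<close>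

lemma monotone_average_limit:
  fixes S :: "nat \<Rightarrow> real"
  assumes mono: "mono S" and S0: "\<And>n. S n \<ge> 0" and L: "L \<ge> 0"
    and lim: "\<And>l. (\<lambda>m. S (nat \<lfloor>(1 + 1 / real (Suc l)) ^ m\<rfloor>) / (1 + 1 / real (Suc l)) ^ m) \<longlonglongrightarrow> L"
  shows "(\<lambda>n. S n / real n) \<longlonglongrightarrow> L"
proof (rule LIMSEQ_I)
  fix e :: real assume e: "e > 0"
  \<comment> \<open>Chosen so that the excess \<open>d\<close> of the ratio over 1 contributes at
    most \<open>e / 4\<close> to the limit \<open>L\<close>.\<close>
  obtain l :: nat where l: "4 * L / e < real l" using reals_Archimedean2 by blast
  define d where "d = 1 / real (Suc l)"
  have d: "0 < d" "d \<le> 1" by (auto simp: d_def)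
  have dL: "d * L \<le> e / 4"
  proof -
    have "4 * L \<le> e * real (Suc l)" using l e by (simp add: field_simps)
    then show ?thesis by (simp add: d_def field_simps)
  qed
  define \<alpha> where "\<alpha> = 1 + d"
  have \<alpha>: "\<alpha> > 1" using d by (simp add: \<alpha>_def)
  define a where "a m = S (nat \<lfloor>\<alpha> ^ m\<rfloor>) / \<alpha> ^ m" for m
  have "a \<longlonglongrightarrow> L" using lim[of l] by (simp add: a_def[abs_def] \<alpha>_def d_def)
  then obtain N where N: "\<And>m. m \<ge> N \<Longrightarrow> \<bar>a m - L\<bar> < e / 4"
    using LIMSEQ_D[of a L "e / 4"] e by auto
  obtain n0 :: nat where n0: "\<alpha> ^ N < real n0" using reals_Archimedean2 by blast
  show "\<exists>no. \<forall>n\<ge>no. norm (S n / real n - L) < e"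
  proof (intro exI[of _ "max 1 n0"] allI impI)
    fix n assume n: "n \<ge> max 1 n0"
    then have n1: "real n \<ge> 1" and nN: "\<alpha> ^ N \<le> real n" using n0 by auto
    have "\<exists>k. real n < \<alpha> ^ k" using \<alpha> by (rule real_arch_pow)
    define k where "k = (LEAST k. real n < \<alpha> ^ k)"
    have k: "real n < \<alpha> ^ k" unfolding k_def by (rule LeastI_ex) fact
    have "k \<noteq> 0" using k n1 by (intro notI) simp
    then obtain m where m: "k = Suc m" using not0_implies_Suc by blast
    have lo: "\<alpha> ^ m \<le> real n"
      using not_less_Least[of m "\<lambda>k. real n < \<alpha> ^ k"] m by (simp add: k_def[symmetric] not_less)
    have "N < k" using k nN \<alpha> by (meson le_less_trans power_less_imp_less_exp)
    then have mN: "m \<ge> N" "Suc m \<ge> N" using m by auto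
    have am: "\<alpha> ^ m > 0" using \<alpha> by simp
    have S1: "S (nat \<lfloor>\<alpha> ^ m\<rfloor>) \<le> S n"
    proof -
      have "\<lfloor>\<alpha> ^ m\<rfloor> \<le> int n" using lo by (metis floor_mono floor_of_nat)
      then show ?thesis by (intro monoD[OF mono]) simp
    qed
    have S2: "S n \<le> S (nat \<lfloor>\<alpha> ^ Suc m\<rfloor>)"
    proof -
      have "int n \<le> \<lfloor>\<alpha> ^ Suc m\<rfloor>" using k m by (simp add: le_floor_iff)
      then show ?thesis by (intro monoD[OF mono]) simp
    qed
    have up: "S n / real n \<le> \<alpha> * a (Suc m)"
    proof -
      have "S n / real n \<le> S (nat \<lfloor>\<alpha> ^ Suc m\<rfloor>) / \<alpha> ^ m"
        using S2 lo am S0 by (intro frac_le) auto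
      also have "\<dots> = \<alpha> * a (Suc m)" using \<alpha> by (simp add: a_def)
      finally show ?thesis .
    qed
    have down: "a m \<le> \<alpha> * (S n / real n)"
    proof -
      have "a m \<le> S n / \<alpha> ^ m" unfolding a_def using S1 am by (intro divide_right_mono) auto
      also have "\<dots> = \<alpha> * (S n / \<alpha> ^ Suc m)" using \<alpha> by simp
      also have "\<dots> \<le> \<alpha> * (S n / real n)"
        using k m \<alpha> S0[of n] n1 by (intro mult_left_mono frac_le) auto
      finally show ?thesis .
    qed
    have "S n / real n < L + e"
    proof -
      have "\<alpha> * a (Suc m) \<le> \<alpha> * (L + e / 4)"
        using N[OF mN(2)] \<alpha> by (intro mult_left_mono) linarith+
      also have "\<dots> = L + e / 4 + d * L + d * (e / 4)" by (simp add: \<alpha>_def algebra_simps)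
      also have "d * (e / 4) \<le> 1 * (e / 4)" using d e by (intro mult_right_mono) auto
      finally have "\<alpha> * a (Suc m) \<le> L + e / 4 + d * L + 1 * (e / 4)" by simp
      then show ?thesis using up dL e by linarith
    qed
    moreover have "L - e < S n / real n"
    proof (rule ccontr)
      assume "\<not> L - e < S n / real n"
      then have c: "S n / real n \<le> L - e" by simp
      have "0 \<le> S n / real n" using S0 by simp
      have "\<alpha> * (S n / real n) \<le> \<alpha> * (L - e)" using c \<alpha> by (intro mult_left_mono) auto
      also have "\<dots> = L - e + d * (L - e)" by (simp add: \<alpha>_def algebra_simps)
      also have "d * (L - e) \<le> d * L" using d e by (intro mult_left_mono) auto
      finally have "a m \<le> L - e + d * L" using down by linarith
      then show False using N[OF mN(1)] dL e by linarith
    qed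
    ultimately show "norm (S n / real n - L) < e" by (simp add: abs_less_iff)
  qed
qed

text \<open>A series with finite expectation converges almost surely. It plays the role of
  Borel-Cantelli, for the truncation events as well as for the squared deviations.\<close>

lemma AE_tendsto_0_of_summable_integral:
  fixes f :: "nat \<Rightarrow> 'a \<Rightarrow> real"
  assumes int: "\<And>m. integrable M (f m)" and f0: "\<And>m x. x \<in> space M \<Longrightarrow> f m x \<ge> 0"
    and sum: "summable (\<lambda>m. \<integral>x. f m x \<partial>M)"
  shows "AE x in M. (\<lambda>m. f m x) \<longlonglongrightarrow> 0"
proof -
  have [measurable]: "f m \<in> borel_measurable M" for m using int[of m] by simp
  have eq: "(\<integral>\<^sup>+x. ennreal (f m x) \<partial>M) = ennreal (\<integral>x. f m x \<partial>M)" for m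
    using int f0 by (intro nn_integral_eq_integral) auto
  have "(\<integral>\<^sup>+x. (\<Sum>m. ennreal (f m x)) \<partial>M) = (\<Sum>m. \<integral>\<^sup>+x. ennreal (f m x) \<partial>M)"
    by (rule nn_integral_suminf) measurable
  also have "\<dots> \<noteq> \<infinity>"
    unfolding eq infinity_ennreal_def
    by (rule ennreal_suminf_neq_top[OF sum]) (intro integral_nonneg_AE AE_I2 f0)
  finally have "AE x in M. (\<Sum>m. ennreal (f m x)) \<noteq> \<infinity>"
    by (intro nn_integral_PInf_AE) auto
  with AE_space show ?thesis
  proof eventually_elim
    case (elim x)
    then have "summable (\<lambda>m. f m x)"
      using f0 by (intro summable_suminf_not_top) auto
    then show ?case by (rule summable_LIMSEQ_zero)
  qed
qed

lemma sum_geometric_distance_le: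
  fixes q :: real
  assumes q: "0 \<le> q" "q < 1"
  shows "(\<Sum>j\<in>{1..n}. q ^ (if i \<le> j then j - i else i - j)) \<le> 2 / (1 - q)"
proof -
  have geo: "(\<Sum>k\<in>K. q ^ k) \<le> 1 / (1 - q)" if "finite K" for K
    using sum_le_suminf[of "\<lambda>k. q ^ k" K] q that by (simp add: suminf_geometric)
  have "(\<Sum>j\<in>{1..n}. q ^ (if i \<le> j then j - i else i - j))
      = (\<Sum>j\<in>{1..n} \<inter> {j. i \<le> j}. q ^ (j - i)) + (\<Sum>j\<in>{1..n} \<inter> - {j. i \<le> j}. q ^ (i - j))"
    by (subst sum.If_cases[symmetric]) (auto intro: sum.cong)
  also have "(\<Sum>j\<in>{1..n} \<inter> {j. i \<le> j}. q ^ (j - i)) = (\<Sum>k\<in>(\<lambda>j. j - i) ` ({1..n} \<inter> {j. i \<le> j}). q ^ k)"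
    by (subst sum.reindex) (auto simp: inj_on_def)
  also have "\<dots> \<le> 1 / (1 - q)" by (rule geo) simp
  also have "(\<Sum>j\<in>{1..n} \<inter> - {j. i \<le> j}. q ^ (i - j)) = (\<Sum>k\<in>(\<lambda>j. i - j) ` ({1..n} \<inter> - {j. i \<le> j}). q ^ k)"
    by (subst sum.reindex) (auto simp: inj_on_def)
  also have "\<dots> \<le> 1 / (1 - q)" by (rule geo) simp
  finally show ?thesis by simp
qed

lemma (in prob_space) integral_same_distr:
  fixes f :: "real \<Rightarrow> real"
  assumes "X \<in> borel_measurable M" "Y \<in> borel_measurable M" "distr M borel X = distr M borel Y"
    "f \<in> borel_measurable borel"
  shows "expectation (\<lambda>\<omega>. f (X \<omega>)) = expectation (\<lambda>\<omega>. f (Y \<omega>))"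
  using assms integral_distr[of X M borel f] integral_distr[of Y M borel f] by metis

text \<open>Etemadi's argument: truncation, a variance bound along geometric subsequences, and
  monotonicity to fill the gaps. Independence is replaced by exponentially decaying covariances
  of the truncated variables.\<close>
theorem (in prob_space) etemadi:
  fixes Y \<tau> :: "nat \<Rightarrow> 'a \<Rightarrow> real"
  defines "Z \<equiv> \<lambda>i \<omega>. if \<tau> i \<omega> \<le> real i then Y i \<omega> else 0"
  assumes \<tau>_meas: "\<And>i. i \<ge> 1 \<Longrightarrow> \<tau> i \<in> borel_measurable M"
    and \<tau>_id: "\<And>i. i \<ge> 1 \<Longrightarrow> distr M borel (\<tau> i) = distr M borel (\<tau> 1)"
    and \<tau>_int: "integrable M (\<tau> 1)"
    and Y_meas: "\<And>i. i \<ge> 1 \<Longrightarrow> Y i \<in> borel_measurable M"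
    and Y_bd: "\<And>i \<omega>. i \<ge> 1 \<Longrightarrow> \<omega> \<in> space M \<Longrightarrow> 0 \<le> Y i \<omega> \<and> Y i \<omega> \<le> K * \<tau> i \<omega>"
    and \<tau>0: "\<And>i \<omega>. i \<ge> 1 \<Longrightarrow> \<omega> \<in> space M \<Longrightarrow> 0 \<le> \<tau> i \<omega>"
    and q: "0 \<le> q" "q < 1" and Kc: "Kc \<ge> 0" and K: "K \<ge> 0"
    and cov: "\<And>i j. 1 \<le> i \<Longrightarrow> i < j \<Longrightarrow>
      \<bar>expectation (\<lambda>\<omega>. Z i \<omega> * Z j \<omega>) - expectation (Z i) * expectation (Z j)\<bar> \<le> Kc * q ^ (j - i)"
    and mean: "(\<lambda>i. expectation (Z i)) \<longlonglongrightarrow> L"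
  shows "AE \<omega> in M. (\<lambda>n. (\<Sum>i\<in>{1..n}. Y i \<omega>) / real n) \<longlonglongrightarrow> L"
proof -
  have Z_meas: "Z i \<in> borel_measurable M" if "i \<ge> 1" for i
    unfolding Z_def using \<tau>_meas[OF that] Y_meas[OF that] by measurable
  have Z0: "0 \<le> Z i \<omega>" "Z i \<omega> \<le> K * real i" "Z i \<omega> \<le> Y i \<omega>" if "i \<ge> 1" "\<omega> \<in> space M" for i \<omega>
    using Y_bd[OF that] K \<tau>0[OF that] by (auto simp: Z_def intro: order_trans mult_left_mono)
  have Z_int: "integrable M (Z i)" if "i \<ge> 1" for i
    by (rule integrable_const_bound[of _ "K * real i"]) (use Z0[OF that] Z_meas[OF that] in auto)
  have ZZ_int: "integrable M (\<lambda>\<omega>. Z i \<omega> * Z j \<omega>)" if "i \<ge> 1" "j \<ge> 1" for i j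
    by (rule integrable_const_bound[of _ "(K * real i) * (K * real j)"])
      (use Z0(1,2)[OF that(1)] Z0(1,2)[OF that(2)] Z_meas that K in
        \<open>auto simp: abs_mult intro!: mult_mono borel_measurable_times\<close>)
  define e where "e i = expectation (Z i)" for i
  define D where "D i \<omega> = Z i \<omega> - e i" for i \<omega>
  have D_int: "integrable M (\<lambda>\<omega>. D i \<omega> * D j \<omega>)" if "i \<ge> 1" "j \<ge> 1" for i j
  proof -
    have "(\<lambda>\<omega>. D i \<omega> * D j \<omega>) = (\<lambda>\<omega>. Z i \<omega> * Z j \<omega> - e j * Z i \<omega> - e i * Z j \<omega> + e i * e j)"
      by (simp add: D_def algebra_simps fun_eq_iff)
    then show ?thesis using ZZ_int[OF that] Z_int that by simp
  qed
  have DD: "expectation (\<lambda>\<omega>. D i \<omega> * D j \<omega>) = expectation (\<lambda>\<omega>. Z i \<omega> * Z j \<omega>) - e i * e j" if "i \<ge> 1" "j \<ge> 1" for i j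
  proof -
    have "(\<lambda>\<omega>. D i \<omega> * D j \<omega>) = (\<lambda>\<omega>. Z i \<omega> * Z j \<omega> - e j * Z i \<omega> - e i * Z j \<omega> + e i * e j)"
      by (simp add: D_def algebra_simps fun_eq_iff)
    then show ?thesis using ZZ_int[OF that] Z_int that by (simp add: prob_space e_def[symmetric])
  qed
  \<comment> \<open>The level \<open>x\<close> is common to all indices: with
    \<open>x = \<alpha> ^ m\<close> it controls the second moments of all summands up to
    \<open>k m\<close> at once.\<close>
  define G where "G x = expectation (\<lambda>\<omega>. if \<tau> 1 \<omega> \<le> x then (\<tau> 1 \<omega>)\<^sup>2 else 0)" for x
  have G_int: "integrable M (\<lambda>\<omega>. if \<tau> i \<omega> \<le> x then (\<tau> i \<omega>)\<^sup>2 else 0)" if "i \<ge> 1" for i x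
    by (rule integrable_const_bound[of _ "x\<^sup>2"])
      (use \<tau>0[OF that] \<tau>_meas[OF that] in \<open>auto intro!: power_mono\<close>)
  have ZG: "expectation (\<lambda>\<omega>. Z i \<omega> * Z i \<omega>) \<le> K\<^sup>2 * G x" if i: "i \<ge> 1" "real i \<le> x" for i x
  proof -
    have "expectation (\<lambda>\<omega>. Z i \<omega> * Z i \<omega>) \<le> expectation (\<lambda>\<omega>. K\<^sup>2 * (if \<tau> i \<omega> \<le> x then (\<tau> i \<omega>)\<^sup>2 else 0))"
    proof (rule integral_mono)
      fix \<omega> assume w: "\<omega> \<in> space M"
      show "Z i \<omega> * Z i \<omega> \<le> K\<^sup>2 * (if \<tau> i \<omega> \<le> x then (\<tau> i \<omega>)\<^sup>2 else 0)"
      proof (cases "\<tau> i \<omega> \<le> real i")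
        case True
        have "Z i \<omega> * Z i \<omega> \<le> (K * \<tau> i \<omega>) * (K * \<tau> i \<omega>)"
          using Y_bd[OF i(1) w] True by (auto simp: Z_def intro!: mult_mono)
        then show ?thesis using True i by (simp add: power2_eq_square mult_ac)
      qed (simp add: Z_def)
    qed (use ZZ_int[OF i(1) i(1)] G_int[OF i(1)] in auto)
    also have "\<dots> = K\<^sup>2 * expectation (\<lambda>\<omega>. if \<tau> i \<omega> \<le> x then (\<tau> i \<omega>)\<^sup>2 else 0)" by simp
    also have "expectation (\<lambda>\<omega>. if \<tau> i \<omega> \<le> x then (\<tau> i \<omega>)\<^sup>2 else 0) = G x"
    proof -
      have "(\<lambda>t. if t \<le> x then t\<^sup>2 else 0) \<in> borel_measurable (borel :: real measure)" by measurable
      from integral_same_distr[OF \<tau>_meas[OF i(1)] \<tau>_meas[OF order_refl] \<tau>_id[OF i(1)] this]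
      show ?thesis by (simp add: G_def)
    qed
    finally show ?thesis .
  qed
  have G0: "G x \<ge> 0" for x unfolding G_def by (intro integral_nonneg_AE) auto
  define V where "V n = expectation (\<lambda>\<omega>. (\<Sum>i\<in>{1..n}. D i \<omega>)\<^sup>2)" for n
  have V_int: "integrable M (\<lambda>\<omega>. (\<Sum>i\<in>{1..n}. D i \<omega>)\<^sup>2)" for n
    unfolding power2_eq_square sum_product by (intro Bochner_Integration.integrable_sum D_int) auto
  have V: "V n \<le> real n * (K\<^sup>2 * G x + Kc * (2 / (1 - q)))" if x: "real n \<le> x" for n x
  proof -
    have "V n = (\<Sum>i\<in>{1..n}. \<Sum>j\<in>{1..n}. expectation (\<lambda>\<omega>. D i \<omega> * D j \<omega>))"
    proof -
      have "V n = (\<Sum>i\<in>{1..n}. expectation (\<lambda>\<omega>. \<Sum>j\<in>{1..n}. D i \<omega> * D j \<omega>))"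
        unfolding V_def power2_eq_square sum_product
        by (intro Bochner_Integration.integral_sum Bochner_Integration.integrable_sum D_int) auto
      also have "\<dots> = (\<Sum>i\<in>{1..n}. \<Sum>j\<in>{1..n}. expectation (\<lambda>\<omega>. D i \<omega> * D j \<omega>))"
        by (intro sum.cong refl Bochner_Integration.integral_sum D_int) auto
      finally show ?thesis .
    qed
    \<comment> \<open>Diagonal terms are bounded by the truncated second moment, the others by the
      covariance hypothesis, whose geometric decay gives a constant per row.\<close>
    also have "\<dots> \<le> (\<Sum>i\<in>{1..n}. \<Sum>j\<in>{1..n}. (if j = i then K\<^sup>2 * G x else 0) + Kc * q ^ (if i \<le> j then j - i else i - j))"
    proof (intro sum_mono)
      fix i j assume i: "i \<in> {1..n}" and j: "j \<in> {1..n}"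
      consider "i = j" | "i < j" | "j < i" by linarith
      then show "expectation (\<lambda>\<omega>. D i \<omega> * D j \<omega>) \<le> (if j = i then K\<^sup>2 * G x else 0) + Kc * q ^ (if i \<le> j then j - i else i - j)"
      proof cases
        case 1
        have "expectation (\<lambda>\<omega>. D i \<omega> * D i \<omega>) \<le> expectation (\<lambda>\<omega>. Z i \<omega> * Z i \<omega>)" using DD[of i i] i by simp
        also have "\<dots> \<le> K\<^sup>2 * G x" using i x by (intro ZG) auto
        finally show ?thesis using 1 Kc by simp
      next
        case 2
        then show ?thesis using DD[of i j] cov[of i j] i j by (auto simp: e_def)
      next
        case 3
        then show ?thesis using DD[of j i] cov[of j i] i j by (auto simp: e_def mult.commute)
      qed
    qed
    also have "\<dots> = (\<Sum>i\<in>{1..n}. K\<^sup>2 * G x + Kc * (\<Sum>j\<in>{1..n}. q ^ (if i \<le> j then j - i else i - j)))"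
      by (intro sum.cong) (auto simp: sum.distrib sum_distrib_left)
    also have "\<dots> \<le> (\<Sum>i\<in>{1..n}. K\<^sup>2 * G x + Kc * (2 / (1 - q)))"
      using Kc q by (intro sum_mono add_left_mono mult_left_mono sum_geometric_distance_le) auto
    finally show ?thesis by simp
  qed
  have tail: "AE \<omega> in M. (\<lambda>n. ((\<Sum>i\<in>{1..n}. Y i \<omega>) - (\<Sum>i\<in>{1..n}. Z i \<omega>)) / real n) \<longlonglongrightarrow> 0"
  proof -
    \<comment> \<open>Flags that truncation acts at index \<open>Suc i\<close>, so that a series
      over all naturals starts at index 1. The expected number of flags is at most the mean of
      \<open>\<tau> 1\<close>; almost surely they stop.\<close>
    define b where "b i \<omega> = (if real (Suc i) < \<tau> (Suc i) \<omega> then 1 else 0 :: real)" for i \<omega>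
    have b_int: "integrable M (b i)" for i
      by (rule integrable_const_bound[of _ 1]) (use \<tau>_meas[of "Suc i"] in \<open>auto simp: b_def[abs_def]\<close>)
    have b1_int: "integrable M (\<lambda>\<omega>. if real (Suc i) < \<tau> 1 \<omega> then 1 else 0 :: real)" for i
      by (rule integrable_const_bound[of _ 1]) (use \<tau>_meas[of 1] in auto)
    have "summable (\<lambda>i. expectation (b i))"
    proof (rule summableI_nonneg_bounded)
      show "0 \<le> expectation (b i)" for i by (intro integral_nonneg_AE) (auto simp: b_def)
      fix n
      have "(\<Sum>i<n. expectation (b i)) = (\<Sum>i<n. expectation (\<lambda>\<omega>. if real (Suc i) < \<tau> 1 \<omega> then 1 else 0))"
      proof (intro sum.cong refl)
        fix i
        have "(\<lambda>t. if real (Suc i) < t then 1 else 0 :: real) \<in> borel_measurable borel" by measurable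
        from integral_same_distr[OF \<tau>_meas[of "Suc i"] \<tau>_meas[OF order_refl] \<tau>_id[of "Suc i"] this]
        show "expectation (b i) = expectation (\<lambda>\<omega>. if real (Suc i) < \<tau> 1 \<omega> then 1 else 0)"
          by (simp add: b_def[abs_def])
      qed
      also have "\<dots> = expectation (\<lambda>\<omega>. \<Sum>i<n. if real (Suc i) < \<tau> 1 \<omega> then 1 else 0)"
        using b1_int by simp
      also have "\<dots> \<le> expectation (\<tau> 1)"
      proof (rule integral_mono)
        fix \<omega> assume w: "\<omega> \<in> space M"
        have t: "\<tau> 1 \<omega> \<ge> 0" using \<tau>0 w by simp
        have "(\<Sum>i<n. if real (Suc i) < \<tau> 1 \<omega> then 1 else 0 :: real) = real (card ({..<n} \<inter> {i. real (Suc i) < \<tau> 1 \<omega>}))"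
          by (simp add: sum.If_cases del: of_nat_Suc)
        also have "\<dots> \<le> real (card {..<nat \<lfloor>\<tau> 1 \<omega>\<rfloor>})"
        proof (intro of_nat_mono card_mono subsetI)
          fix i assume "i \<in> {..<n} \<inter> {i. real (Suc i) < \<tau> 1 \<omega>}"
          then have "int (Suc i) \<le> \<lfloor>\<tau> 1 \<omega>\<rfloor>" by (simp add: le_floor_iff)
          then show "i \<in> {..<nat \<lfloor>\<tau> 1 \<omega>\<rfloor>}" by simp
        qed simp
        also have "\<dots> \<le> \<tau> 1 \<omega>" using t by simp
        finally show "(\<Sum>i<n. if real (Suc i) < \<tau> 1 \<omega> then 1 else 0 :: real) \<le> \<tau> 1 \<omega>" .
      qed (use b1_int \<tau>_int in auto)
      finally show "(\<Sum>i<n. expectation (b i)) \<le> expectation (\<tau> 1)" .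
    qed
    then have "AE \<omega> in M. (\<lambda>i. b i \<omega>) \<longlonglongrightarrow> 0"
      by (rule AE_tendsto_0_of_summable_integral[OF b_int, rotated]) (simp add: b_def)
    then show ?thesis
    proof eventually_elim
      case (elim \<omega>)
      then have "eventually (\<lambda>i. b i \<omega> < 1) sequentially" by (rule order_tendstoD) simp
      then obtain N where N: "\<And>i. i \<ge> N \<Longrightarrow> b i \<omega> < 1" by (auto simp: eventually_sequentially)
      have YZ: "Y i \<omega> = Z i \<omega>" if "i > N" for i
      proof -
        have "b (i - 1) \<omega> < 1" using that by (intro N) simp
        then show ?thesis using that by (auto simp: b_def Z_def split: if_splits)
      qed
      define c where "c = (\<Sum>i\<in>{1..N}. Y i \<omega> - Z i \<omega>)"
      have "(\<Sum>i\<in>{1..n}. Y i \<omega>) - (\<Sum>i\<in>{1..n}. Z i \<omega>) = c" if "n \<ge> N" for n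
        unfolding sum_subtractf[symmetric] c_def using that YZ
        by (intro sum.mono_neutral_right) auto
      then have "eventually (\<lambda>n. c / real n = ((\<Sum>i\<in>{1..n}. Y i \<omega>) - (\<Sum>i\<in>{1..n}. Z i \<omega>)) / real n) sequentially"
        by (intro eventually_sequentiallyI[of N]) simp
      moreover have "(\<lambda>n. c / real n) \<longlonglongrightarrow> 0" by (rule lim_const_over_n)
      ultimately show ?case by (rule Lim_transform_eventually[rotated])
    qed
  qed
  have geom: "AE \<omega> in M. (\<lambda>m. (\<Sum>i\<in>{1..nat \<lfloor>\<alpha> ^ m\<rfloor>}. Y i \<omega>) / \<alpha> ^ m) \<longlonglongrightarrow> L" if \<alpha>: "\<alpha> > 1" for \<alpha> :: real
  proof -
    define k where "k m = nat \<lfloor>\<alpha> ^ m\<rfloor>" for m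
    have am: "\<alpha> ^ m > 0" for m using \<alpha> by simp
    have k_le: "real (k m) \<le> \<alpha> ^ m" for m using am[of m] by (simp add: k_def)
    have k_ge: "\<alpha> ^ m - 1 \<le> real (k m)" for m
      unfolding k_def by linarith
    have k_inf: "filterlim k at_top sequentially"
    proof -
      have "filterlim (\<lambda>m. \<alpha> ^ m) at_top sequentially"
        by (rule filterlim_at_infinity_imp_filterlim_at_top[OF filterlim_realpow_sequentially_gt1]) (use \<alpha> am in auto)
      then have "filterlim (\<lambda>m. \<lfloor>\<alpha> ^ m\<rfloor>) at_top sequentially"
        by (rule filterlim_compose[OF filterlim_floor_sequentially])
      then show ?thesis unfolding k_def
        by (rule filterlim_compose[OF filterlim_nat_sequentially])
    qed
    have k_ratio: "(\<lambda>m. real (k m) / \<alpha> ^ m) \<longlonglongrightarrow> 1"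
    proof (rule tendsto_sandwich)
      have "(\<lambda>m. 1 - (1 / \<alpha>) ^ m) \<longlonglongrightarrow> 1 - 0"
        using \<alpha> by (intro tendsto_diff tendsto_const LIMSEQ_realpow_zero) auto
      then show "(\<lambda>m. 1 - (1 / \<alpha>) ^ m) \<longlonglongrightarrow> 1" by simp
      show "eventually (\<lambda>m. 1 - (1 / \<alpha>) ^ m \<le> real (k m) / \<alpha> ^ m) sequentially"
      proof (intro always_eventually allI)
        fix m
        have "1 - (1 / \<alpha>) ^ m = (\<alpha> ^ m - 1) / \<alpha> ^ m" using \<alpha> by (simp add: field_simps)
        also have "\<dots> \<le> real (k m) / \<alpha> ^ m" using k_ge am by (intro divide_right_mono) (auto simp: less_imp_le)
        finally show "1 - (1 / \<alpha>) ^ m \<le> real (k m) / \<alpha> ^ m" .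
      qed
      show "eventually (\<lambda>m. real (k m) / \<alpha> ^ m \<le> 1) sequentially"
        using k_le am by (intro always_eventually allI) simp
    qed simp
    define F where "F m \<omega> = (\<Sum>i\<in>{1..k m}. D i \<omega>)\<^sup>2 / (\<alpha> ^ m)\<^sup>2" for m \<omega>
    have G_sum: "summable (\<lambda>m. G (\<alpha> ^ m) / \<alpha> ^ m)"
    proof (rule summableI_nonneg_bounded)
      show "0 \<le> G (\<alpha> ^ m) / \<alpha> ^ m" for m using G0 am by (simp add: less_imp_le)
      fix M'
      have "(\<Sum>m<M'. G (\<alpha> ^ m) / \<alpha> ^ m)
          = expectation (\<lambda>\<omega>. \<Sum>m<M'. (if \<tau> 1 \<omega> \<le> \<alpha> ^ m then (\<tau> 1 \<omega>)\<^sup>2 else 0) / \<alpha> ^ m)"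
        unfolding G_def using G_int[of 1] by simp
      also have "\<dots> \<le> expectation (\<lambda>\<omega>. \<tau> 1 \<omega> * (1 / (1 - 1 / \<alpha>)))"
      proof (rule integral_mono)
        fix \<omega> assume w: "\<omega> \<in> space M"
        let ?t = "\<tau> 1 \<omega>"
        have t: "?t \<ge> 0" using \<tau>0 w by simp
        \<comment> \<open>One factor \<open>?t\<close> is pulled out; the rest is a geometric
          sequence cut off above 1, so the first moment of \<open>\<tau> 1\<close> suffices.\<close>
        have "(\<Sum>m<M'. (if ?t \<le> \<alpha> ^ m then ?t\<^sup>2 else 0) / \<alpha> ^ m)
            = ?t * (\<Sum>m<M'. if ?t * (1 / \<alpha>) ^ m \<le> 1 then ?t * (1 / \<alpha>) ^ m else 0)"
          unfolding sum_distrib_left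
          by (intro sum.cong) (use am in \<open>auto simp: power2_eq_square field_simps power_one_over\<close>)
        also have "\<dots> \<le> ?t * (1 / (1 - 1 / \<alpha>))"
          using \<alpha> t by (intro mult_left_mono truncated_geometric_sum_le) auto
        finally show "(\<Sum>m<M'. (if ?t \<le> \<alpha> ^ m then ?t\<^sup>2 else 0) / \<alpha> ^ m) \<le> ?t * (1 / (1 - 1 / \<alpha>))" .
      qed (use G_int[of 1] \<tau>_int in \<open>auto intro!: integrable_sum\<close>)
      finally show "(\<Sum>m<M'. G (\<alpha> ^ m) / \<alpha> ^ m) \<le> expectation (\<lambda>\<omega>. \<tau> 1 \<omega> * (1 / (1 - 1 / \<alpha>)))" .
    qed
    \<comment> \<open>The variance is at most \<open>\<alpha> ^ m\<close> times a truncated moment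
      plus a constant, against the square of \<open>\<alpha> ^ m\<close> in the denominator.\<close>
    have "summable (\<lambda>m. expectation (F m))"
    proof (rule summable_comparison_test')
      show "summable (\<lambda>m. K\<^sup>2 * (G (\<alpha> ^ m) / \<alpha> ^ m) + Kc * (2 / (1 - q)) * (1 / \<alpha>) ^ m)"
        using \<alpha> by (intro summable_add summable_mult G_sum summable_geometric) auto
      fix m :: nat
      have "expectation (F m) = V (k m) / (\<alpha> ^ m)\<^sup>2" unfolding F_def[abs_def] V_def by simp
      also have "\<dots> \<le> \<alpha> ^ m * (K\<^sup>2 * G (\<alpha> ^ m) + Kc * (2 / (1 - q))) / (\<alpha> ^ m)\<^sup>2"
      proof (rule divide_right_mono)
        have "V (k m) \<le> real (k m) * (K\<^sup>2 * G (\<alpha> ^ m) + Kc * (2 / (1 - q)))" by (rule V[OF k_le])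
        also have "\<dots> \<le> \<alpha> ^ m * (K\<^sup>2 * G (\<alpha> ^ m) + Kc * (2 / (1 - q)))"
          using k_le G0 Kc q by (intro mult_right_mono) auto
        finally show "V (k m) \<le> \<alpha> ^ m * (K\<^sup>2 * G (\<alpha> ^ m) + Kc * (2 / (1 - q)))" .
      qed simp
      also have "\<dots> = K\<^sup>2 * (G (\<alpha> ^ m) / \<alpha> ^ m) + Kc * (2 / (1 - q)) * (1 / \<alpha>) ^ m"
      proof -
        have "X * (a * g + c) / X\<^sup>2 = a * (g / X) + c * (1 / X)" if "X > 0" for X a g c :: real
          using that by (simp add: power2_eq_square field_simps)
        from this[OF am[of m]] show ?thesis by (simp only: power_one_over)
      qed
      finally show "norm (expectation (F m)) \<le> K\<^sup>2 * (G (\<alpha> ^ m) / \<alpha> ^ m) + Kc * (2 / (1 - q)) * (1 / \<alpha>) ^ m"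
        by (simp add: F_def integral_nonneg_AE)
    qed
    then have "AE \<omega> in M. (\<lambda>m. F m \<omega>) \<longlonglongrightarrow> 0"
      by (rule AE_tendsto_0_of_summable_integral[rotated 2]) (simp_all add: F_def V_int del: One_nat_def)
    with tail show ?thesis
    proof eventually_elim
      case (elim \<omega>)
      have "(\<lambda>m. sqrt (F m \<omega>)) \<longlonglongrightarrow> sqrt 0" by (intro tendsto_real_sqrt elim)
      then have "(\<lambda>m. \<bar>(\<Sum>i\<in>{1..k m}. D i \<omega>) / \<alpha> ^ m\<bar>) \<longlonglongrightarrow> 0"
        using am by (simp add: F_def real_sqrt_divide abs_divide less_imp_le)
      then have 1: "(\<lambda>m. (\<Sum>i\<in>{1..k m}. D i \<omega>) / \<alpha> ^ m) \<longlonglongrightarrow> 0"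
        by (rule tendsto_rabs_zero_cancel)
      have 2: "(\<lambda>m. (\<Sum>i\<in>{1..k m}. e i) / real (k m) * (real (k m) / \<alpha> ^ m)) \<longlonglongrightarrow> L * 1"
        using filterlim_compose[OF cesaro_mean[of e L] k_inf] mean
        by (intro tendsto_mult k_ratio) (auto simp: e_def[abs_def])
      have 3: "(\<lambda>m. ((\<Sum>i\<in>{1..k m}. Y i \<omega>) - (\<Sum>i\<in>{1..k m}. Z i \<omega>)) / real (k m) * (real (k m) / \<alpha> ^ m)) \<longlonglongrightarrow> 0 * 1"
        by (intro tendsto_mult k_ratio filterlim_compose[OF elim(1) k_inf])
      have cancel: "x / real (k m) * (real (k m) / \<alpha> ^ m) = x / \<alpha> ^ m" if "k m = 0 \<longrightarrow> x = 0" for x m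
        using that by (cases "k m = 0") auto
      have e2: "(\<lambda>m. (\<Sum>i\<in>{1..k m}. e i) / \<alpha> ^ m) \<longlonglongrightarrow> L"
        using 2 by (subst (asm) cancel) auto
      have e3: "(\<lambda>m. ((\<Sum>i\<in>{1..k m}. Y i \<omega>) - (\<Sum>i\<in>{1..k m}. Z i \<omega>)) / \<alpha> ^ m) \<longlonglongrightarrow> 0"
        using 3 by (subst (asm) cancel) auto
      have "(\<Sum>i\<in>{1..k m}. Y i \<omega>) / \<alpha> ^ m = (\<Sum>i\<in>{1..k m}. D i \<omega>) / \<alpha> ^ m + (\<Sum>i\<in>{1..k m}. e i) / \<alpha> ^ m
          + ((\<Sum>i\<in>{1..k m}. Y i \<omega>) - (\<Sum>i\<in>{1..k m}. Z i \<omega>)) / \<alpha> ^ m" for m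
        by (simp add: D_def sum_subtractf diff_divide_distrib)
      then show ?case
        using tendsto_add[OF tendsto_add[OF 1 e2] e3] by (simp add: k_def)
    qed
  qed
  have L0: "L \<ge> 0"
  proof (rule LIMSEQ_le_const[OF mean], intro exI[of _ 1] allI impI)
    fix n :: nat assume "1 \<le> n"
    then show "0 \<le> expectation (Z n)" by (intro integral_nonneg_AE AE_I2 Z0)
  qed
  have "AE \<omega> in M. \<forall>l. (\<lambda>m. (\<Sum>i\<in>{1..nat \<lfloor>(1 + 1 / real (Suc l)) ^ m\<rfloor>}. Y i \<omega>) / (1 + 1 / real (Suc l)) ^ m) \<longlonglongrightarrow> L"
    by (subst AE_all_countable) (intro allI geom, simp)
  with AE_space show ?thesis
  proof eventually_elim
    case (elim \<omega>)
    show ?case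
    proof (rule monotone_average_limit)
      show "mono (\<lambda>n. \<Sum>i\<in>{1..n}. Y i \<omega>)"
        using Y_bd elim by (intro monoI sum_mono2) auto
      show "0 \<le> (\<Sum>i\<in>{1..n}. Y i \<omega>)" for n using Y_bd elim by (intro sum_nonneg) auto
    qed (use elim L0 in auto)
  qed
qed

section \<open>The random walk along the switching times\<close>

locale jump_process = walk H1 H2 \<mu> p + M: prob_space M
  for H1 H2 :: "'n::finite cmat" and \<mu> p and M :: "'w measure" +
  fixes \<tau> :: "nat \<Rightarrow> 'w \<Rightarrow> real"
  assumes indep: "M.indep_vars (\<lambda>_. borel) \<tau> {1..}"
    and law: "i \<ge> 1 \<Longrightarrow> distr M borel (\<tau> i) = \<mu>"
    and \<tau>_pos: "i \<ge> 1 \<Longrightarrow> \<omega> \<in> space M \<Longrightarrow> \<tau> i \<omega> > 0"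
    and \<tau>_mean: "integrable M (\<tau> 1)"
begin

lemma \<tau>_measurable: "i \<ge> 1 \<Longrightarrow> \<tau> i \<in> borel_measurable M"
  using indep by (auto simp: M.indep_vars_def)

definition X :: "nat \<Rightarrow> 'w \<Rightarrow> 'n cmat" where "X n \<omega> = J (\<lambda>i. \<tau> i \<omega>) n"

text \<open>The history of the first \<open>n\<close> times, restricted so as to be an element of
  the product space \<open>Pb n\<close>; \<open>X k\<close> with \<open>k \<le> n\<close> is a
  function of it.\<close>

definition W :: "nat \<Rightarrow> 'w \<Rightarrow> nat \<Rightarrow> real" where "W n \<omega> = restrict (\<lambda>i. \<tau> i \<omega>) {1..n}"

abbreviation Pb :: "nat \<Rightarrow> (nat \<Rightarrow> real) measure" where "Pb n \<equiv> PiM {1..n} (\<lambda>_. borel)"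

lemma X_0: "X 0 \<omega> = mat 1"
  by (simp add: X_def)

lemma X_Suc: "X (Suc n) \<omega> = ev (Suc n) (\<tau> (Suc n) \<omega>) ** X n \<omega>"
  by (simp add: X_def)

lemma X_unitary: "X n \<omega> \<in> unitary_group"
  by (simp add: X_def)

lemma X_measurable [measurable]: "X n \<in> borel_measurable M"
proof (induction n)
  case (Suc n)
  have [measurable]: "\<tau> (Suc n) \<in> borel_measurable M" by (rule \<tau>_measurable) simp
  note Suc[measurable]
  show ?case unfolding X_Suc[abs_def] by measurable
qed (simp add: X_def)

lemma J_W: "k \<le> n \<Longrightarrow> J (W n \<omega>) k = X k \<omega>"
  unfolding X_def by (rule J_cong) (auto simp: W_def)

lemma W_measurable [measurable]: "W n \<in> M \<rightarrow>\<^sub>M Pb n"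
  unfolding W_def using \<tau>_measurable by (intro measurable_restrict) auto

lemma J_measurable_Pb:
  assumes "k \<le> n"
  shows "(\<lambda>s. J s k) \<in> borel_measurable (Pb n)"
proof -
  have "(\<lambda>s. J s k) \<in> borel_measurable (PiM {1..n} (\<lambda>_. \<mu>))"
    using assms by (intro J_measurable) auto
  moreover have "sets (PiM {1..n} (\<lambda>_. \<mu>)) = sets (Pb n)"
    by (rule sets_PiM_cong) auto
  ultimately show ?thesis by (simp cong: measurable_cong_sets)
qed

text \<open>Independence of disjoint blocks, with the block of the next time a product over one
  index whose evaluation map identifies it with the real line.\<close>

lemma joint_law:
  "distr M (Pb n \<Otimes>\<^sub>M borel) (\<lambda>\<omega>. (W n \<omega>, \<tau> (Suc n) \<omega>)) = distr M (Pb n) (W n) \<Otimes>\<^sub>M \<mu>"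
proof -
  let ?Q = "PiM {Suc n} (\<lambda>_. borel :: real measure)"
  define V where "V \<omega> = restrict (\<lambda>i. \<tau> i \<omega>) {Suc n}" for \<omega>
  have "M.indep_var (Pb n) (W n) ?Q V"
    unfolding W_def[abs_def] V_def[abs_def] by (rule M.indep_var_restrict[OF indep]) auto
  then have V: "V \<in> M \<rightarrow>\<^sub>M ?Q"
    and joint: "distr M (Pb n) (W n) \<Otimes>\<^sub>M distr M ?Q V = distr M (Pb n \<Otimes>\<^sub>M ?Q) (\<lambda>\<omega>. (W n \<omega>, V \<omega>))"
    by (simp_all add: M.indep_var_distribution_eq)
  have c: "(\<lambda>v. v (Suc n)) \<in> ?Q \<rightarrow>\<^sub>M borel"
    by (rule measurable_component_singleton) simp
  have Vt: "(\<lambda>v. v (Suc n)) \<circ> V = \<tau> (Suc n)" by (simp add: V_def fun_eq_iff)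
  have d2: "distr (distr M ?Q V) borel (\<lambda>v. v (Suc n)) = \<mu>"
    using distr_distr[OF c V] law[of "Suc n"] by (simp add: Vt)
  have d1: "distr (distr M (Pb n) (W n)) (Pb n) (\<lambda>w. w) = distr M (Pb n) (W n)"
    by (rule distr_id2) simp
  have m: "(\<lambda>(w, v). (w, v (Suc n))) \<in> Pb n \<Otimes>\<^sub>M ?Q \<rightarrow>\<^sub>M Pb n \<Otimes>\<^sub>M borel"
    using measurable_compose[OF measurable_snd c] by (simp add: case_prod_unfold)
  have "distr M (Pb n) (W n) \<Otimes>\<^sub>M \<mu> = distr (distr M (Pb n) (W n)) (Pb n) (\<lambda>w. w) \<Otimes>\<^sub>M distr (distr M ?Q V) borel (\<lambda>v. v (Suc n))"
    by (simp only: d1 d2)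
  also have "\<dots> = distr (distr M (Pb n) (W n) \<Otimes>\<^sub>M distr M ?Q V) (Pb n \<Otimes>\<^sub>M borel) (\<lambda>(w, v). (w, v (Suc n)))"
    by (rule pair_measure_distr) (use c mu.sigma_finite_measure_axioms d2 in \<open>auto simp: measurable_distr_eq1\<close>)
  also have "\<dots> = distr M (Pb n \<Otimes>\<^sub>M borel) ((\<lambda>(w, v). (w, v (Suc n))) \<circ> (\<lambda>\<omega>. (W n \<omega>, V \<omega>)))"
    unfolding joint using V by (intro distr_distr[OF m]) measurable
  also have "(\<lambda>(w, v). (w, v (Suc n))) \<circ> (\<lambda>\<omega>. (W n \<omega>, V \<omega>)) = (\<lambda>\<omega>. (W n \<omega>, \<tau> (Suc n) \<omega>))"
    by (simp add: V_def fun_eq_iff)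
  finally show ?thesis by simp
qed

lemma markov_step:
  fixes H :: "(nat \<Rightarrow> real) \<times> real \<Rightarrow> real"
  assumes H: "H \<in> borel_measurable (Pb n \<Otimes>\<^sub>M borel)" and B: "\<And>z. \<bar>H z\<bar> \<le> B"
  shows "(\<integral>\<omega>. H (W n \<omega>, \<tau> (Suc n) \<omega>) \<partial>M) = (\<integral>\<omega>. (\<integral>s. H (W n \<omega>, s) \<partial>\<mu>) \<partial>M)"
proof -
  have [measurable]: "\<tau> (Suc n) \<in> borel_measurable M" by (rule \<tau>_measurable) simp
  let ?D = "distr M (Pb n) (W n)"
  interpret D: prob_space ?D by (rule M.prob_space_distr) measurable
  interpret pp: pair_prob_space ?D \<mu> ..
  have sD: "sets (?D \<Otimes>\<^sub>M \<mu>) = sets (Pb n \<Otimes>\<^sub>M borel)" by (intro sets_pair_measure_cong) auto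
  have H': "H \<in> borel_measurable (?D \<Otimes>\<^sub>M \<mu>)" using H by (simp cong: measurable_cong_sets add: sD)
  have "integrable (?D \<Otimes>\<^sub>M \<mu>) H"
    by (rule pp.P.integrable_const_bound[of _ B]) (use B H' in auto)
  have "(\<integral>\<omega>. H (W n \<omega>, \<tau> (Suc n) \<omega>) \<partial>M) = integral\<^sup>L (?D \<Otimes>\<^sub>M \<mu>) H"
    unfolding joint_law[symmetric] by (rule integral_distr[OF _ H, symmetric]) measurable
  also have "\<dots> = (\<integral>w. (\<integral>s. H (w, s) \<partial>\<mu>) \<partial>?D)"
    by (rule pp.integral_fst'[symmetric]) fact
  also have "\<dots> = (\<integral>\<omega>. (\<integral>s. H (W n \<omega>, s) \<partial>\<mu>) \<partial>M)"
  proof (rule integral_distr)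
    have "case_prod (\<lambda>w s. H (w, s)) \<in> borel_measurable (Pb n \<Otimes>\<^sub>M \<mu>)"
    proof -
      have "sets (Pb n \<Otimes>\<^sub>M \<mu>) = sets (Pb n \<Otimes>\<^sub>M borel)" by (intro sets_pair_measure_cong) auto
      then show ?thesis using H by (simp cong: measurable_cong_sets)
    qed
    then show "(\<lambda>w. \<integral>s. H (w, s) \<partial>\<mu>) \<in> borel_measurable (Pb n)"
      by (rule mu.borel_measurable_lebesgue_integral)
  qed measurable
  finally show ?thesis .
qed

text \<open>The Markov property in weak form: \<open>T a n \<phi> (X a \<omega>)\<close> is the
  conditional mean of \<open>\<phi>\<close> at step \<open>a + n\<close>, tested against bounded
  functions of the history up to \<open>a\<close>.\<close>

lemma markov_T:
  assumes \<psi>: "\<psi> \<in> borel_measurable (Pb a)" and B: "\<And>w. \<bar>\<psi> w\<bar> \<le> B" and \<phi>: "bm B' \<phi>"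
  shows "(\<integral>\<omega>. \<psi> (W a \<omega>) * \<phi> (X (a + n) \<omega>) \<partial>M) = (\<integral>\<omega>. \<psi> (W a \<omega>) * T a n \<phi> (X a \<omega>) \<partial>M)"
  using \<phi>
proof (induction n arbitrary: \<phi>)
  case (Suc n)
  note bm_measurable[OF Suc.prems, measurable]
  define H where "H z = \<psi> (restrict (fst z) {1..a}) * \<phi> (ev (Suc (a + n)) (snd z) ** J (fst z) (a + n))" for z
  have r: "restrict (W (a + n) \<omega>) {1..a} = W a \<omega>" for \<omega> by (auto simp: W_def restrict_def fun_eq_iff)
  have "(\<lambda>w. restrict w {1..a}) \<in> Pb (a + n) \<rightarrow>\<^sub>M Pb a" by (rule measurable_restrict_subset) auto
  from measurable_compose[OF this \<psi>] have m1: "(\<lambda>w. \<psi> (restrict w {1..a})) \<in> borel_measurable (Pb (a + n))" .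
  have m2: "(\<lambda>z. \<psi> (restrict (fst z) {1..a})) \<in> borel_measurable (Pb (a + n) \<Otimes>\<^sub>M borel)"
    by (rule measurable_compose[OF measurable_fst m1])
  have m3 [measurable]: "(\<lambda>z. J (fst z) (a + n)) \<in> borel_measurable (Pb (a + n) \<Otimes>\<^sub>M borel)"
    by (rule measurable_compose[OF measurable_fst J_measurable_Pb]) simp
  have m4: "(\<lambda>z. \<phi> (ev (Suc (a + n)) (snd z) ** J (fst z) (a + n))) \<in> borel_measurable (Pb (a + n) \<Otimes>\<^sub>M (borel :: real measure))"
    by measurable
  have H: "H \<in> borel_measurable (Pb (a + n) \<Otimes>\<^sub>M borel)" unfolding H_def using m2 m4 by (rule borel_measurable_times)
  have HB: "\<bar>H z\<bar> \<le> B * B'" for z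
    unfolding H_def abs_mult using B Suc.prems by (intro mult_mono) (auto simp: bm_def intro: order_trans[OF abs_ge_zero B])
  have "(\<integral>\<omega>. \<psi> (W a \<omega>) * \<phi> (X (a + Suc n) \<omega>) \<partial>M) = (\<integral>\<omega>. H (W (a + n) \<omega>, \<tau> (Suc (a + n)) \<omega>) \<partial>M)"
    by (simp add: H_def r J_W X_Suc del: One_nat_def)
  also have "\<dots> = (\<integral>\<omega>. (\<integral>s. H (W (a + n) \<omega>, s) \<partial>\<mu>) \<partial>M)"
    by (rule markov_step[OF H HB])
  also have "\<dots> = (\<integral>\<omega>. \<psi> (W a \<omega>) * Kop (Suc (a + n)) \<phi> (X (a + n) \<omega>) \<partial>M)"
    by (simp add: H_def r J_W Kop_def del: One_nat_def)
  also have "\<dots> = (\<integral>\<omega>. \<psi> (W a \<omega>) * T a n (Kop (Suc (a + n)) \<phi>) (X a \<omega>) \<partial>M)"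
    by (rule Suc.IH[OF Kop_bm[OF Suc.prems]])
  finally show ?case by simp
qed simp

lemma expectation_X: "bm B \<phi> \<Longrightarrow> (\<integral>\<omega>. \<phi> (X n \<omega>) \<partial>M) = T 0 n \<phi> (mat 1)"
  using markov_T[of "\<lambda>_. 1" 0 1 B \<phi> n] by (simp add: X_0 M.prob_space)

section \<open>Integrals over the cycles\<close>

text \<open>The contribution of one cycle of length \<open>t\<close> started at \<open>x\<close> to
  the time integral; it is 0 for negative \<open>t\<close>.\<close>

definition cyc :: "('n cmat \<Rightarrow> real) \<Rightarrow> nat \<Rightarrow> real \<Rightarrow> 'n cmat \<Rightarrow> real" where
  "cyc f j t x = (\<integral>s. indicator {0..<t} s * f (ev j s ** x) \<partial>lborel)"

definition Y :: "('n cmat \<Rightarrow> real) \<Rightarrow> nat \<Rightarrow> 'w \<Rightarrow> real" where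
  "Y f i \<omega> = cyc f i (\<tau> i \<omega>) (X (i - 1) \<omega>)"

definition trunc :: "('n cmat \<Rightarrow> real) \<Rightarrow> nat \<Rightarrow> real \<Rightarrow> 'n cmat \<Rightarrow> real" where
  "trunc f i t x = (if t \<le> real i then cyc f i t x else 0)"

text \<open>The conditional mean of the truncated cycle integral given the starting point of the
  cycle, a function on the matrices to which the transition operators apply.\<close>

definition tbar :: "('n cmat \<Rightarrow> real) \<Rightarrow> nat \<Rightarrow> 'n cmat \<Rightarrow> real" where
  "tbar f i x = (\<integral>t. trunc f i t x \<partial>\<mu>)"

text \<open>The mean waiting time. The absolute value makes \<open>C * \<bar>t\<bar>\<close>
  dominate \<open>trunc\<close> for every real \<open>t\<close>; the law charges positive times
  only.\<close>

definition m1 :: real where "m1 = (\<integral>t. \<bar>t\<bar> \<partial>\<mu>)"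

lemma \<mu>_abs_integrable: "integrable \<mu> (\<lambda>t. \<bar>t\<bar>)"
  using \<tau>_mean \<tau>_measurable[of 1] by (subst law[of 1, symmetric], simp, subst integrable_distr_eq) auto

lemma \<mu>_pos: "AE t in \<mu>. t > 0"
  using \<tau>_measurable[of 1] \<tau>_pos[of 1] by (subst law[of 1, symmetric], simp, subst AE_distr_iff) auto

lemma m1_pos: "m1 > 0"
proof -
  have "\<not> (AE t in \<mu>. t = 0)"
  proof
    assume "AE t in \<mu>. t = 0"
    with \<mu>_pos have "AE t in \<mu>. False" by eventually_elim auto
    then show False by simp
  qed
  then have "m1 \<noteq> 0"
    unfolding m1_def using \<mu>_abs_integrable by (subst integral_nonneg_eq_0_iff_AE) auto
  moreover have "m1 \<ge> 0" unfolding m1_def by (intro integral_nonneg_AE) auto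
  ultimately show ?thesis by simp
qed

context
  fixes f :: "'n cmat \<Rightarrow> real" and C :: real
  assumes f_meas [measurable]: "f \<in> borel_measurable borel" and f_bd: "\<And>x. 0 \<le> f x \<and> f x \<le> C"
begin

lemma Ico_finite: "emeasure lborel {0..<t::real} < \<top>"
  by (cases "0 \<le> t") auto

lemma C_nonneg: "C \<ge> 0" using f_bd order_trans by blast

lemma cyc_integrable: "integrable lborel (\<lambda>s. indicator {0..<t} s * f (ev j s ** x))"
proof (rule Bochner_Integration.integrable_bound[of _ "\<lambda>s. C * indicator {0..<t} s"])
  show "integrable lborel (\<lambda>s. C * indicator {0..<t} s :: real)"
    by (intro integrable_mult_right integrable_real_indicator) (auto simp: Ico_finite)
  show "AE s in lborel. norm (indicator {0..<t} s * f (ev j s ** x)) \<le> norm (C * indicator {0..<t} s)"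
    using f_bd C_nonneg by (intro AE_I2) (auto simp: indicator_def)
qed measurable

lemma cyc_measurable [measurable]: "(\<lambda>z. cyc f j (fst z) (snd z)) \<in> borel_measurable (borel \<Otimes>\<^sub>M borel)"
proof -
  have "case_prod (\<lambda>z s. (if 0 \<le> s \<and> s < fst z then 1 else 0) * f (ev j s ** snd z))
      \<in> borel_measurable ((borel \<Otimes>\<^sub>M borel) \<Otimes>\<^sub>M lborel)"
    by measurable
  from lborel.borel_measurable_lebesgue_integral[OF this]
  show ?thesis by (simp add: cyc_def indicator_def of_bool_def)
qed

lemma cyc_bounds: "0 \<le> cyc f j t x" "cyc f j t x \<le> C * max 0 t"
proof -
  show "0 \<le> cyc f j t x" unfolding cyc_def using f_bd by (intro integral_nonneg_AE AE_I2) auto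
  have "cyc f j t x \<le> (\<integral>s. C * indicator {0..<t} s \<partial>lborel)"
    unfolding cyc_def
  proof (rule integral_mono[OF cyc_integrable])
    show "integrable lborel (\<lambda>s. C * indicator {0..<t} s :: real)"
      by (intro integrable_mult_right integrable_real_indicator) (auto simp: Ico_finite)
  qed (use f_bd in \<open>auto simp: indicator_def\<close>)
  also have "\<dots> = C * max 0 t" by (simp add: max_def)
  finally show "cyc f j t x \<le> C * max 0 t" .
qed

lemma trunc_measurable [measurable]: "(\<lambda>z. trunc f j (fst z) (snd z)) \<in> borel_measurable (borel \<Otimes>\<^sub>M borel)"
  unfolding trunc_def by measurable

lemma trunc_bounds: "0 \<le> trunc f j t x" "trunc f j t x \<le> C * real j" "trunc f j t x \<le> C * \<bar>t\<bar>"
proof -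
  show "0 \<le> trunc f j t x" by (simp add: trunc_def cyc_bounds)
  have "C * max 0 t \<le> C * \<bar>t\<bar>" using C_nonneg by (intro mult_left_mono) auto
  then show "trunc f j t x \<le> C * \<bar>t\<bar>"
    using cyc_bounds(2)[of j t x] C_nonneg by (auto simp: trunc_def)
  have "C * max 0 t \<le> C * real j" if "t \<le> real j" using C_nonneg that by (intro mult_left_mono) auto
  then show "trunc f j t x \<le> C * real j"
    using cyc_bounds(2)[of j t x] C_nonneg by (force simp: trunc_def)
qed

lemma trunc_integrable: "integrable \<mu> (\<lambda>t. trunc f j t x)"
proof (rule mu.integrable_const_bound[of _ "C * real j"])
  have "(\<lambda>t. (t, x)) \<in> \<mu> \<rightarrow>\<^sub>M borel \<Otimes>\<^sub>M borel" by measurable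
  from measurable_compose[OF this trunc_measurable[of j]] show "(\<lambda>t. trunc f j t x) \<in> borel_measurable \<mu>" by simp
qed (simp add: trunc_bounds)

lemma tbar_bounds: "0 \<le> tbar f j x" "tbar f j x \<le> C * real j" "tbar f j x \<le> C * m1"
proof -
  show "0 \<le> tbar f j x" unfolding tbar_def by (intro integral_nonneg_AE AE_I2 trunc_bounds)
  have "tbar f j x \<le> (\<integral>t. C * real j \<partial>\<mu>)"
    unfolding tbar_def by (intro integral_mono trunc_integrable trunc_bounds) auto
  then show "tbar f j x \<le> C * real j" by (simp add: mu.prob_space[unfolded space_\<mu>])
  have "tbar f j x \<le> (\<integral>t. C * \<bar>t\<bar> \<partial>\<mu>)"
    unfolding tbar_def using \<mu>_abs_integrable by (intro integral_mono trunc_integrable trunc_bounds) auto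
  then show "tbar f j x \<le> C * m1" by (simp add: m1_def)
qed

lemma tbar_bm: "bm (C * real j) (tbar f j)"
proof -
  have "(\<lambda>z. (snd z, fst z)) \<in> borel \<Otimes>\<^sub>M \<mu> \<rightarrow>\<^sub>M borel \<Otimes>\<^sub>M borel" by measurable
  from measurable_compose[OF this trunc_measurable[of j]]
  have "case_prod (\<lambda>x t. trunc f j t x) \<in> borel_measurable (borel \<Otimes>\<^sub>M \<mu>)"
    by (simp add: case_prod_unfold)
  from mu.borel_measurable_lebesgue_integral[OF this] have "tbar f j \<in> borel_measurable borel"
    by (simp add: tbar_def[abs_def])
  then show ?thesis using tbar_bounds by (simp add: bm_def)
qed

text \<open>This bound is uniform in \<open>j\<close>, unlike the bound in \<open>tbar_bm\<close>;
  the covariance estimates become independent of the truncation level through it.\<close>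

lemma tbar_osc: "osc (tbar f j) (C * m1)"
  unfolding osc_def using tbar_bounds by (smt (verit, best))

text \<open>Started from \<open>\<pi>\<close>, the evolving point has law \<open>\<pi>\<close> at
  each time of the cycle. Fubini thus separates the mean of \<open>f\<close> from the truncated mean
  length.\<close>

lemma haar_tbar:
  assumes \<pi>: "is_haar \<pi>"
  shows "(\<integral>x. tbar f j x \<partial>\<pi>) = (\<integral>x. f x \<partial>\<pi>) * (\<integral>t. (if t \<le> real j then max 0 t else 0) \<partial>\<mu>)"
proof -
  interpret pi: prob_space \<pi> using \<pi> by (simp add: is_haar_def)
  interpret pp: pair_prob_space \<pi> \<mu> ..
  have id: "(\<lambda>x. x) \<in> borel_measurable \<pi>" by (rule haar_borel[OF \<pi>]) simp
  have [measurable]: "(\<lambda>z. fst z) \<in> borel_measurable (\<pi> \<Otimes>\<^sub>M N)" for N :: "real measure"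
    by (rule measurable_compose[OF measurable_fst id])
  have fi: "integrable \<pi> f"
    using f_bd by (intro pi.integrable_const_bound[of _ C] haar_borel[OF \<pi>]) auto
  have "(\<lambda>z. (snd z, fst z)) \<in> \<pi> \<Otimes>\<^sub>M \<mu> \<rightarrow>\<^sub>M borel \<Otimes>\<^sub>M borel" by measurable
  from measurable_compose[OF this trunc_measurable[of j]]
  have m: "case_prod (\<lambda>x t. trunc f j t x) \<in> borel_measurable (\<pi> \<Otimes>\<^sub>M \<mu>)"
    by (simp add: case_prod_unfold)
  have "integrable (\<pi> \<Otimes>\<^sub>M \<mu>) (case_prod (\<lambda>x t. trunc f j t x))"
    by (rule pp.P.integrable_const_bound[of _ "C * real j"]) (use m trunc_bounds in auto)
  from pp.Fubini_integral[OF this]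
  have "(\<integral>x. tbar f j x \<partial>\<pi>) = (\<integral>t. (\<integral>x. trunc f j t x \<partial>\<pi>) \<partial>\<mu>)"
    by (simp add: tbar_def)
  also have "\<dots> = (\<integral>t. (\<integral>x. f x \<partial>\<pi>) * (if t \<le> real j then max 0 t else 0) \<partial>\<mu>)"
  proof (rule Bochner_Integration.integral_cong)
    fix t
    have "(\<integral>x. cyc f j t x \<partial>\<pi>) = (\<integral>x. f x \<partial>\<pi>) * max 0 t"
    proof -
      interpret q: pair_sigma_finite \<pi> lborel ..
      have m': "case_prod (\<lambda>x s. indicator {0..<t} s * f (ev j s ** x)) \<in> borel_measurable (\<pi> \<Otimes>\<^sub>M lborel)"
        by measurable
      have "integrable (\<pi> \<Otimes>\<^sub>M lborel) (case_prod (\<lambda>x s. indicator {0..<t} s * f (ev j s ** x)))"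
      proof (rule q.Fubini_integrable[OF m'])
        have "(\<lambda>x. \<integral>s. norm (case (x, s) of (x, s) \<Rightarrow> indicator {0..<t} s * f (ev j s ** x)) \<partial>lborel) = (\<lambda>x. cyc f j t x)"
          using f_bd by (simp add: cyc_def abs_mult)
        moreover have "integrable \<pi> (\<lambda>x. cyc f j t x)"
        proof (rule pi.integrable_const_bound[of _ "C * max 0 t"])
          have "(\<lambda>x. (t, x)) \<in> \<pi> \<rightarrow>\<^sub>M borel \<Otimes>\<^sub>M borel" using id by (intro measurable_Pair) auto
          from measurable_compose[OF this cyc_measurable[of j]] show "(\<lambda>x. cyc f j t x) \<in> borel_measurable \<pi>" by simp
        qed (simp add: cyc_bounds)
        ultimately show "integrable \<pi> (\<lambda>x. \<integral>s. norm (case (x, s) of (x, s) \<Rightarrow> indicator {0..<t} s * f (ev j s ** x)) \<partial>lborel)"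
          by simp
        show "AE x in \<pi>. integrable lborel (\<lambda>s. case (x, s) of (x, s) \<Rightarrow> indicator {0..<t} s * f (ev j s ** x))"
          using cyc_integrable by simp
      qed
      from q.Fubini_integral[OF this]
      have "(\<integral>x. cyc f j t x \<partial>\<pi>) = (\<integral>s. (\<integral>x. indicator {0..<t} s * f (ev j s ** x) \<partial>\<pi>) \<partial>lborel)"
        by (simp add: cyc_def)
      also have "\<dots> = (\<integral>s. (\<integral>x. f x \<partial>\<pi>) * indicator {0..<t} s \<partial>lborel)"
        by (intro Bochner_Integration.integral_cong) (simp_all add: haar_shift[OF \<pi>] mult.commute)
      also have "\<dots> = (\<integral>x. f x \<partial>\<pi>) * max 0 t" by (simp add: max_def)
      finally show ?thesis .
    qed
    then show "(\<integral>x. trunc f j t x \<partial>\<pi>) = (\<integral>x. f x \<partial>\<pi>) * (if t \<le> real j then max 0 t else 0)"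
      by (simp add: trunc_def)
  qed simp
  finally show ?thesis by simp
qed

lemma truncated_mean_limit: "(\<lambda>j. \<integral>t. (if t \<le> real j then max 0 t else 0) \<partial>\<mu>) \<longlonglongrightarrow> m1"
proof -
  have "(\<lambda>j. \<integral>t. (if t \<le> real j then max 0 t else 0) \<partial>\<mu>) \<longlonglongrightarrow> (\<integral>t. max 0 t \<partial>\<mu>)"
  proof (rule integral_dominated_convergence[where w="\<lambda>t. \<bar>t\<bar>"])
    show "AE t in \<mu>. (\<lambda>j. if t \<le> real j then max 0 t else 0) \<longlonglongrightarrow> max 0 t"
    proof (intro AE_I2 tendsto_eventually)
      fix t :: real
      obtain N :: nat where "t \<le> real N" using real_arch_simple by blast
      then show "eventually (\<lambda>j. (if t \<le> real j then max 0 t else 0) = max 0 t) sequentially"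
        by (intro eventually_sequentiallyI[of N]) auto
    qed
  qed (auto simp: \<mu>_abs_integrable)
  also have "(\<integral>t. max 0 t \<partial>\<mu>) = m1"
    unfolding m1_def using \<mu>_pos by (intro integral_cong_AE) (auto elim!: eventually_mono)
  finally show ?thesis .
qed

end

end

section \<open>Renewal averages\<close>

text \<open>\<open>F T / T\<close> lies between \<open>S n / t (Suc n)\<close> and
  \<open>S (Suc n) / t n\<close> when \<open>T\<close> is in the cycle after \<open>t n\<close>, and
  both quotients tend to \<open>\<rho>\<close>.\<close>

lemma renewal_limit:
  fixes t S :: "nat \<Rightarrow> real" and F :: "real \<Rightarrow> real"
  assumes t0: "t 0 = 0" and t: "strict_mono t" and m: "m > 0"
    and tl: "(\<lambda>n. t n / real n) \<longlonglongrightarrow> m" and Sl: "(\<lambda>n. S n / real n) \<longlonglongrightarrow> \<rho> * m"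
    and S0: "\<And>n. S n \<ge> 0"
    and F: "\<And>n T. t n \<le> T \<Longrightarrow> T < t (Suc n) \<Longrightarrow> S n \<le> F T \<and> F T \<le> S (Suc n)"
  shows "((\<lambda>T. F T / T) \<longlongrightarrow> \<rho>) at_top"
proof -
  have t_inf: "filterlim t at_top sequentially"
  proof -
    have "filterlim (\<lambda>n. t n / real n * real n) at_top sequentially"
      using tl m filterlim_real_sequentially by (rule filterlim_tendsto_pos_mult_at_top)
    moreover have "t n / real n * real n = t n" for n using t0 by (cases "n = 0") auto
    ultimately show ?thesis by simp
  qed
  define N where "N T = (LEAST n. T < t n) - 1" for T
  have N: "t (N T) \<le> T" "T < t (Suc (N T))" if T: "T \<ge> 0" for T
  proof -
    have "eventually (\<lambda>n. t n \<ge> T + 1) sequentially" using t_inf by (simp add: filterlim_at_top)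
    then obtain n where "t n \<ge> T + 1" by (auto simp: eventually_sequentially)
    then have "\<exists>n. T < t n" by (intro exI[of _ n]) simp
    then have L: "T < t (LEAST n. T < t n)" by (rule LeastI_ex)
    then have "(LEAST n. T < t n) \<noteq> 0" using T t0 by (intro notI) simp
    then have e: "Suc (N T) = (LEAST n. T < t n)" by (simp add: N_def)
    then show "T < t (Suc (N T))" using L by simp
    have "N T < (LEAST n. T < t n)" using e by simp
    then show "t (N T) \<le> T" using not_less_Least by fastforce
  qed
  have N_inf: "filterlim N at_top at_top"
    unfolding filterlim_at_top
  proof
    fix k
    show "eventually (\<lambda>T. k \<le> N T) at_top"
    proof (rule eventually_at_top_linorderI[of "max 0 (t k)"])
      fix T assume T: "max 0 (t k) \<le> T"
      then have "t k < t (Suc (N T))" using N(2)[of T] by simp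
      then show "k \<le> N T" using t by (simp add: strict_mono_less)
    qed
  qed
  have tpos: "t n > 0" if "n \<ge> 1" for n using t t0 that by (metis strict_mono_less less_eq_Suc_le One_nat_def)
  \<comment> \<open>A product of convergent quotients; the index shift costs the factor
    \<open>n / (n + 1)\<close>.\<close>
  have "(\<lambda>n. (S n / real n) / (t (Suc n) / real (Suc n)) * (real n / real (Suc n))) \<longlonglongrightarrow> \<rho> * m / m * 1"
    by (intro tendsto_mult tendsto_divide Sl LIMSEQ_Suc[OF tl] LIMSEQ_n_over_Suc_n) (use m in auto)
  moreover have "eventually (\<lambda>n. (S n / real n) / (t (Suc n) / real (Suc n)) * (real n / real (Suc n)) = S n / t (Suc n)) sequentially"
    by (intro eventually_sequentiallyI[of 1]) (simp add: field_simps del: of_nat_Suc)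
  ultimately have a: "(\<lambda>n. S n / t (Suc n)) \<longlonglongrightarrow> \<rho>" using m by (simp add: Lim_transform_eventually)
  have "(\<lambda>n. (S (Suc n) / real (Suc n)) / (t n / real n) * (real (Suc n) / real n)) \<longlonglongrightarrow> \<rho> * m / m * 1"
    by (intro tendsto_mult tendsto_divide LIMSEQ_Suc[OF Sl] tl LIMSEQ_Suc_n_over_n) (use m in auto)
  moreover have "eventually (\<lambda>n. (S (Suc n) / real (Suc n)) / (t n / real n) * (real (Suc n) / real n) = S (Suc n) / t n) sequentially"
    by (intro eventually_sequentiallyI[of 1]) (simp add: field_simps del: of_nat_Suc)
  ultimately have b: "(\<lambda>n. S (Suc n) / t n) \<longlonglongrightarrow> \<rho>" using m by (simp add: Lim_transform_eventually)
  show ?thesis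
  proof (rule tendsto_sandwich)
    show "((\<lambda>T. S (N T) / t (Suc (N T))) \<longlongrightarrow> \<rho>) at_top" by (rule filterlim_compose[OF a N_inf])
    show "((\<lambda>T. S (Suc (N T)) / t (N T)) \<longlongrightarrow> \<rho>) at_top" by (rule filterlim_compose[OF b N_inf])
    have ev: "eventually (\<lambda>T. T \<ge> t 1) at_top" by (rule eventually_ge_at_top)
    show "eventually (\<lambda>T. S (N T) / t (Suc (N T)) \<le> F T / T) at_top"
      using ev
    proof eventually_elim
      case (elim T)
      then have T: "T > 0" using tpos[of 1] by simp
      have "S (N T) \<le> F T" using F[OF N(1)[of T] N(2)[of T]] T by simp
      then show ?case using N(2)[of T] T S0[of "N T"] by (intro frac_le) linarith+
    qed
    show "eventually (\<lambda>T. F T / T \<le> S (Suc (N T)) / t (N T)) at_top"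
      using ev
    proof eventually_elim
      case (elim T)
      then have T: "T > 0" using tpos[of 1] by simp
      have "t 1 < t (Suc (N T))" using elim N(2)[of T] T by simp
      then have "N T \<ge> 1" using t by (simp add: strict_mono_less)
      then have "t (N T) > 0" by (rule tpos)
      moreover have "F T \<le> S (Suc (N T))" using F[OF N(1)[of T] N(2)[of T]] T by simp
      ultimately show ?case using N(1)[of T] T S0[of "Suc (N T)"] by (intro frac_le) linarith+
    qed
  qed
qed

section \<open>Means and covariances of the truncated cycle integrals\<close>

context jump_process begin

context
  fixes f :: "'n cmat \<Rightarrow> real" and C :: real
  assumes f_meas [measurable]: "f \<in> borel_measurable borel" and f_bd: "\<And>x. 0 \<le> f x \<and> f x \<le> C"
begin

lemma Y_measurable: "i \<ge> 1 \<Longrightarrow> Y f i \<in> borel_measurable M"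
proof -
  assume "i \<ge> 1"
  then have "(\<lambda>\<omega>. (\<tau> i \<omega>, X (i - 1) \<omega>)) \<in> M \<rightarrow>\<^sub>M borel \<Otimes>\<^sub>M borel"
    using \<tau>_measurable by (intro measurable_Pair X_measurable)
  from measurable_compose[OF this cyc_measurable[OF f_meas f_bd]] show ?thesis
    by (simp add: Y_def[abs_def])
qed

lemma Y_bounds:
  assumes "i \<ge> 1" "\<omega> \<in> space M"
  shows "0 \<le> Y f i \<omega> \<and> Y f i \<omega> \<le> C * \<tau> i \<omega>"
  using cyc_bounds[OF f_meas f_bd, of i "\<tau> i \<omega>"] \<tau>_pos[OF assms] by (simp add: Y_def max_def split: if_splits)

lemma trunc_Y: "(if \<tau> i \<omega> \<le> real i then Y f i \<omega> else 0) = trunc f i (\<tau> i \<omega>) (X (i - 1) \<omega>)"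
  by (simp add: trunc_def Y_def)

text \<open>Integrating out the new time, which is independent of the history, replaces the
  truncated cycle integral by its conditional mean.\<close>

lemma expectation_trunc:
  assumes \<psi>: "\<psi> \<in> borel_measurable (Pb n)" and B: "\<And>w. \<bar>\<psi> w\<bar> \<le> B"
  shows "(\<integral>\<omega>. \<psi> (W n \<omega>) * trunc f (Suc n) (\<tau> (Suc n) \<omega>) (X n \<omega>) \<partial>M) = (\<integral>\<omega>. \<psi> (W n \<omega>) * tbar f (Suc n) (X n \<omega>) \<partial>M)"
proof -
  define H where "H z = \<psi> (fst z) * trunc f (Suc n) (snd z) (J (fst z) n)" for z
  have [measurable]: "(\<lambda>z. \<psi> (fst z)) \<in> borel_measurable (Pb n \<Otimes>\<^sub>M (borel :: real measure))"
    by (rule measurable_compose[OF measurable_fst \<psi>])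
  have m: "(\<lambda>z. J (fst z) n) \<in> borel_measurable (Pb n \<Otimes>\<^sub>M (borel :: real measure))"
    by (rule measurable_compose[OF measurable_fst J_measurable_Pb[OF order_refl]])
  have "(\<lambda>z. (snd z, J (fst z) n)) \<in> Pb n \<Otimes>\<^sub>M (borel :: real measure) \<rightarrow>\<^sub>M borel \<Otimes>\<^sub>M borel"
    by (intro measurable_Pair measurable_snd m)
  from measurable_compose[OF this trunc_measurable[OF f_meas f_bd, of "Suc n"]]
  have [measurable]: "(\<lambda>z. trunc f (Suc n) (snd z) (J (fst z) n)) \<in> borel_measurable (Pb n \<Otimes>\<^sub>M borel)" by simp
  have H: "H \<in> borel_measurable (Pb n \<Otimes>\<^sub>M borel)" unfolding H_def by measurable
  have HB: "\<bar>H z\<bar> \<le> B * (C * real (Suc n))" for z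
    unfolding H_def abs_mult using B trunc_bounds[OF f_meas f_bd, of "Suc n"]
    by (intro mult_mono) (auto intro: order_trans[OF abs_ge_zero B])
  show ?thesis
    using markov_step[OF H HB] by (simp add: H_def J_W tbar_def)
qed

lemma expectation_trunc_1:
  "(\<integral>\<omega>. trunc f (Suc n) (\<tau> (Suc n) \<omega>) (X n \<omega>) \<partial>M) = (\<integral>\<omega>. tbar f (Suc n) (X n \<omega>) \<partial>M)"
  using expectation_trunc[of "\<lambda>_. 1" n 1] by simp

context
  fixes c q :: real and \<pi> :: "'n cmat measure"
  assumes c: "c > 0" and q: "0 < q" "q < 1" and \<pi>: "is_haar \<pi>"
    and geo: "\<forall>a n B \<phi> r. bm B \<phi> \<longrightarrow> osc \<phi> r \<longrightarrow> osc (T a n \<phi>) (c * q ^ n * r)"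
begin

text \<open>Given the history up to cycle \<open>i\<close>, the mean of the \<open>j\<close>-th
  truncated integral is a function \<open>g\<close> of \<open>X i\<close>. The transition operators
  have flattened \<open>g\<close> to an oscillation of order \<open>q ^ (j - i)\<close>, so it is
  nearly constant, and the other factor has mean at most \<open>C * m1\<close>.\<close>

lemma trunc_covariance:
  assumes ij: "1 \<le> i" "i < j"
  shows "\<bar>(\<integral>\<omega>. trunc f i (\<tau> i \<omega>) (X (i - 1) \<omega>) * trunc f j (\<tau> j \<omega>) (X (j - 1) \<omega>) \<partial>M)
      - (\<integral>\<omega>. trunc f i (\<tau> i \<omega>) (X (i - 1) \<omega>) \<partial>M) * (\<integral>\<omega>. trunc f j (\<tau> j \<omega>) (X (j - 1) \<omega>) \<partial>M)\<bar>
      \<le> (C * m1) * (c * (C * m1) / q) * q ^ (j - i)"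
proof -
  obtain k where j: "j = Suc (i + k)" using ij(2) less_iff_Suc_add by auto
  define g where "g = T i k (tbar f j)"
  define r where "r = c * q ^ k * (C * m1)"
  have gb: "bm (C * real j) g" unfolding g_def by (rule T_bm[OF tbar_bm[OF f_meas f_bd]])
  have go: "osc g r" unfolding g_def r_def by (rule geo[rule_format, OF tbar_bm[OF f_meas f_bd] tbar_osc[OF f_meas f_bd]])
  define \<psi> where "\<psi> w = trunc f i (w i) (J w (i - 1))" for w
  have \<psi>W: "\<psi> (W i \<omega>) = trunc f i (\<tau> i \<omega>) (X (i - 1) \<omega>)" for \<omega>
    using ij(1) by (simp add: \<psi>_def J_W) (simp add: W_def)
  have "(\<lambda>w. (w i, J w (i - 1))) \<in> Pb i \<rightarrow>\<^sub>M borel \<Otimes>\<^sub>M borel"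
    using ij(1) by (intro measurable_Pair J_measurable_Pb measurable_component_singleton) auto
  from measurable_compose[OF this trunc_measurable[OF f_meas f_bd, of i]]
  have \<psi>m: "\<psi> \<in> borel_measurable (Pb i)" by (simp add: \<psi>_def[abs_def])
  have \<psi>B: "\<bar>\<psi> w\<bar> \<le> C * real i" for w using trunc_bounds[OF f_meas f_bd, of i] by (simp add: \<psi>_def)
  have "(\<lambda>w. restrict w {1..i}) \<in> Pb (i + k) \<rightarrow>\<^sub>M Pb i" by (rule measurable_restrict_subset) auto
  from measurable_compose[OF this \<psi>m] have \<psi>m': "(\<lambda>w. \<psi> (restrict w {1..i})) \<in> borel_measurable (Pb (i + k))" .
  have res: "restrict (W (i + k) \<omega>) {1..i} = W i \<omega>" for \<omega> by (auto simp: W_def restrict_def fun_eq_iff)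
  let ?Z = "\<lambda>\<omega>. \<psi> (W i \<omega>)"
  have Zm: "?Z \<in> borel_measurable M" by (rule measurable_compose[OF W_measurable \<psi>m])
  have Z0: "0 \<le> ?Z \<omega>" for \<omega> using trunc_bounds[OF f_meas f_bd, of i] by (simp add: \<psi>_def)
  have Zi: "integrable M ?Z" by (rule M.integrable_const_bound[of _ "C * real i"]) (use \<psi>B Zm in auto)
  have gm: "(\<lambda>\<omega>. g (X i \<omega>)) \<in> borel_measurable M" by (rule measurable_compose[OF X_measurable bm_measurable[OF gb]])
  have gi: "integrable M (\<lambda>\<omega>. g (X i \<omega>))"
    by (rule bm_integrable[OF gb M.prob_space_axioms X_measurable])
  have Zgi: "integrable M (\<lambda>\<omega>. ?Z \<omega> * g (X i \<omega>))"
    by (rule M.integrable_const_bound[of _ "(C * real i) * (C * real j)"])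
      (use \<psi>B gb Zm gm in \<open>auto simp: abs_mult bm_def intro!: mult_mono order_trans[OF abs_ge_zero \<psi>B]\<close>)
  define \<gamma> where "\<gamma> = (\<integral>\<omega>. g (X i \<omega>) \<partial>M)"
  have EZj: "(\<integral>\<omega>. trunc f j (\<tau> j \<omega>) (X (j - 1) \<omega>) \<partial>M) = \<gamma>"
    using expectation_trunc_1[of "i + k"] markov_T[of "\<lambda>_. 1" i 1 _ "tbar f j" k, OF _ _ tbar_bm[OF f_meas f_bd]]
    by (simp add: j \<gamma>_def g_def)
  have EZZ: "(\<integral>\<omega>. ?Z \<omega> * trunc f j (\<tau> j \<omega>) (X (j - 1) \<omega>) \<partial>M) = (\<integral>\<omega>. ?Z \<omega> * g (X i \<omega>) \<partial>M)"
    using expectation_trunc[OF \<psi>m' \<psi>B] markov_T[OF \<psi>m \<psi>B tbar_bm[OF f_meas f_bd, of j], of k]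
    unfolding res by (simp add: j g_def)
  have near: "\<bar>g (X i \<omega>) - \<gamma>\<bar> \<le> r" for \<omega>
  proof -
    have "\<gamma> \<le> (\<integral>\<omega>'. g (X i \<omega>) + r \<partial>M)" "(\<integral>\<omega>'. g (X i \<omega>) - r \<partial>M) \<le> \<gamma>"
      unfolding \<gamma>_def
      using oscD[OF go X_unitary[of i _] X_unitary[of i \<omega>]] oscD[OF go X_unitary[of i \<omega>] X_unitary[of i _]] gi
      by (intro integral_mono; simp add: algebra_simps)+
    then show ?thesis by (simp add: M.prob_space)
  qed
  have "\<bar>(\<integral>\<omega>. ?Z \<omega> * g (X i \<omega>) \<partial>M) - (\<integral>\<omega>. ?Z \<omega> \<partial>M) * \<gamma>\<bar> = \<bar>\<integral>\<omega>. ?Z \<omega> * (g (X i \<omega>) - \<gamma>) \<partial>M\<bar>"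
    using Zi Zgi by (simp add: right_diff_distrib)
  also have "\<dots> \<le> (\<integral>\<omega>. \<bar>?Z \<omega> * (g (X i \<omega>) - \<gamma>)\<bar> \<partial>M)"
    by (rule integral_abs_bound)
  also have "\<dots> \<le> (\<integral>\<omega>. ?Z \<omega> * r \<partial>M)"
  proof (rule integral_mono)
    show "integrable M (\<lambda>\<omega>. \<bar>?Z \<omega> * (g (X i \<omega>) - \<gamma>)\<bar>)" using Zi Zgi by (simp add: right_diff_distrib)
    show "integrable M (\<lambda>\<omega>. ?Z \<omega> * r)" using Zi by simp
    fix \<omega> show "\<bar>?Z \<omega> * (g (X i \<omega>) - \<gamma>)\<bar> \<le> ?Z \<omega> * r"
      using Z0[of \<omega>] near[of \<omega>] by (simp add: abs_mult mult_left_mono)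
  qed
  also have "\<dots> = (\<integral>\<omega>. ?Z \<omega> \<partial>M) * r" by simp
  also have "\<dots> \<le> (C * m1) * r"
  proof (rule mult_right_mono)
    have "(\<integral>\<omega>. ?Z \<omega> \<partial>M) = (\<integral>\<omega>. tbar f i (X (i - 1) \<omega>) \<partial>M)"
      using expectation_trunc_1[of "i - 1"] ij(1) by (simp add: \<psi>W)
    also have "\<dots> \<le> (\<integral>\<omega>. C * m1 \<partial>M)"
      by (intro integral_mono bm_integrable[OF tbar_bm[OF f_meas f_bd] M.prob_space_axioms X_measurable] tbar_bounds[OF f_meas f_bd]) auto
    finally show "(\<integral>\<omega>. ?Z \<omega> \<partial>M) \<le> C * m1" by (simp add: M.prob_space)
    show "0 \<le> r" using osc_nonneg[OF go] .
  qed
  \<comment> \<open>Only \<open>j - i - 1\<close> transition steps separate the two cycles, whence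
    the division by \<open>q\<close>.\<close>
  also have "\<dots> = (C * m1) * (c * (C * m1) / q) * q ^ (j - i)"
    using q by (simp add: r_def j)
  finally show ?thesis by (simp only: EZj EZZ \<psi>W[symmetric])
qed

text \<open>Both the distance of the law of \<open>X n\<close> from \<open>\<pi>\<close>, seen
  through \<open>tbar\<close>, and the effect of truncation on the mean length vanish in the
  limit.\<close>

lemma trunc_mean_limit:
  "(\<lambda>i. \<integral>\<omega>. trunc f i (\<tau> i \<omega>) (X (i - 1) \<omega>) \<partial>M) \<longlonglongrightarrow> (\<integral>x. f x \<partial>\<pi>) * m1"
proof -
  let ?e = "\<lambda>i. \<integral>\<omega>. trunc f i (\<tau> i \<omega>) (X (i - 1) \<omega>) \<partial>M"
  let ?a = "\<lambda>i. (\<integral>x. f x \<partial>\<pi>) * (\<integral>t. (if t \<le> real i then max 0 t else 0) \<partial>\<mu>)"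
  have "(\<lambda>n. ?e (Suc n) - ?a (Suc n)) \<longlonglongrightarrow> 0"
  proof (rule Lim_null_comparison)
    show "(\<lambda>n. c * q ^ n * (C * m1)) \<longlonglongrightarrow> 0"
      using q by (intro tendsto_mult_left_zero tendsto_mult_right_zero LIMSEQ_realpow_zero) auto
    show "eventually (\<lambda>n. norm (?e (Suc n) - ?a (Suc n)) \<le> c * q ^ n * (C * m1)) sequentially"
    proof (intro always_eventually allI)
      fix n
      have "?e (Suc n) = T 0 n (tbar f (Suc n)) (mat 1)"
        using expectation_trunc_1[of n] expectation_X[OF tbar_bm[OF f_meas f_bd], of "Suc n" n] by simp
      moreover have "osc (T 0 n (tbar f (Suc n))) (c * q ^ n * (C * m1))"
        by (rule geo[rule_format, OF tbar_bm[OF f_meas f_bd] tbar_osc[OF f_meas f_bd]])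
      ultimately show "norm (?e (Suc n) - ?a (Suc n)) \<le> c * q ^ n * (C * m1)"
        using T_haar[OF \<pi> tbar_bm[OF f_meas f_bd] _ unitary_one, of 0 n "Suc n"]
        by (simp add: haar_tbar[OF f_meas f_bd \<pi>])
    qed
  qed
  moreover have "(\<lambda>n. ?a (Suc n)) \<longlonglongrightarrow> (\<integral>x. f x \<partial>\<pi>) * m1"
    by (intro tendsto_mult tendsto_const LIMSEQ_Suc[OF truncated_mean_limit[OF f_meas f_bd]])
  ultimately have "(\<lambda>n. (?e (Suc n) - ?a (Suc n)) + ?a (Suc n)) \<longlonglongrightarrow> 0 + (\<integral>x. f x \<partial>\<pi>) * m1"
    by (rule tendsto_add)
  then have "(\<lambda>n. ?e (Suc n)) \<longlonglongrightarrow> (\<integral>x. f x \<partial>\<pi>) * m1" by simp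
  then show ?thesis by (rule LIMSEQ_imp_Suc)
qed

lemma cycle_average: "AE \<omega> in M. (\<lambda>n. (\<Sum>i\<in>{1..n}. Y f i \<omega>) / real n) \<longlonglongrightarrow> (\<integral>x. f x \<partial>\<pi>) * m1"
proof (rule M.etemadi[where \<tau>=\<tau> and K=C and q=q and Kc="(C * m1) * (c * (C * m1) / q)"])
  show "distr M borel (\<tau> i) = distr M borel (\<tau> 1)" if "1 \<le> i" for i using law[OF that] law[of 1] by simp
  show "0 \<le> C" by (rule C_nonneg[OF f_meas f_bd])
  then show "0 \<le> C * m1 * (c * (C * m1) / q)" using m1_pos c q by simp
  show "\<bar>(\<integral>\<omega>. (if \<tau> i \<omega> \<le> real i then Y f i \<omega> else 0) * (if \<tau> j \<omega> \<le> real j then Y f j \<omega> else 0) \<partial>M)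
      - (\<integral>\<omega>. (if \<tau> i \<omega> \<le> real i then Y f i \<omega> else 0) \<partial>M) * (\<integral>\<omega>. (if \<tau> j \<omega> \<le> real j then Y f j \<omega> else 0) \<partial>M)\<bar>
      \<le> C * m1 * (c * (C * m1) / q) * q ^ (j - i)" if "1 \<le> i" "i < j" for i j
    unfolding trunc_Y by (rule trunc_covariance[OF that])
  show "(\<lambda>i. \<integral>\<omega>. (if \<tau> i \<omega> \<le> real i then Y f i \<omega> else 0) \<partial>M) \<longlonglongrightarrow> (\<integral>x. f x \<partial>\<pi>) * m1"
    unfolding trunc_Y by (rule trunc_mean_limit)
qed (use \<tau>_measurable \<tau>_mean Y_measurable Y_bounds \<tau>_pos q in \<open>auto simp: less_imp_le\<close>)

end

end

section \<open>From cycles to the continuous-time path\<close>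

lemma jump_time_Suc: "jump_time \<tau> \<omega> (Suc n) = jump_time \<tau> \<omega> n + \<tau> (Suc n) \<omega>"
  by (simp add: jump_time_def)

lemma jump_time_0: "jump_time \<tau> \<omega> 0 = 0"
  by (simp add: jump_time_def)

lemma jump_time_strict_mono: "\<omega> \<in> space M \<Longrightarrow> strict_mono (jump_time \<tau> \<omega>)"
  using \<tau>_pos by (intro strict_mono_Suc_iff[THEN iffD2]) (simp add: jump_time_Suc)

lemma Xt_cycle:
  assumes w: "\<omega> \<in> space M" and s: "jump_time \<tau> \<omega> n \<le> s" "s < jump_time \<tau> \<omega> (Suc n)"
  shows "Xt H1 H2 \<tau> s \<omega> = ev (Suc n) (s - jump_time \<tau> \<omega> n) ** X n \<omega>"
proof -
  have L: "(LEAST n. s < jump_time \<tau> \<omega> n) = Suc n"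
  proof (rule Least_equality)
    fix k assume k: "s < jump_time \<tau> \<omega> k"
    then have "jump_time \<tau> \<omega> n < jump_time \<tau> \<omega> k" using s by simp
    then show "Suc n \<le> k" using jump_time_strict_mono[OF w] by (simp add: strict_mono_less)
  qed (rule s)
  have "J (\<lambda>i. if i < Suc n then \<tau> i \<omega> else s - jump_time \<tau> \<omega> (Suc n - 1)) n = X n \<omega>"
    unfolding X_def by (rule J_cong) auto
  then show ?thesis
    unfolding Xt_def L Let_def J_def[symmetric] by simp
qed

lemma Xt_unitary: "Xt H1 H2 \<tau> s \<omega> \<in> unitary_group"
  unfolding Xt_def Let_def J_def[symmetric] by simp

context
  fixes f :: "'n cmat \<Rightarrow> real" and C :: real
  assumes f_meas: "f \<in> borel_measurable borel" and f_bd: "\<And>x. 0 \<le> f x \<and> f x \<le> C"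
begin

text \<open>Integrability and value are built up together, cycle by cycle, by translating each cycle
  to start at 0; measurability of the path in time comes out of the same induction.\<close>

lemma path_integral:
  assumes w: "\<omega> \<in> space M"
  shows "has_bochner_integral lborel (\<lambda>s. indicator {0..<jump_time \<tau> \<omega> n} s * f (Xt H1 H2 \<tau> s \<omega>)) (\<Sum>i\<in>{1..n}. Y f i \<omega>)"
proof (induction n)
  case 0
  show ?case by (simp add: jump_time_0 has_bochner_integral_zero)
next
  case (Suc n)
  let ?t = "jump_time \<tau> \<omega>"
  have le: "0 \<le> ?t n" "?t n \<le> ?t (Suc n)"
    using strict_mono_mono[OF jump_time_strict_mono[OF w]] jump_time_0[of \<omega>]
    by (metis monoD zero_le, simp add: mono_iff_le_Suc)
  define g where "g u = indicator {0..<\<tau> (Suc n) \<omega>} u * f (ev (Suc n) u ** X n \<omega>)" for u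
  have "has_bochner_integral lborel g (Y f (Suc n) \<omega>)"
    using cyc_integrable[OF f_meas f_bd] by (simp add: has_bochner_integral_iff g_def[abs_def] Y_def cyc_def)
  then have "has_bochner_integral lborel (\<lambda>s. g (- ?t n + 1 * s)) (Y f (Suc n) \<omega> /\<^sub>R \<bar>1\<bar>)"
    by (subst lborel_has_bochner_integral_real_affine_iff[symmetric]) auto
  moreover have "g (- ?t n + 1 * s) = indicator {?t n..<?t (Suc n)} s * f (Xt H1 H2 \<tau> s \<omega>)" for s
    using Xt_cycle[OF w, of n s] by (auto simp: g_def indicator_def jump_time_Suc)
  ultimately have "has_bochner_integral lborel (\<lambda>s. indicator {?t n..<?t (Suc n)} s * f (Xt H1 H2 \<tau> s \<omega>)) (Y f (Suc n) \<omega>)"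
    by simp
  from has_bochner_integral_add[OF Suc.IH this]
  show ?case
    by (rule has_bochner_integral_cong[THEN iffD1, rotated -1])
      (use le in \<open>auto simp: indicator_def\<close>)
qed

definition path_avg :: "'w \<Rightarrow> real \<Rightarrow> real" where
  "path_avg \<omega> u = (\<integral>s. indicator {0..<u} s * f (Xt H1 H2 \<tau> s \<omega>) \<partial>lborel)"

lemma path_integrable:
  assumes w: "\<omega> \<in> space M" and T: "u < jump_time \<tau> \<omega> n"
  shows "integrable lborel (\<lambda>s. indicator {0..<u} s * f (Xt H1 H2 \<tau> s \<omega>))"
proof -
  have i: "integrable lborel (\<lambda>s. indicator {0..<jump_time \<tau> \<omega> n} s * f (Xt H1 H2 \<tau> s \<omega>))"
    using path_integral[OF w] by (simp add: has_bochner_integral_iff)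
  have e: "indicator {0..<u} s * (indicator {0..<jump_time \<tau> \<omega> n} s * f (Xt H1 H2 \<tau> s \<omega>)) = indicator {0..<u} s * f (Xt H1 H2 \<tau> s \<omega>)" for s
    using T by (auto simp: indicator_def)
  have "integrable lborel (\<lambda>s. indicator {0..<u} s * (indicator {0..<jump_time \<tau> \<omega> n} s * f (Xt H1 H2 \<tau> s \<omega>)))"
    by (rule Bochner_Integration.integrable_bound[OF i]) (use i in \<open>auto simp: indicator_def\<close>)
  then show ?thesis by (simp only: e)
qed

text \<open>Since \<open>f\<close> is nonnegative, the integral up to a time inside a cycle lies
  between the sums of completed cycles before and after it.\<close>

lemma path_avg_sandwich:
  assumes w: "\<omega> \<in> space M" and T: "jump_time \<tau> \<omega> n \<le> u" "u < jump_time \<tau> \<omega> (Suc n)"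
  shows "(\<Sum>i\<in>{1..n}. Y f i \<omega>) \<le> path_avg \<omega> u \<and> path_avg \<omega> u \<le> (\<Sum>i\<in>{1..Suc n}. Y f i \<omega>)"
proof -
  have i: "integrable lborel (\<lambda>s. indicator {0..<jump_time \<tau> \<omega> k} s * f (Xt H1 H2 \<tau> s \<omega>))"
    "(\<integral>s. indicator {0..<jump_time \<tau> \<omega> k} s * f (Xt H1 H2 \<tau> s \<omega>) \<partial>lborel) = (\<Sum>i\<in>{1..k}. Y f i \<omega>)" for k
    using path_integral[OF w] by (simp_all add: has_bochner_integral_iff)
  have "(\<Sum>i\<in>{1..n}. Y f i \<omega>) \<le> path_avg \<omega> u"
    unfolding i(2)[symmetric] path_avg_def
    using T f_bd by (intro integral_mono i path_integrable[OF w T(2)]) (auto simp: indicator_def)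
  moreover have "path_avg \<omega> u \<le> (\<Sum>i\<in>{1..Suc n}. Y f i \<omega>)"
    unfolding i(2)[symmetric] path_avg_def
    using T f_bd by (intro integral_mono i path_integrable[OF w T(2)]) (auto simp: indicator_def)
  ultimately show ?thesis by simp
qed

end

text \<open>For the constant function 1 the cycle integrals are the waiting times themselves, so
  \<open>cycle_average\<close> also yields the asymptotics of the jump times that the renewal
  argument requires.\<close>

lemma time_average_nonneg:
  fixes f :: "'n cmat \<Rightarrow> real"
  assumes c: "c > 0" and q: "0 < q" "q < 1" and \<pi>: "is_haar \<pi>"
    and geo: "\<forall>a n B \<phi> r. bm B \<phi> \<longrightarrow> osc \<phi> r \<longrightarrow> osc (T a n \<phi>) (c * q ^ n * r)"
    and f_meas: "f \<in> borel_measurable borel" and f_bd: "\<And>x. 0 \<le> f x \<and> f x \<le> C"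
  shows "AE \<omega> in M. ((\<lambda>T. (\<integral>s. indicator {0..<T} s * f (Xt H1 H2 \<tau> s \<omega>) \<partial>lborel) / T) \<longlongrightarrow> (\<integral>x. f x \<partial>\<pi>)) at_top
     \<and> (\<forall>T. integrable lborel (\<lambda>s. indicator {0..<T} s * f (Xt H1 H2 \<tau> s \<omega>)))"
proof -
  interpret pi: prob_space \<pi> using \<pi> by (simp add: is_haar_def)
  have "AE \<omega> in M. (\<lambda>n. (\<Sum>i\<in>{1..n}. Y (\<lambda>_. 1) i \<omega>) / real n) \<longlonglongrightarrow> (\<integral>x. 1 \<partial>\<pi>) * m1"
    by (rule cycle_average[where C=1, OF _ _ c q \<pi> geo]) auto
  moreover have "AE \<omega> in M. (\<lambda>n. (\<Sum>i\<in>{1..n}. Y f i \<omega>) / real n) \<longlonglongrightarrow> (\<integral>x. f x \<partial>\<pi>) * m1"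
    by (rule cycle_average[OF f_meas f_bd c q \<pi> geo])
  ultimately show ?thesis
    using AE_space
  proof eventually_elim
    case (elim \<omega>)
    have "Y (\<lambda>_. 1) i \<omega> = \<tau> i \<omega>" if "i \<ge> 1" for i
      using \<tau>_pos[OF that elim(3)] by (simp add: Y_def cyc_def)
    then have "(\<Sum>i\<in>{1..n}. Y (\<lambda>_. 1) i \<omega>) = jump_time \<tau> \<omega> n" for n
      by (simp add: jump_time_def)
    then have tl: "(\<lambda>n. jump_time \<tau> \<omega> n / real n) \<longlonglongrightarrow> m1" using elim(1) by (simp add: pi.prob_space)
    have "((\<lambda>T. path_avg f \<omega> T / T) \<longlongrightarrow> (\<integral>x. f x \<partial>\<pi>)) at_top"
      by (rule renewal_limit[OF jump_time_0 jump_time_strict_mono[OF elim(3)] m1_pos tl elim(2)])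
        (use Y_bounds[OF f_meas f_bd] elim(3) path_avg_sandwich[OF f_meas f_bd elim(3)] in \<open>auto intro!: sum_nonneg\<close>)
    moreover have "integrable lborel (\<lambda>s. indicator {0..<T} s * f (Xt H1 H2 \<tau> s \<omega>))" for T
    proof -
      have "filterlim (\<lambda>n. jump_time \<tau> \<omega> n / real n * real n) at_top sequentially"
        using tl m1_pos filterlim_real_sequentially by (rule filterlim_tendsto_pos_mult_at_top)
      then have "eventually (\<lambda>n. T + 1 \<le> jump_time \<tau> \<omega> n / real n * real n) sequentially"
        by (simp add: filterlim_at_top)
      then obtain N where N: "\<And>n. n \<ge> N \<Longrightarrow> T + 1 \<le> jump_time \<tau> \<omega> n / real n * real n"
        by (auto simp: eventually_sequentially)
      have "T < jump_time \<tau> \<omega> (Suc N)" using N[of "Suc N"] by simp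
      then show ?thesis by (rule path_integrable[OF f_meas f_bd elim(3)])
    qed
    ultimately show ?case by (simp add: path_avg_def[OF f_meas f_bd])
  qed
qed

lemma time_average:
  fixes f :: "'n cmat \<Rightarrow> real"
  assumes c: "c > 0" and q: "0 < q" "q < 1" and \<pi>: "is_haar \<pi>"
    and geo: "\<forall>a n B \<phi> r. bm B \<phi> \<longrightarrow> osc \<phi> r \<longrightarrow> osc (T a n \<phi>) (c * q ^ n * r)"
    and f_meas: "f \<in> borel_measurable U_borel" and f_bd: "bounded (f ` unitary_group)"
  shows "AE \<omega> in M. ((\<lambda>T. (1 / T) * (LBINT t=0..ereal T. f (Xt H1 H2 \<tau> t \<omega>))) \<longlongrightarrow> integral\<^sup>L \<pi> f) at_top"
proof -
  interpret pi: prob_space \<pi> using \<pi> by (simp add: is_haar_def)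
  obtain b where b: "\<And>x. x \<in> unitary_group \<Longrightarrow> \<bar>f x\<bar> \<le> b"
    using f_bd unfolding bounded_iff by auto
  have b0: "b \<ge> 0" using b[OF unitary_one] by simp
  \<comment> \<open>Adding \<open>b\<close> makes the function nonnegative on the group, and
    extension by 0 makes it Borel on all matrices. The path stays in the group, so along it only the
    shift by \<open>b\<close> is visible.\<close>
  define h where "h x = (f x + b) * indicator unitary_group x" for x
  have "(\<lambda>x. f x + b) \<in> borel_measurable (restrict_space borel unitary_group)"
    using f_meas unfolding U_borel_def by measurable
  then have hm: "h \<in> borel_measurable borel"
    by (subst (asm) borel_measurable_restrict_space_iff) (auto simp: h_def[abs_def] mult.commute)
  have hb: "0 \<le> h x \<and> h x \<le> 2 * b" for x
    using b[of x] b0 by (auto simp: h_def indicator_def abs_le_iff)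
  have sp: "space \<pi> = unitary_group" "sets \<pi> = sets U_borel" using \<pi> by (auto simp: is_haar_def)
  have fi: "integrable \<pi> f"
  proof (rule pi.integrable_const_bound[of _ b])
    show "f \<in> borel_measurable \<pi>" using f_meas sp(2) by (simp cong: measurable_cong_sets)
  qed (use b sp in auto)
  have hf: "(\<integral>x. h x \<partial>\<pi>) = (\<integral>x. f x \<partial>\<pi>) + b"
  proof -
    have "(\<integral>x. h x \<partial>\<pi>) = (\<integral>x. f x + b \<partial>\<pi>)"
      by (rule Bochner_Integration.integral_cong) (auto simp: h_def sp)
    then show ?thesis using fi by (simp add: pi.prob_space)
  qed
  from time_average_nonneg[OF c q \<pi> geo hm hb] show ?thesis
  proof eventually_elim
    case (elim \<omega>)
    let ?F = "\<lambda>T. \<integral>s. indicator {0..<T} s * h (Xt H1 H2 \<tau> s \<omega>) \<partial>lborel"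
    have paths: "integrable lborel (\<lambda>s. indicator {0..<T} s * h (Xt H1 H2 \<tau> s \<omega>))" for T
      using elim by blast
    have "((\<lambda>T. ?F T / T - b) \<longlongrightarrow> (\<integral>x. h x \<partial>\<pi>) - b) at_top"
      using elim by (intro tendsto_diff tendsto_const) auto
    then have lim: "((\<lambda>T. ?F T / T - b) \<longlongrightarrow> integral\<^sup>L \<pi> f) at_top" by (simp add: hf)
    have "eventually (\<lambda>T. ?F T / T - b = (1 / T) * (LBINT t=0..ereal T. f (Xt H1 H2 \<tau> t \<omega>))) at_top"
      using eventually_gt_at_top[of 0]
    proof eventually_elim
      case (elim T)
      note T = elim
      have bi: "integrable lborel (\<lambda>s. b * indicator {0..<T} s :: real)"
        using T by (intro integrable_mult_right integrable_real_indicator) auto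
      \<comment> \<open>The interval integral runs over the open interval, the cycle integrals over
        half-open ones; the point 0 is split off and contributes nothing.\<close>
      have zi: "integrable lborel (\<lambda>s. indicator {0::real} s * f (Xt H1 H2 \<tau> 0 \<omega>))"
        by (intro integrable_mult_left integrable_real_indicator) auto
      note hi = paths[of T]
      have "(LBINT t=0..ereal T. f (Xt H1 H2 \<tau> t \<omega>)) = (\<integral>s. indicator {0<..<T} s * f (Xt H1 H2 \<tau> s \<omega>) \<partial>lborel)"
        using T by (simp add: interval_lebesgue_integral_def set_lebesgue_integral_def zero_ereal_def)
      also have "\<dots> = (\<integral>s. indicator {0..<T} s * h (Xt H1 H2 \<tau> s \<omega>) - b * indicator {0..<T} s \<partial>lborel)"
      proof -
        have "indicator {0<..<T} s * f (Xt H1 H2 \<tau> s \<omega>)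
            = indicator {0..<T} s * h (Xt H1 H2 \<tau> s \<omega>) - b * indicator {0..<T} s - indicator {0} s * f (Xt H1 H2 \<tau> 0 \<omega>)" for s
          using Xt_unitary[of s \<omega>] T by (auto simp: h_def indicator_def algebra_simps)
        then have "(\<integral>s. indicator {0<..<T} s * f (Xt H1 H2 \<tau> s \<omega>) \<partial>lborel)
            = (\<integral>s. indicator {0..<T} s * h (Xt H1 H2 \<tau> s \<omega>) - b * indicator {0..<T} s - indicator {0} s * f (Xt H1 H2 \<tau> 0 \<omega>) \<partial>lborel)"
          by simp
        also have "\<dots> = (\<integral>s. indicator {0..<T} s * h (Xt H1 H2 \<tau> s \<omega>) - b * indicator {0..<T} s \<partial>lborel)
            - (\<integral>s. indicator {0::real} s * f (Xt H1 H2 \<tau> 0 \<omega>) \<partial>lborel)"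
          using Bochner_Integration.integral_diff[OF Bochner_Integration.integrable_diff[OF hi bi] zi] .
        also have "(\<integral>s. indicator {0::real} s * f (Xt H1 H2 \<tau> 0 \<omega>) \<partial>lborel) = 0" by simp
        finally show ?thesis by simp
      qed
      also have "\<dots> = ?F T - (\<integral>s. b * indicator {0..<T} s \<partial>lborel)"
        by (rule Bochner_Integration.integral_diff[OF hi bi])
      also have "\<dots> = ?F T - b * T" using T by simp
      finally show ?case using T by (simp add: field_simps)
    qed
    from Lim_transform_eventually[OF lim this] show ?case .
  qed
qed

end

theorem mainTheorem9:
  fixes M :: "'w measure" and \<tau> :: "nat \<Rightarrow> 'w \<Rightarrow> real" and p :: "real \<Rightarrow> ennreal"
    and H1 H2 :: "'n::finite cmat" and \<pi> :: "'n cmat measure"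
  assumes N: "CARD('n) > 1"
    and herm: "hermitian H1" "hermitian H2"
    and ctrl: "U_controllable H1 H2"
    and P: "prob_space M"
    and indep: "prob_space.indep_vars M (\<lambda>_. borel) \<tau> {1..}"
    and ident: "\<forall>i\<ge>1. distr M borel (\<tau> i) = distr M borel (\<tau> 1)"
    and pos: "\<forall>i\<ge>1. \<forall>\<omega>\<in>space M. \<tau> i \<omega> > 0"
    and mean: "integrable M (\<tau> 1)"
    and dens: "distributed M lborel (\<tau> 1) p"
    and dens_pos: "\<forall>x\<ge>0. p x > 0"
    and haar: "is_haar \<pi>"
  shows "(\<exists>c q. c > 0 \<and> 0 < q \<and> q < 1 \<and>
            (\<forall>n\<ge>1. \<forall>A\<in>sets U_borel.
               \<bar>measure M {\<omega>\<in>space M. Xn H1 H2 \<tau> n \<omega> \<in> A} - measure \<pi> A\<bar> \<le> c * q ^ n))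
       \<and> (\<forall>f :: 'n cmat \<Rightarrow> real. f \<in> borel_measurable U_borel \<longrightarrow> bounded (f ` unitary_group) \<longrightarrow>
            (AE \<omega> in M. ((\<lambda>T. (1 / T) * (LBINT t=0..T. f (Xt H1 H2 \<tau> t \<omega>)))
                           \<longlongrightarrow> integral\<^sup>L \<pi> f) at_top))"
proof -
  interpret M: prob_space M by (rule P)
  have \<tau>1: "\<tau> 1 \<in> borel_measurable M" using indep by (auto simp: M.indep_vars_def)
  have p_meas: "p \<in> borel_measurable borel"
    using distributed_borel_measurable[OF dens] by simp
  have \<mu>: "distr M borel (\<tau> 1) = density lborel p"
    using distributed_distr_eq_density[OF dens] by (simp cong: distr_cong)
  have prob: "prob_space (density lborel p)"
    using M.prob_space_distr[OF \<tau>1] unfolding \<mu> .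
  interpret pd: prob_space "density lborel p" by (rule prob)
  interpret jump_process H1 H2 "density lborel p" p M \<tau>
  proof
    show "hermitian H1" "hermitian H2" by (fact herm)+
    show "p \<in> borel_measurable borel" by (fact p_meas)
    show "0 < p x" if "0 \<le> x" for x using dens_pos that by blast
    show "M.indep_vars (\<lambda>_. borel) \<tau> {1..}" by (fact indep)
    show "distr M borel (\<tau> i) = density lborel p" if "1 \<le> i" for i
      using ident[rule_format, OF that] \<mu> by (rule trans)
    show "0 < \<tau> i \<omega>" if "1 \<le> i" "\<omega> \<in> space M" for i \<omega> using pos that by blast
    show "integrable M (\<tau> 1)" by (fact mean)
  qed simp_all
  obtain m where m: "even m" "m \<ge> 2" "reach m" by (rule reach_even[OF ctrl])
  obtain c q where cq: "c > 0" "0 < q" "q < 1"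
    and geo: "\<forall>a n B \<phi> r. bm B \<phi> \<longrightarrow> osc \<phi> r \<longrightarrow> osc (T a n \<phi>) (c * q ^ n * r)"
    using geometric_osc[OF m] by blast
  have part1: "\<bar>measure M {\<omega>\<in>space M. Xn H1 H2 \<tau> n \<omega> \<in> A} - measure \<pi> A\<bar> \<le> c * q ^ n" if A: "A \<in> sets U_borel" for n A
  proof -
    have Ab: "A \<in> sets borel" and AU: "A \<subseteq> unitary_group"
      using A by (auto simp: U_borel_def sets_restrict_space)
    interpret pi: prob_space \<pi> using haar by (simp add: is_haar_def)
    have sp: "space \<pi> = unitary_group" "sets \<pi> = sets U_borel" using haar by (auto simp: is_haar_def)
    have "measure M {\<omega>\<in>space M. Xn H1 H2 \<tau> n \<omega> \<in> A} = (\<integral>\<omega>. indicator {\<omega>\<in>space M. Xn H1 H2 \<tau> n \<omega> \<in> A} \<omega> \<partial>M)"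
      by (simp add: Int_absorb2 subset_eq)
    also have "\<dots> = (\<integral>\<omega>. indicator A (X n \<omega>) \<partial>M)"
      by (rule Bochner_Integration.integral_cong) (auto simp: indicator_def X_def J_def Xn_def)
    also have "\<dots> = T 0 n (indicator A) (mat 1)" by (rule expectation_X[OF bm_indicator[OF Ab]])
    finally have 1: "measure M {\<omega>\<in>space M. Xn H1 H2 \<tau> n \<omega> \<in> A} = T 0 n (indicator A) (mat 1)" .
    \<comment> \<open>Every indicator has oscillation at most 1, which makes the constants the same
      for all Borel sets.\<close>
    have "osc (indicator A) 1" by (auto simp: osc_def indicator_def)
    then have "osc (T 0 n (indicator A)) (c * q ^ n * 1)" using geo bm_indicator[OF Ab] by blast
    from T_haar[OF haar bm_indicator[OF Ab] this unitary_one]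
    show ?thesis using AU by (simp add: 1 sp Int_absorb2)
  qed
  have part2: "AE \<omega> in M. ((\<lambda>T. (1 / T) * (LBINT t=0..ereal T. f (Xt H1 H2 \<tau> t \<omega>))) \<longlongrightarrow> integral\<^sup>L \<pi> f) at_top"
    if "f \<in> borel_measurable U_borel" "bounded (f ` unitary_group)" for f :: "'n cmat \<Rightarrow> real"
    by (rule time_average[OF cq haar geo that])
  show ?thesis
  proof (rule conjI, goal_cases)
    case 1
    show ?case
      by (rule exI[of _ c], rule exI[of _ q]) (simp add: cq part1)
  next
    case 2
    show ?case by (intro allI impI part2)
  qed
qed

end
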